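(* Let $1<p<\infty$. There exists a reflexive infinite dimensional Banach space $X$ which is not asymptotically symmetric and yet satisfies the following: every normalized basic sequence in $X$ admits a subsequence that is $4$-equivalent to the unit vector basis of $\ell_p$.
   Context: A Banach space $X$ is asymptotically symmetric if there is $C<\infty$ such that for all $m\in\mathbb{N}$, all bounded sequences $(x_n^i)_{n=1}^\infty\subseteq X$, $1\le i\le m$, and all permutations $\sigma$ of $\{1,\ldots,m\}$, $$\lim_{n_1\to\infty}\cdots\lim_{n_m\to\infty}\Big\|\sum_{i=1}^m x_{n_i}^i\Big\|\le C\lim_{n_{\sigma(1)}\to\infty}\cdots\lim_{n_{\sigma(m)}\to\infty}\Big\|\sum_{i=1}^m x_{n_i}^i\Big\|,$$ provided that these iterated limits exist. Two sequences $(x_i)$ and $(y_i)$ are $K$-equivalent if there are $A,B>0$ with $AB\le K$ such that $A^{-1}\|\sum a_iy_i\|\le\|\sum a_ix_i\|\le B\|\sum a_iy_i\|$ for all finitely supported scalar sequences $(a_i)$. *)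

theory Defs
  imports "HOL-Analysis.Analysis" "HOL-Library.Function_Algebras"
begin

text \<open>Functions into a real vector space form a real vector space under pointwise operations.
  Sequence spaces and dual spaces below live in such function types.\<close>

instantiation "fun" :: (type, real_vector) real_vector
begin

definition scaleR_fun_def: "c *\<^sub>R f = (\<lambda>x. c *\<^sub>R f x)"

instance
  by standard (simp_all add: scaleR_fun_def fun_eq_iff scaleR_add_right scaleR_add_left)

end

section \<open>Normed spaces on carrier sets\<close>

text \<open>A (real) normed space is given by a linear subspace \<open>V\<close> of an ambient real vector space
  and a norm \<open>N\<close> on \<open>V\<close>; the ambient type carries no norm or topology of its own, and the values
  of \<open>N\<close> outside \<open>V\<close> are irrelevant.  This makes it possible to quantify over spaces.\<close>

definition normed_space_on :: "'a::real_vector set \<Rightarrow> ('a \<Rightarrow> real) \<Rightarrow> bool" where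
  "normed_space_on V N \<longleftrightarrow>
     subspace V \<and>
     (\<forall>x\<in>V. N x = 0 \<longleftrightarrow> x = 0) \<and>
     (\<forall>c. \<forall>x\<in>V. N (c *\<^sub>R x) = \<bar>c\<bar> * N x) \<and>
     (\<forall>x\<in>V. \<forall>y\<in>V. N (x + y) \<le> N x + N y)"

definition banach_space_on :: "'a::real_vector set \<Rightarrow> ('a \<Rightarrow> real) \<Rightarrow> bool" where
  "banach_space_on V N \<longleftrightarrow>
     normed_space_on V N \<and>
     (\<forall>s::nat \<Rightarrow> 'a. (\<forall>n. s n \<in> V) \<and> (\<forall>\<epsilon>>0. \<exists>M. \<forall>m\<ge>M. \<forall>n\<ge>M. N (s m - s n) < \<epsilon>)
        \<longrightarrow> (\<exists>x\<in>V. (\<lambda>n. N (s n - x)) \<longlonglongrightarrow> 0))"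

definition infinite_dimensional :: "'a::real_vector set \<Rightarrow> bool" where
  "infinite_dimensional V \<longleftrightarrow> \<not> (\<exists>B. finite B \<and> span B = V)"

section \<open>Duality and reflexivity\<close>

text \<open>Continuous linear functionals on \<open>V\<close>, represented as functions on the ambient type that
  vanish outside \<open>V\<close> so that distinct elements of the dual are distinct functions.\<close>

definition dual_carrier :: "'a::real_vector set \<Rightarrow> ('a \<Rightarrow> real) \<Rightarrow> ('a \<Rightarrow> real) set" where
  "dual_carrier V N = {f.
     (\<forall>x\<in>V. \<forall>y\<in>V. f (x + y) = f x + f y) \<and>
     (\<forall>c. \<forall>x\<in>V. f (c *\<^sub>R x) = c * f x) \<and>
     (\<exists>K. \<forall>x\<in>V. \<bar>f x\<bar> \<le> K * N x) \<and>
     (\<forall>x. x \<notin> V \<longrightarrow> f x = 0)}"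

definition dual_norm :: "'a::real_vector set \<Rightarrow> ('a \<Rightarrow> real) \<Rightarrow> ('a \<Rightarrow> real) \<Rightarrow> real" where
  "dual_norm V N f = (SUP x\<in>{x \<in> V. N x \<le> 1}. \<bar>f x\<bar>)"

text \<open>The canonical map of the space into its bidual is onto.\<close>

definition reflexive_space :: "'a::real_vector set \<Rightarrow> ('a \<Rightarrow> real) \<Rightarrow> bool" where
  "reflexive_space V N \<longleftrightarrow>
     (\<forall>\<Phi> \<in> dual_carrier (dual_carrier V N) (dual_norm V N).
        \<exists>x\<in>V. \<forall>f \<in> dual_carrier V N. \<Phi> f = f x)"

section \<open>Basic sequences\<close>

definition closed_span_on :: "'a::real_vector set \<Rightarrow> ('a \<Rightarrow> real) \<Rightarrow> 'a set \<Rightarrow> 'a set" where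
  "closed_span_on V N S = {x \<in> V. \<forall>\<epsilon>>0. \<exists>y \<in> span S. N (x - y) < \<epsilon>}"

text \<open>A basic sequence is a Schauder basis of its closed linear span.\<close>

definition basic_sequence :: "'a::real_vector set \<Rightarrow> ('a \<Rightarrow> real) \<Rightarrow> (nat \<Rightarrow> 'a) \<Rightarrow> bool" where
  "basic_sequence V N x \<longleftrightarrow>
     (\<forall>n. x n \<in> V) \<and>
     (\<forall>v \<in> closed_span_on V N (range x).
        \<exists>!a::nat \<Rightarrow> real. (\<lambda>n. N (v - (\<Sum>i<n. a i *\<^sub>R x i))) \<longlonglongrightarrow> 0)"

definition normalized :: "('a \<Rightarrow> real) \<Rightarrow> (nat \<Rightarrow> 'a) \<Rightarrow> bool" where
  "normalized N x \<longleftrightarrow> (\<forall>n. N (x n) = 1)"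

text \<open>The sequence \<open>x\<close>, measured by \<open>N\<close>, is \<open>K\<close>-equivalent to the sequence \<open>y\<close>, measured by \<open>N'\<close>.\<close>

definition K_equivalent ::
  "real \<Rightarrow> ('a::real_vector \<Rightarrow> real) \<Rightarrow> (nat \<Rightarrow> 'a) \<Rightarrow> ('b::real_vector \<Rightarrow> real) \<Rightarrow> (nat \<Rightarrow> 'b) \<Rightarrow> bool" where
  "K_equivalent K N x N' y \<longleftrightarrow>
     (\<exists>A>0. \<exists>B>0. A * B \<le> K \<and>
        (\<forall>a::nat \<Rightarrow> real. finite {i. a i \<noteq> 0} \<longrightarrow>
           inverse A * N' (\<Sum>i | a i \<noteq> 0. a i *\<^sub>R y i) \<le> N (\<Sum>i | a i \<noteq> 0. a i *\<^sub>R x i) \<and>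
           N (\<Sum>i | a i \<noteq> 0. a i *\<^sub>R x i) \<le> B * N' (\<Sum>i | a i \<noteq> 0. a i *\<^sub>R y i)))"

text \<open>The norm of \<open>\<ell>\<^sub>p\<close>, meaningful on sequences whose \<open>p\<close>-th powers are summable,
  and its unit vector basis.\<close>

definition lp_norm :: "real \<Rightarrow> (nat \<Rightarrow> real) \<Rightarrow> real" where
  "lp_norm p a = (\<Sum>i. \<bar>a i\<bar> powr p) powr (1 / p)"

definition unit_vector :: "nat \<Rightarrow> nat \<Rightarrow> real" where
  "unit_vector i = (\<lambda>j. if j = i then 1 else 0)"

section \<open>Asymptotic symmetry\<close>

text \<open>\<open>has_iterated_limit F [i\<^sub>1, \<dots>, i\<^sub>k] n L\<close> says that the iterated limit of \<open>F n\<close>, where first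
  (innermost) the coordinate \<open>n i\<^sub>k\<close> tends to infinity and last (outermost) \<open>n i\<^sub>1\<close>, exists and
  equals \<open>L\<close>; the coordinates of \<open>n\<close> that are not listed are held fixed.\<close>

primrec has_iterated_limit ::
  "((nat \<Rightarrow> nat) \<Rightarrow> real) \<Rightarrow> nat list \<Rightarrow> (nat \<Rightarrow> nat) \<Rightarrow> real \<Rightarrow> bool" where
  "has_iterated_limit F [] n L \<longleftrightarrow> F n = L"
| "has_iterated_limit F (i # is) n L \<longleftrightarrow>
     (\<exists>g. (\<forall>k. has_iterated_limit F is (n(i := k)) (g k)) \<and> g \<longlonglongrightarrow> L)"

text \<open>Below \<open>[1..<Suc m]\<close> is the list \<open>1, \<dots>, m\<close>, and \<open>x i\<close> is the \<open>i\<close>-th sequence.  The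
  starting index vector is irrelevant, since all relevant coordinates get overwritten.\<close>

definition asymptotically_symmetric :: "'a::real_vector set \<Rightarrow> ('a \<Rightarrow> real) \<Rightarrow> bool" where
  "asymptotically_symmetric V N \<longleftrightarrow>
     (\<exists>C::real. \<forall>(m::nat) (x :: nat \<Rightarrow> nat \<Rightarrow> 'a) \<sigma> L L'.
        (\<forall>i\<in>{1..m}. (\<forall>n. x i n \<in> V) \<and> (\<exists>M. \<forall>n. N (x i n) \<le> M)) \<and>
        \<sigma> permutes {1..m} \<and>
        has_iterated_limit (\<lambda>n. N (\<Sum>i=1..m. x i (n i))) [1..<Suc m] (\<lambda>_. 0) L \<and>
        has_iterated_limit (\<lambda>n. N (\<Sum>i=1..m. x i (n i))) (map \<sigma> [1..<Suc m]) (\<lambda>_. 0) L'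
        \<longrightarrow> L \<le> C * L')"

end

theory Submission
  imports Defs "HOL-Library.Diagonal_Subsequence"
begin

text \<open>The space consists of real sequences.  Every index carries a label, each label occurs
  infinitely often, and a finite set of indices is called descending if the labels strictly decrease
  along it.  The norm has three layers: the \<open>\<ell>\<^sub>r\<close> norm on a descending set; the \<open>\<ell>\<^sub>t\<close> sum of these
  over a packing, that is, over descending sets that share no labels; and the \<open>\<ell>\<^sub>p\<close> sum of these
  over a chain of packings that follow one another on the index line.  The norm of a sequence is the
  supremum over all chains, where \<open>1/r = 1/p + 1/t\<close> and \<open>t \<ge> p\<close>.

  \<^emph>\<open>Asymmetry.\<close>  Take \<open>m\<close> unit vectors with distinct labels.  If the labels decrease, they form one
  descending set and the sum has norm at least \<open>m powr (1/r)\<close>.  If the labels increase, a descending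
  set meets at most one of them and the norm is at most \<open>m powr (1/p)\<close>.  Both arrangements are
  iterated limits of the same \<open>m\<close> sequences (each sequence runs through the unit vectors of one label)
  in opposite orders, so no constant works for all \<open>m\<close>.

  \<^emph>\<open>Subsequences.\<close>  Let \<open>y\<^sub>k\<close> be successive blocks of norm at most one.  Chains living on different
  blocks can be joined, which gives a lower \<open>\<ell>\<^sub>p\<close> estimate with constant one.  For the upper estimate
  of \<open>v = \<Sum>k. a\<^sub>k y\<^sub>k\<close>, split \<open>v\<close> on each descending set into the part on the first block that the set
  meets and the rest.  The first parts contribute at most the \<open>\<ell>\<^sub>p\<close> norm of \<open>a\<close>, because \<open>t \<ge> p\<close>
  allows the sum over blocks to be pulled out.  In a later block the labels of the set lie below a
  label met earlier, hence in a finite set that is known before the block is chosen.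
  So after passing to a subsequence one may assume that the largest \<open>\<ell>\<^sub>r\<close> norm of \<open>y\<^sub>k\<close> on a
  descending set with labels in \<open>J\<close> is essentially a number \<open>w J\<close> independent of \<open>k\<close>.  Hoelder's
  inequality bounds the rest by the \<open>\<ell>\<^sub>p\<close> norm of \<open>a\<close> times an \<open>\<ell>\<^sub>t\<close> sum of numbers \<open>w J\<close>
  over disjoint sets \<open>J\<close>, and the latter sum is about one at most because a single block realizes all
  these \<open>w J\<close> by one packing.  Finally a block can be a later block for only one packing of the
  chain.  Altogether the upper constant is close to two (lemmas \<open>upper_estimate\<close>,
  \<open>stable_profile\<close>, \<open>lp_subsequence\<close>).

  \<^emph>\<open>Reflexivity.\<close>  The unit vectors are a boundedly complete basis by the definition of the norm as a
  supremum and the lower estimate, and a shrinking one by the upper estimate, since \<open>p > 1\<close>.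

  \<^emph>\<open>Basic sequences.\<close>  The subsequence result needs a coordinatewise null sequence.  A normalized basic
  sequence is one: a subsequence converges coordinatewise to some \<open>z\<close>, its differences
  from \<open>z\<close> have Cesaro means tending to zero by the upper estimate, so \<open>z\<close> lies in the closed span of
  every tail; as the coefficient functionals of a basic sequence are bounded (a Baire category
  argument), all coefficients of \<open>z\<close> vanish.\<close>

section \<open>The \<open>\<ell>\<^sub>s\<close> norm of a finite family\<close>

definition pnorm :: "real \<Rightarrow> 'i set \<Rightarrow> ('i \<Rightarrow> real) \<Rightarrow> real" where
  "pnorm s A u = (\<Sum>a\<in>A. \<bar>u a\<bar> powr s) powr (1 / s)"

lemma pnorm_nonneg [simp]: "0 \<le> pnorm s A u"
  by (simp add: pnorm_def)

lemma abs_pnorm [simp]: "\<bar>pnorm s A u\<bar> = pnorm s A u"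
  by simp

lemma pnorm_empty [simp]: "pnorm s {} u = 0"
  by (simp add: pnorm_def)

lemma pnorm_powr: "0 < s \<Longrightarrow> pnorm s A u powr s = (\<Sum>a\<in>A. \<bar>u a\<bar> powr s)"
  by (simp add: pnorm_def powr_powr sum_nonneg)

lemma pnorm_cong: "A = B \<Longrightarrow> (\<And>a. a \<in> B \<Longrightarrow> \<bar>u a\<bar> = \<bar>v a\<bar>) \<Longrightarrow> pnorm s A u = pnorm s B v"
  by (simp add: pnorm_def)

lemma le_if_powr_le:
  fixes x y s :: real
  assumes "0 < s" "x powr s \<le> y powr s" "0 \<le> x" "0 \<le> y"
  shows "x \<le> y"
  using assms powr_less_mono2[of s y x] by (meson linorder_not_le)

lemma pnorm_le_iff:
  assumes "0 < s" "0 \<le> C"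
  shows "pnorm s A u \<le> C \<longleftrightarrow> (\<Sum>a\<in>A. \<bar>u a\<bar> powr s) \<le> C powr s"
  using assms pnorm_powr[of s A u] powr_mono2[of s "pnorm s A u" C]
    le_if_powr_le[of s "pnorm s A u" C] by auto

lemma pnorm_mono:
  assumes "0 < s" "\<And>a. a \<in> A \<Longrightarrow> \<bar>u a\<bar> \<le> \<bar>v a\<bar>"
  shows "pnorm s A u \<le> pnorm s A v"
  using assms by (auto simp: pnorm_le_iff pnorm_powr intro!: sum_mono powr_mono2)

lemma pnorm_subset:
  assumes "0 < s" "finite B" "A \<subseteq> B"
  shows "pnorm s A u \<le> pnorm s B u"
  using assms by (auto simp: pnorm_le_iff pnorm_powr intro!: sum_mono2)

lemma pnorm_neutral:
  assumes "finite B" "A \<subseteq> B" "\<And>a. a \<in> B - A \<Longrightarrow> u a = 0"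
  shows "pnorm s A u = pnorm s B u"
  unfolding pnorm_def using assms by (subst sum.mono_neutral_left[of B A]) auto

lemma pnorm_member:
  assumes "0 < s" "finite A" "a \<in> A"
  shows "\<bar>u a\<bar> \<le> pnorm s A u"
proof -
  have "pnorm s {a} u = \<bar>u a\<bar>" using assms by (simp add: pnorm_def powr_powr)
  then show ?thesis using pnorm_subset[of s A "{a}" u] assms by auto
qed

lemma pnorm_scale: "0 < s \<Longrightarrow> pnorm s A (\<lambda>a. c * u a) = \<bar>c\<bar> * pnorm s A u"
  by (simp add: pnorm_def abs_mult powr_mult powr_powr sum_nonneg flip: sum_distrib_left)

lemma pnorm_scale_right: "0 < s \<Longrightarrow> pnorm s A (\<lambda>a. u a * c) = pnorm s A u * \<bar>c\<bar>"
  using pnorm_scale[of s A c u] by (simp add: mult.commute)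

lemma pnorm_reindex_nontrivial:
  assumes "finite A" "\<And>x y. x \<in> A \<Longrightarrow> y \<in> A \<Longrightarrow> x \<noteq> y \<Longrightarrow> h x = h y \<Longrightarrow> u (h x) = 0"
  shows "pnorm s (h ` A) u = pnorm s A (\<lambda>x. u (h x))"
  unfolding pnorm_def using assms by (subst sum.reindex_nontrivial) (auto simp: o_def)

lemma pnorm_reindex: "inj_on h A \<Longrightarrow> pnorm s (h ` A) u = pnorm s A (\<lambda>x. u (h x))"
  by (simp add: pnorm_def sum.reindex o_def)

lemma pnorm_Sigma:
  assumes "0 < s" "finite A" "\<And>a. a \<in> A \<Longrightarrow> finite (B a)"
  shows "pnorm s A (\<lambda>a. pnorm s (B a) (u a)) = pnorm s (Sigma A B) (\<lambda>(a,b). u a b)"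
  using assms by (simp add: pnorm_def[of s A] pnorm_powr pnorm_def[of s "Sigma A B"] sum.Sigma split_def)

lemma pnorm_swap:
  assumes "0 < s" "finite A" "finite B"
  shows "pnorm s A (\<lambda>a. pnorm s B (u a)) = pnorm s B (\<lambda>b. pnorm s A (\<lambda>a. u a b))"
  using assms by (simp add: pnorm_def[of s A "\<lambda>a. pnorm s B (u a)"] pnorm_def[of s B "\<lambda>b. pnorm s A (\<lambda>a. u a b)"] pnorm_powr)
     (subst sum.swap, rule refl)

lemma pnorm_UN:
  assumes "0 < s" "finite I" "\<And>i. i \<in> I \<Longrightarrow> finite (A i)"
    and "\<And>i j. i \<in> I \<Longrightarrow> j \<in> I \<Longrightarrow> i \<noteq> j \<Longrightarrow> A i \<inter> A j = {}"
  shows "pnorm s (\<Union>i\<in>I. A i) u = pnorm s I (\<lambda>i. pnorm s (A i) u)"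
  using assms by (simp add: pnorm_def[of s "\<Union>i\<in>I. A i"] pnorm_def[of s I] pnorm_powr sum.UNION_disjoint)

lemma pnorm_exponent_mono:
  assumes "0 < s" "s \<le> s'" "finite A"
  shows "pnorm s' A u \<le> pnorm s A u"
proof (cases "pnorm s A u = 0")
  case True
  then have "\<And>a. a \<in> A \<Longrightarrow> u a = 0" using pnorm_member[OF assms(1,3)] by (metis abs_le_zero_iff)
  then have "pnorm s' A u = 0" by (simp add: pnorm_def)
  then show ?thesis using True by simp
next
  case False
  define c where "c = pnorm s A u"
  have c: "c > 0" using False pnorm_nonneg[of s A u] unfolding c_def by linarith
  have "\<bar>u a\<bar> powr s' \<le> c powr (s' - s) * \<bar>u a\<bar> powr s" if "a \<in> A" for a
  proof (cases "u a = 0")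
    case False
    have "\<bar>u a\<bar> powr s' = \<bar>u a\<bar> powr (s' - s) * \<bar>u a\<bar> powr s"
      by (simp flip: powr_add)
    also have "\<dots> \<le> c powr (s' - s) * \<bar>u a\<bar> powr s"
      using assms pnorm_member[OF assms(1,3) that, of u] unfolding c_def
      by (intro mult_right_mono powr_mono2) auto
    finally show ?thesis .
  qed simp
  then have "(\<Sum>a\<in>A. \<bar>u a\<bar> powr s') \<le> c powr (s' - s) * (\<Sum>a\<in>A. \<bar>u a\<bar> powr s)"
    by (simp add: sum_distrib_left sum_mono)
  also have "\<dots> = c powr (s' - s) * c powr s"
    using assms by (simp add: c_def pnorm_powr)
  also have "\<dots> = c powr s'" by (simp flip: powr_add)
  finally show ?thesis using assms c by (simp add: pnorm_le_iff c_def)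
qed

lemma pnorm_Holder_conjugate:
  assumes s: "1 < s" "1 < s'" "1 / s + 1 / s' = 1" and fin: "finite A"
  shows "(\<Sum>a\<in>A. \<bar>u a * v a\<bar>) \<le> pnorm s A u * pnorm s' A v"
proof (cases "pnorm s A u = 0 \<or> pnorm s' A v = 0")
  case True
  then have "u a * v a = 0" if "a \<in> A" for a
    using pnorm_member[of s A a u] pnorm_member[of s' A a v] that s fin by fastforce
  then have "(\<Sum>a\<in>A. \<bar>u a * v a\<bar>) = 0" by (auto intro!: sum.neutral)
  then show ?thesis using mult_nonneg_nonneg[OF pnorm_nonneg pnorm_nonneg] by metis
next
  case False
  define c d where "c = pnorm s A u" and "d = pnorm s' A v"
  have c: "c > 0" "d > 0" using False pnorm_nonneg[of s A u] pnorm_nonneg[of s' A v]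
    unfolding c_def d_def by linarith+
  have "(\<Sum>a\<in>A. (\<bar>u a\<bar> / c) * (\<bar>v a\<bar> / d))
      \<le> (\<Sum>a\<in>A. (\<bar>u a\<bar> / c) powr s / s + (\<bar>v a\<bar> / d) powr s' / s')"
    using s c by (intro sum_mono Youngs_inequality) auto
  also have "\<dots> = (\<Sum>a\<in>A. \<bar>u a\<bar> powr s) / (c powr s) / s + (\<Sum>a\<in>A. \<bar>v a\<bar> powr s') / (d powr s') / s'"
    using c by (simp add: sum.distrib powr_divide sum_divide_distrib)
  also have "\<dots> = 1 / s + 1 / s'"
    using s c by (simp add: c_def d_def flip: pnorm_powr)
  finally have "(\<Sum>a\<in>A. \<bar>u a * v a\<bar> / (c * d)) \<le> 1"
    using s by (simp add: abs_mult)
  then have "(\<Sum>a\<in>A. \<bar>u a * v a\<bar>) / (c * d) \<le> 1" by (simp add: sum_divide_distrib)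
  then show ?thesis using c by (simp add: c_def[symmetric] d_def[symmetric])
qed

lemma pnorm_Holder:
  assumes r: "0 < r" "0 < s" "0 < s'" "1 / r = 1 / s + 1 / s'" and fin: "finite A"
  shows "pnorm r A (\<lambda>a. u a * v a) \<le> pnorm s A u * pnorm s' A v"
proof -
  have sr: "s > r" "s' > r"
    using r by (metis add_less_cancel_left add.right_neutral add.left_neutral add_less_cancel_right frac_less2 less_divide_eq_1_pos zero_less_divide_1_iff
        less_imp_inverse_less inverse_eq_divide inverse_less_imp_less)+
  have "(\<Sum>a\<in>A. \<bar>\<bar>u a\<bar> powr r * \<bar>v a\<bar> powr r\<bar>) \<le> pnorm (s / r) A (\<lambda>a. \<bar>u a\<bar> powr r) * pnorm (s' / r) A (\<lambda>a. \<bar>v a\<bar> powr r)"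
    using r sr fin by (intro pnorm_Holder_conjugate) (auto simp: field_simps)
  also have "pnorm (s / r) A (\<lambda>a. \<bar>u a\<bar> powr r) = pnorm s A u powr r"
    using r by (simp add: pnorm_def powr_powr)
  also have "pnorm (s' / r) A (\<lambda>a. \<bar>v a\<bar> powr r) = pnorm s' A v powr r"
    using r by (simp add: pnorm_def powr_powr)
  finally show ?thesis using r
    by (simp add: pnorm_le_iff abs_mult powr_mult)
qed

text \<open>For \<open>s > 1\<close> the coefficients are the gradient of the norm at the vector of absolute values of \<open>u\<close>.  This single statement yields the
  triangle inequality below, and later the norming functionals needed for reflexivity.\<close>

lemma pnorm_supporting:
  assumes s: "1 \<le> s" and fin: "finite A"
  shows "\<exists>c. (\<forall>a. 0 \<le> c a) \<and> (\<Sum>a\<in>A. c a * \<bar>u a\<bar>) = pnorm s A u \<and>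
    (\<forall>v. (\<Sum>a\<in>A. c a * \<bar>v a\<bar>) \<le> pnorm s A v)"
proof (cases "s = 1")
  case True
  then show ?thesis by (intro exI[of _ "\<lambda>_. 1"]) (simp add: pnorm_def sum_nonneg)
next
  case False
  then have s: "s > 1" using s by simp
  define s' where "s' = s / (s - 1)"
  have s': "s' > 1" "1 / s + 1 / s' = 1" "(s - 1) * s' = s" using s by (auto simp: s'_def field_simps)
  show ?thesis
  proof (cases "pnorm s A u = 0")
    case True
    then show ?thesis by (intro exI[of _ "\<lambda>_. 0"]) simp
  next
    case False
    define m where "m = pnorm s A u"
    have m: "m > 0" using False pnorm_nonneg[of s A u] unfolding m_def by linarith
    have ms: "(\<Sum>a\<in>A. \<bar>u a\<bar> powr s) = m powr s" using s by (simp add: m_def pnorm_powr)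
    define c where "c a = \<bar>u a\<bar> powr (s - 1) / m powr (s - 1)" for a
    have "\<bar>x\<bar> powr (s - 1) * \<bar>x\<bar> = \<bar>x\<bar> powr s" for x :: real
      using powr_add[of "\<bar>x\<bar>" "s - 1" 1] s by (cases "x = 0") simp_all
    then have "(\<Sum>a\<in>A. c a * \<bar>u a\<bar>) = (\<Sum>a\<in>A. \<bar>u a\<bar> powr s) / m powr (s - 1)"
      by (simp add: c_def sum_divide_distrib)
    also have "\<dots> = m" using m s by (simp add: ms flip: powr_diff)
    finally have 1: "(\<Sum>a\<in>A. c a * \<bar>u a\<bar>) = m" .
    have "(\<Sum>a\<in>A. \<bar>c a\<bar> powr s') = (\<Sum>a\<in>A. \<bar>u a\<bar> powr s / m powr s)"
      using m s' by (simp add: c_def powr_divide powr_powr)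
    also have "\<dots> = 1" using m ms by (simp flip: sum_divide_distrib)
    finally have c1: "pnorm s' A c = 1" by (simp add: pnorm_def)
    have "(\<Sum>a\<in>A. c a * \<bar>v a\<bar>) \<le> pnorm s A v" for v
    proof -
      have "(\<Sum>a\<in>A. c a * \<bar>v a\<bar>) \<le> (\<Sum>a\<in>A. \<bar>v a * c a\<bar>)"
        by (intro sum_mono) (simp add: c_def abs_mult mult.commute)
      also have "\<dots> \<le> pnorm s A v * pnorm s' A c"
        using s s' fin by (intro pnorm_Holder_conjugate) auto
      finally show ?thesis using c1 by simp
    qed
    moreover have "\<forall>a. 0 \<le> c a" by (simp add: c_def)
    ultimately show ?thesis using 1 unfolding m_def by blast
  qed
qed

lemma pnorm_triangle:
  assumes "1 \<le> s" "finite A"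
  shows "pnorm s A (\<lambda>a. u a + v a) \<le> pnorm s A u + pnorm s A v"
proof -
  obtain c where c: "\<forall>a. 0 \<le> c a" "(\<Sum>a\<in>A. c a * \<bar>u a + v a\<bar>) = pnorm s A (\<lambda>a. u a + v a)"
    "\<And>v. (\<Sum>a\<in>A. c a * \<bar>v a\<bar>) \<le> pnorm s A v"
    using pnorm_supporting[OF assms, of "\<lambda>a. u a + v a"] by blast
  have "(\<Sum>a\<in>A. c a * \<bar>u a + v a\<bar>) \<le> (\<Sum>a\<in>A. c a * \<bar>u a\<bar> + c a * \<bar>v a\<bar>)"
    using c(1) by (intro sum_mono) (simp add: mult_left_mono flip: distrib_left)
  also have "\<dots> \<le> pnorm s A u + pnorm s A v"
    using c(3)[of u] c(3)[of v] by (simp add: sum.distrib)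
  finally show ?thesis using c(2) by simp
qed

lemma pnorm_sum_triangle:
  assumes "1 \<le> s" "finite A" "finite K"
  shows "pnorm s A (\<lambda>a. \<Sum>k\<in>K. u k a) \<le> (\<Sum>k\<in>K. pnorm s A (u k))"
  using assms(3)
proof (induction K rule: finite_induct)
  case empty
  then show ?case by (simp add: pnorm_def)
next
  case (insert k K)
  then show ?case using pnorm_triangle[OF assms(1,2), of "u k" "\<lambda>a. \<Sum>k\<in>K. u k a"] by auto
qed

text \<open>This is the triangle inequality of \<open>\<ell>\<^sub>s\<close> for \<open>s = t / p\<close>, applied to \<open>p\<close>-th powers.\<close>

lemma pnorm_mixed_swap:
  assumes "1 \<le> p" "p \<le> t" "finite A" "finite K"
  shows "pnorm t A (\<lambda>a. pnorm p K (u a)) \<le> pnorm p K (\<lambda>k. pnorm t A (\<lambda>a. u a k))"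
proof -
  have p: "0 < p" and t: "0 < t" "1 \<le> t / p" using assms by auto
  have pw: "pnorm t A w powr p = pnorm (t / p) A (\<lambda>a. \<bar>w a\<bar> powr p)" for w
    using p t by (simp add: pnorm_def powr_powr)
  have "pnorm t A (\<lambda>a. pnorm p K (u a)) powr p = pnorm (t / p) A (\<lambda>a. \<Sum>k\<in>K. \<bar>u a k\<bar> powr p)"
    using p by (simp add: pw pnorm_powr)
  also have "\<dots> \<le> (\<Sum>k\<in>K. pnorm (t / p) A (\<lambda>a. \<bar>u a k\<bar> powr p))"
    using t assms by (intro pnorm_sum_triangle) auto
  also have "\<dots> = pnorm p K (\<lambda>k. pnorm t A (\<lambda>a. u a k)) powr p"
    using p by (simp add: pnorm_powr pw)
  finally show ?thesis using le_if_powr_le[OF p] by simp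
qed

lemma tendsto_pnorm:
  assumes "0 < s" "\<And>a. a \<in> A \<Longrightarrow> ((\<lambda>k. u k a) \<longlongrightarrow> v a) F"
  shows "((\<lambda>k. pnorm s A (u k)) \<longlongrightarrow> pnorm s A v) F"
  unfolding pnorm_def using assms
  by (intro tendsto_powr' tendsto_sum tendsto_rabs tendsto_const) (auto intro!: always_eventually sum_nonneg)

section \<open>The space\<close>

definition label :: "nat \<Rightarrow> nat" where
  "label n = fst (prod_decode n)"

definition descending :: "nat set \<Rightarrow> bool" where
  "descending d \<longleftrightarrow> finite d \<and> (\<forall>m\<in>d. \<forall>n\<in>d. m < n \<longrightarrow> label n < label m)"

definition packing :: "nat set set \<Rightarrow> bool" where
  "packing D \<longleftrightarrow> finite D \<and> (\<forall>d\<in>D. descending d) \<and>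
     (\<forall>d\<in>D. \<forall>d'\<in>D. d \<noteq> d' \<longrightarrow> label ` d \<inter> label ` d' = {})"

text \<open>On the empty set this holds in both directions, so packings without points cause no trouble in a chain.\<close>

definition before :: "nat set \<Rightarrow> nat set \<Rightarrow> bool" where
  "before A B \<longleftrightarrow> (\<forall>m\<in>A. \<forall>n\<in>B. m < n)"

definition packing_chain :: "nat set set set \<Rightarrow> bool" where
  "packing_chain F \<longleftrightarrow> finite F \<and> (\<forall>D\<in>F. packing D) \<and>
     (\<forall>D\<in>F. \<forall>D'\<in>F. D \<noteq> D' \<longrightarrow> before (\<Union>D) (\<Union>D') \<or> before (\<Union>D') (\<Union>D))"

lemma label_le: "label n \<le> n"
  using le_prod_encode_1[of "fst (prod_decode n)" "snd (prod_decode n)"] by (simp add: label_def)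

lemma label_prod_encode [simp]: "label (prod_encode (i, k)) = i"
  by (simp add: label_def)

lemma descending_finite: "descending d \<Longrightarrow> finite d"
  by (simp add: descending_def)

lemma descending_subset: "descending d \<Longrightarrow> e \<subseteq> d \<Longrightarrow> descending e"
  unfolding descending_def by (meson finite_subset subset_iff)

lemma descending_label_inj: "descending d \<Longrightarrow> inj_on label d"
  unfolding descending_def inj_on_def by (metis less_irrefl linorder_neqE_nat)

lemma packing_finite: "packing D \<Longrightarrow> finite D"
  by (simp add: packing_def)

lemma packing_descending: "packing D \<Longrightarrow> d \<in> D \<Longrightarrow> descending d"
  by (simp add: packing_def)

lemma packing_finite_member: "packing D \<Longrightarrow> d \<in> D \<Longrightarrow> finite d"
  by (simp add: packing_def descending_def)

lemma packing_chain_finite: "packing_chain F \<Longrightarrow> finite F"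
  by (simp add: packing_chain_def)

lemma packing_chain_packing: "packing_chain F \<Longrightarrow> D \<in> F \<Longrightarrow> packing D"
  by (simp add: packing_chain_def)

lemma packing_chain_empty [simp]: "packing_chain {}"
  by (simp add: packing_chain_def)

lemma packing_chain_singleton [simp]: "packing_chain {D} \<longleftrightarrow> packing D"
  by (simp add: packing_chain_def)

lemma packing_singleton [simp]: "packing {d} \<longleftrightarrow> descending d"
  by (simp add: packing_def)

lemma descending_singleton [simp]: "descending {n}"
  by (simp add: descending_def)

lemma descending_empty [simp]: "descending {}"
  by (simp add: descending_def)

definition restr :: "(nat \<Rightarrow> real) \<Rightarrow> nat set \<Rightarrow> nat \<Rightarrow> real" where
  "restr x S = (\<lambda>n. if n \<in> S then x n else 0)"

locale exponents =
  fixes p t r :: real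
  assumes p_gt_1: "1 < p" and p_le_t: "p \<le> t" and r_ge_1: "1 \<le> r"
    and r_eq: "1 / r = 1 / p + 1 / t"
begin

lemma exponents_pos [simp]: "0 < p" "0 < t" "0 < r" "1 \<le> p" "1 \<le> t" "p \<noteq> 0" "t \<noteq> 0" "r \<noteq> 0" "0 \<le> p" "0 \<le> t" "0 \<le> r"
  using p_gt_1 p_le_t r_ge_1 by auto

definition val :: "nat set set set \<Rightarrow> (nat \<Rightarrow> real) \<Rightarrow> real" where
  "val F x = pnorm p F (\<lambda>D. pnorm t D (\<lambda>d. pnorm r d x))"

definition N :: "(nat \<Rightarrow> real) \<Rightarrow> real" where
  "N x = (SUP F\<in>Collect packing_chain. val F x)"

definition X :: "(nat \<Rightarrow> real) set" where
  "X = {x. bdd_above ((\<lambda>F. val F x) ` Collect packing_chain)}"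

lemma val_nonneg [simp]: "0 \<le> val F x"
  by (simp add: val_def)

lemma val_le_N: "x \<in> X \<Longrightarrow> packing_chain F \<Longrightarrow> val F x \<le> N x"
  unfolding X_def N_def by (auto intro!: cSUP_upper)

lemma X_I: "(\<And>F. packing_chain F \<Longrightarrow> val F x \<le> C) \<Longrightarrow> x \<in> X"
  unfolding X_def by (auto intro!: bdd_aboveI)

lemma N_leI: "(\<And>F. packing_chain F \<Longrightarrow> val F x \<le> C) \<Longrightarrow> N x \<le> C"
  unfolding N_def by (rule cSUP_least) (auto intro: exI[of _ "{}"])

lemma N_nonneg: "x \<in> X \<Longrightarrow> 0 \<le> N x"
  using val_le_N[OF _ packing_chain_empty, of x] val_nonneg[of "{}" x] by linarith

text \<open>Joining chains adds \<open>p\<close>-th powers, so the bounds that come from joined chains have this form.\<close>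

lemma N_powr_leI:
  assumes x: "x \<in> X" and le: "\<And>F. packing_chain F \<Longrightarrow> val F x powr p \<le> C"
  shows "N x powr p \<le> C"
proof -
  have C: "0 \<le> C" using le[OF packing_chain_empty] powr_ge_zero[of "val {} x" p] by linarith
  have "N x \<le> C powr (1 / p)"
  proof (rule N_leI)
    fix F assume "packing_chain F"
    then have "(val F x powr p) powr (1 / p) \<le> C powr (1 / p)" using le by (intro powr_mono2) auto
    then show "val F x \<le> C powr (1 / p)" by (simp add: powr_powr)
  qed
  then have "N x powr p \<le> (C powr (1 / p)) powr p" using N_nonneg[OF x] by (intro powr_mono2) auto
  then show ?thesis using C by (simp add: powr_powr)
qed

lemma val_mono:
  assumes "\<And>n. \<bar>x n\<bar> \<le> \<bar>y n\<bar>"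
  shows "val F x \<le> val F y"
  unfolding val_def using assms by (intro pnorm_mono) (auto intro!: pnorm_mono)

lemma X_ideal:
  assumes "y \<in> X" "\<And>n. \<bar>x n\<bar> \<le> \<bar>y n\<bar>"
  shows "x \<in> X" "N x \<le> N y"
proof -
  have *: "val F x \<le> N y" if "packing_chain F" for F
    using val_mono[of x y F, OF assms(2)] val_le_N[OF assms(1) that] by linarith
  show "x \<in> X" "N x \<le> N y" using X_I[OF *] N_leI[OF *] by auto
qed

lemma val_triangle:
  assumes "packing_chain F"
  shows "val F (\<lambda>n. x n + y n) \<le> val F x + val F y"
proof -
  have "val F (\<lambda>n. x n + y n) \<le> pnorm p F (\<lambda>D. pnorm t D (\<lambda>d. pnorm r d x + pnorm r d y))"
    unfolding val_def using assms r_ge_1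
    by (intro pnorm_mono) (auto intro!: pnorm_mono pnorm_triangle packing_finite_member packing_chain_packing)
  also have "\<dots> \<le> pnorm p F (\<lambda>D. pnorm t D (\<lambda>d. pnorm r d x) + pnorm t D (\<lambda>d. pnorm r d y))"
    using assms by (intro pnorm_mono) (auto intro!: pnorm_triangle packing_finite packing_chain_packing)
  also have "\<dots> \<le> val F x + val F y"
    unfolding val_def using assms by (intro pnorm_triangle) (auto intro: packing_chain_finite)
  finally show ?thesis .
qed

lemma val_scale: "val F (\<lambda>n. c * x n) = \<bar>c\<bar> * val F x"
  by (simp add: val_def pnorm_scale)

lemma val_coordinate: "val {{{n}}} x = \<bar>x n\<bar>"
  by (simp add: val_def pnorm_def powr_powr)

lemma coordinate_le_N: "x \<in> X \<Longrightarrow> \<bar>x n\<bar> \<le> N x"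
  using val_le_N[of x "{{{n}}}"] by (simp add: val_coordinate)

lemma zero_mem_X [simp]: "(\<lambda>n. 0) \<in> X" and N_zero [simp]: "N (\<lambda>n. 0) = 0"
proof -
  have *: "val F (\<lambda>n. 0) \<le> 0" for F using val_scale[of F 0 "\<lambda>n. 0"] by simp
  show "(\<lambda>n. 0) \<in> X" using X_I[OF *] .
  then show "N (\<lambda>n. 0) = 0" using N_leI[OF *] N_nonneg by (simp add: order_antisym)
qed

lemma add_mem_X: 
  assumes "x \<in> X" "y \<in> X"
  shows "(\<lambda>n. x n + y n) \<in> X" and N_triangle: "N (\<lambda>n. x n + y n) \<le> N x + N y"
proof -
  have *: "val F (\<lambda>n. x n + y n) \<le> N x + N y" if "packing_chain F" for F
    using val_triangle[OF that, of x y] val_le_N[OF assms(1) that] val_le_N[OF assms(2) that] by linarith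
  show "(\<lambda>n. x n + y n) \<in> X" "N (\<lambda>n. x n + y n) \<le> N x + N y" using X_I[OF *] N_leI[OF *] by auto
qed

lemma scale_mem_X: 
  assumes "x \<in> X"
  shows "(\<lambda>n. c * x n) \<in> X" and N_scale: "N (\<lambda>n. c * x n) = \<bar>c\<bar> * N x"
proof -
  have *: "(\<lambda>n. c * x n) \<in> X \<and> N (\<lambda>n. c * x n) \<le> \<bar>c\<bar> * N x" if "x \<in> X" for x c
  proof -
    have "val F (\<lambda>n. c * x n) \<le> \<bar>c\<bar> * N x" if "packing_chain F" for F
      using val_le_N[OF \<open>x \<in> X\<close> that] by (simp add: val_scale mult_left_mono)
    then show ?thesis using X_I N_leI by blast
  qed
  show cx: "(\<lambda>n. c * x n) \<in> X" using * assms by blast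
  show "N (\<lambda>n. c * x n) = \<bar>c\<bar> * N x"
  proof (cases "c = 0")
    case False
    have "N (\<lambda>n. inverse c * (c * x n)) \<le> \<bar>inverse c\<bar> * N (\<lambda>n. c * x n)" using * cx by blast
    then have "\<bar>c\<bar> * N x \<le> N (\<lambda>n. c * x n)" using False by (simp add: field_simps)
    then show ?thesis using *[OF assms, of c] by simp
  qed simp
qed

lemma diff_mem_X: "x \<in> X \<Longrightarrow> y \<in> X \<Longrightarrow> (\<lambda>n. x n - y n) \<in> X"
  using add_mem_X[of x "\<lambda>n. (-1) * y n"] scale_mem_X[of y "-1"] by simp

lemma N_minus: "x \<in> X \<Longrightarrow> N (\<lambda>n. - x n) = N x"
  using N_scale[of x "-1"] by simp

lemma N_triangle_diff: "x \<in> X \<Longrightarrow> y \<in> X \<Longrightarrow> N (\<lambda>n. x n - y n) \<le> N x + N y"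
  using N_triangle[of x "\<lambda>n. (-1) * y n"] scale_mem_X[of y "-1"] N_minus[of y] by simp

lemma sum_mem_X_aux: 
  assumes "finite K" "\<And>k. k \<in> K \<Longrightarrow> x k \<in> X"
  shows "(\<lambda>n. \<Sum>k\<in>K. a k * x k n) \<in> X \<and> N (\<lambda>n. \<Sum>k\<in>K. a k * x k n) \<le> (\<Sum>k\<in>K. \<bar>a k\<bar> * N (x k))"
  using assms
proof (induction K rule: finite_induct)
  case (insert k K)
  have 1: "(\<lambda>n. a k * x k n) \<in> X" "N (\<lambda>n. a k * x k n) = \<bar>a k\<bar> * N (x k)"
    using insert.prems scale_mem_X N_scale by auto
  have 2: "(\<lambda>n. \<Sum>k\<in>K. a k * x k n) \<in> X" 
    "N (\<lambda>n. \<Sum>k\<in>K. a k * x k n) \<le> (\<Sum>k\<in>K. \<bar>a k\<bar> * N (x k))"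
    using insert by auto
  show ?case using add_mem_X[OF 1(1) 2(1)] N_triangle[OF 1(1) 2(1)] 1 2 insert.hyps by simp
qed simp

lemmas sum_mem_X = sum_mem_X_aux[THEN conjunct1] and N_sum_le = sum_mem_X_aux[THEN conjunct2]

lemma normed_space_X: "normed_space_on X N"
proof -
  have "subspace X"
    unfolding subspace_def using add_mem_X scale_mem_X zero_mem_X
    by (auto simp: plus_fun_def zero_fun_def scaleR_fun_def)
  moreover have "x = 0" if "x \<in> X" "N x = 0" for x
    using coordinate_le_N[OF that(1)] that(2) by (auto simp: zero_fun_def)
  ultimately show ?thesis
    unfolding normed_space_on_def using N_scale N_triangle N_zero
    by (auto simp: plus_fun_def scaleR_fun_def zero_fun_def)
qed

lemma tendsto_val:
  assumes "\<And>n. ((\<lambda>k. x k n) \<longlongrightarrow> y n) G"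
  shows "((\<lambda>k. val F (x k)) \<longlongrightarrow> val F y) G"
  unfolding val_def using assms by (auto intro!: tendsto_pnorm)

text \<open>The norm is a supremum of functions of finitely many coordinates, hence lower semicontinuous for
  coordinatewise convergence.  Completeness rests on this, as does the
  membership of coordinatewise limits of bounded sequences in the space.\<close>

lemma coordinate_limit:
  assumes "\<And>k. x k \<in> X" "eventually (\<lambda>k. N (x k) \<le> C) sequentially" "\<And>n. (\<lambda>k. x k n) \<longlonglongrightarrow> y n"
  shows "y \<in> X" "N y \<le> C"
proof -
  have *: "val F y \<le> C" if "packing_chain F" for F
  proof (rule tendsto_upperbound[OF tendsto_val[OF assms(3)]])
    show "eventually (\<lambda>k. val F (x k) \<le> C) sequentially"
      using assms(2) by eventually_elim (use val_le_N[OF assms(1) that] order_trans in blast)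
  qed simp
  show "y \<in> X" "N y \<le> C" using X_I[OF *] N_leI[OF *] by auto
qed

lemma banach_space_X: "banach_space_on X N"
  unfolding banach_space_on_def
proof (intro conjI allI impI normed_space_X)
  fix s :: "nat \<Rightarrow> nat \<Rightarrow> real"
  assume "(\<forall>n. s n \<in> X) \<and> (\<forall>\<epsilon>>0. \<exists>M. \<forall>m\<ge>M. \<forall>n\<ge>M. N (s m - s n) < \<epsilon>)"
  then have s: "\<And>n. s n \<in> X" and cau: "\<And>\<epsilon>. \<epsilon> > 0 \<Longrightarrow> \<exists>M. \<forall>m\<ge>M. \<forall>n\<ge>M. N (s m - s n) < \<epsilon>" by auto
  have diff: "(\<lambda>i. s m i - s n i) \<in> X" for m n using diff_mem_X s by blast
  have "Cauchy (\<lambda>k. s k n)" for n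
    unfolding Cauchy_def dist_real_def
  proof (intro allI impI)
    fix \<epsilon> :: real assume "\<epsilon> > 0"
    then obtain M where M: "\<forall>m\<ge>M. \<forall>n\<ge>M. N (s m - s n) < \<epsilon>" using cau by blast
    have "\<bar>s k n - s l n\<bar> < \<epsilon>" if "k \<ge> M" "l \<ge> M" for k l
    proof -
      have "N (\<lambda>i. s k i - s l i) < \<epsilon>" using M that by (simp add: fun_diff_def)
      then show ?thesis using coordinate_le_N[OF diff[of k l], of n] by linarith
    qed
    then show "\<exists>M. \<forall>m\<ge>M. \<forall>l\<ge>M. \<bar>s m n - s l n\<bar> < \<epsilon>" by blast
  qed
  then have "\<forall>n. \<exists>l. (\<lambda>k. s k n) \<longlonglongrightarrow> l" using Cauchy_convergent_iff convergent_def by blast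
  then obtain y where y: "\<And>n. (\<lambda>k. s k n) \<longlonglongrightarrow> y n" by metis
  have lim: "(\<lambda>i. s m i - y i) \<in> X \<and> N (\<lambda>i. s m i - y i) \<le> \<epsilon>" if "\<forall>n\<ge>M. N (s m - s n) < \<epsilon>" for m M \<epsilon>
  proof -
    have "eventually (\<lambda>n. N (\<lambda>i. s m i - s n i) \<le> \<epsilon>) sequentially"
      using that by (auto simp: eventually_sequentially fun_diff_def intro!: exI[of _ M] less_imp_le)
    moreover have "(\<lambda>n. s m i - s n i) \<longlonglongrightarrow> s m i - y i" for i
      by (intro tendsto_diff tendsto_const y)
    ultimately show ?thesis
      using coordinate_limit[of "\<lambda>n i. s m i - s n i" \<epsilon> "\<lambda>i. s m i - y i"] diff by blast
  qed
  obtain M where "\<forall>m\<ge>M. \<forall>n\<ge>M. N (s m - s n) < 1" using cau[of 1] by auto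
  then have "(\<lambda>i. s M i - y i) \<in> X" using lim by blast
  then have "y \<in> X" using diff_mem_X[OF s[of M]] by fastforce
  moreover have "(\<lambda>n. N (s n - y)) \<longlonglongrightarrow> 0"
  proof (rule LIMSEQ_I)
    fix \<epsilon> :: real assume "\<epsilon> > 0"
    then obtain M where M: "\<forall>m\<ge>M. \<forall>n\<ge>M. N (s m - s n) < \<epsilon> / 2" using cau[of "\<epsilon> / 2"] by auto
    have "norm (N (s n - y) - 0) < \<epsilon>" if "n \<ge> M" for n
      using lim[of M n "\<epsilon> / 2"] M that N_nonneg[of "\<lambda>i. s n i - y i"] \<open>\<epsilon> > 0\<close> by (auto simp: fun_diff_def)
    then show "\<exists>M. \<forall>n\<ge>M. norm (N (s n - y) - 0) < \<epsilon>" by blast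
  qed
  ultimately show "\<exists>x\<in>X. (\<lambda>n. N (s n - x)) \<longlonglongrightarrow> 0" by blast
qed

lemma restr_mem_X: "x \<in> X \<Longrightarrow> restr x S \<in> X"
  and N_restr_le: "x \<in> X \<Longrightarrow> N (restr x S) \<le> N x"
  using X_ideal[of x "restr x S"] by (auto simp: restr_def)

text \<open>Besides the values, only the order of the support and its labels enter the norm.  With \<open>\<phi>\<close> the identity this confines a
  chain to a set carrying the vector; otherwise it moves unit vectors along the index line.
  Different members may get the same image, but only if that image contains no index and contributes nothing.\<close>

lemma transport_chain:
  assumes F: "packing_chain F" and mono: "strict_mono_on S \<phi>"
    and lab: "\<And>n. n \<in> S \<Longrightarrow> label (\<phi> n) = label n"
    and val: "\<And>n. n \<in> S \<Longrightarrow> \<bar>x' (\<phi> n)\<bar> = \<bar>x n\<bar>"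
    and zero: "\<And>n. n \<notin> S \<Longrightarrow> x n = 0"
  obtains F' where "packing_chain F'" "val F' x' = val F x" "\<And>D. D \<in> F' \<Longrightarrow> \<Union>D \<noteq> {} \<and> \<Union>D \<subseteq> \<phi> ` S"
proof -
  define h where "h d = \<phi> ` (d \<inter> S)" for d
  define H where "H D = h ` D" for D
  \<comment> \<open>Packings that lose all their points are dropped, so that chains over disjoint sets have no member in common.\<close>
  define F' where "F' = {D \<in> H ` F. \<Union>D \<noteq> {}}"
  have inj: "inj_on \<phi> S" by (rule strict_mono_on_imp_inj_on[OF mono])
  have less: "a < b" if "\<phi> a < \<phi> b" "a \<in> S" "b \<in> S" for a b
    using mono that unfolding strict_mono_on_def by (metis less_asym linorder_neqE_nat less_irrefl)
  have less': "\<phi> a < \<phi> b" if "a < b" "a \<in> S" "b \<in> S" for a b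
    using mono that unfolding strict_mono_on_def by blast
  have lab_h: "label ` h d = label ` (d \<inter> S)" for d
    unfolding h_def image_image using lab by (intro image_cong) auto
  have UH: "\<Union>(H D) = \<phi> ` (\<Union>D \<inter> S)" for D
    unfolding H_def h_def by auto
  have descending_h: "descending (h d)" if "descending d" for d
    using that lab less unfolding descending_def h_def by auto
  have pack_H: "packing (H D)" if D: "packing D" for D
    unfolding packing_def
  proof (intro conjI ballI impI)
    show "finite (H D)" using D by (simp add: H_def packing_finite)
    show "descending d" if "d \<in> H D" for d using that descending_h packing_descending[OF D] by (auto simp: H_def)
    show "label ` d \<inter> label ` d' = {}" if dd: "d \<in> H D" "d' \<in> H D" "d \<noteq> d'" for d d'
    proof -
      obtain e e' where e: "e \<in> D" "e' \<in> D" "d = h e" "d' = h e'" using dd by (auto simp: H_def)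
      moreover have "e \<noteq> e'" using e dd(3) by blast
      ultimately have "label ` e \<inter> label ` e' = {}" using D unfolding packing_def by blast
      moreover have "label ` h e \<subseteq> label ` e" "label ` h e' \<subseteq> label ` e'" by (auto simp: lab_h)
      ultimately show ?thesis unfolding e(3,4) by blast
    qed
  qed
  have bef: "before (\<Union>(H D)) (\<Union>(H D'))" if "before (\<Union>D) (\<Union>D')" for D D'
    using that less' unfolding UH before_def by auto
  have ch: "packing_chain (H ` F)"
    unfolding packing_chain_def
  proof (intro conjI ballI impI)
    show "finite (H ` F)" using F by (simp add: packing_chain_finite)
    show "packing D" if "D \<in> H ` F" for D using that pack_H packing_chain_packing[OF F] by auto
    show "before (\<Union>D) (\<Union>D') \<or> before (\<Union>D') (\<Union>D)" if "D \<in> H ` F" "D' \<in> H ` F" "D \<noteq> D'" for D D'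
      using that F bef unfolding packing_chain_def by (metis image_iff)
  qed
  have v_r: "pnorm r (h d) x' = pnorm r d x" if "finite d" for d
  proof -
    have "pnorm r (h d) x' = pnorm r (d \<inter> S) (\<lambda>n. x' (\<phi> n))"
      unfolding h_def using inj by (intro pnorm_reindex) (auto intro: inj_on_subset)
    also have "\<dots> = pnorm r (d \<inter> S) x" using val by (intro pnorm_cong) auto
    also have "\<dots> = pnorm r d x" using zero that by (intro pnorm_neutral) auto
    finally show ?thesis .
  qed
  \<comment> \<open>Members of a packing with the same image have disjoint labels, so the image is empty.\<close>
  have v_t: "pnorm t (H D) (\<lambda>d. pnorm r d x') = pnorm t D (\<lambda>d. pnorm r d x)" if D: "packing D" for D
  proof -
    have "pnorm t (H D) (\<lambda>d. pnorm r d x') = pnorm t D (\<lambda>d. pnorm r (h d) x')"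
      unfolding H_def
    proof (intro pnorm_reindex_nontrivial)
      show "finite D" using D by (rule packing_finite)
      fix d d' assume d: "d \<in> D" "d' \<in> D" "d \<noteq> d'" "h d = h d'"
      have "label ` d \<inter> label ` d' = {}" using D d by (auto simp: packing_def)
      moreover have "label ` (d \<inter> S) = label ` (d' \<inter> S)" using lab_h d(4) by metis
      ultimately have "d \<inter> S = {}" by blast
      then show "pnorm r (h d) x' = 0" by (simp add: h_def)
    qed
    also have "\<dots> = pnorm t D (\<lambda>d. pnorm r d x)"
      using v_r packing_finite_member[OF D] by (intro pnorm_cong) auto
    finally show ?thesis .
  qed
  have Uzero: "pnorm t D (\<lambda>d. pnorm r d x') = 0" if "\<Union>D = {}" for D
  proof -
    have "pnorm t D (\<lambda>d. pnorm r d x') = pnorm t D (\<lambda>d. 0)" using that by (intro pnorm_cong) auto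
    then show ?thesis by (simp add: pnorm_def)
  qed
  have "val (H ` F) x' = pnorm p F (\<lambda>D. pnorm t (H D) (\<lambda>d. pnorm r d x'))"
    unfolding val_def
  proof (intro pnorm_reindex_nontrivial)
    show "finite F" using F by (rule packing_chain_finite)
    fix D D' assume D: "D \<in> F" "D' \<in> F" "D \<noteq> D'" "H D = H D'"
    then have "before (\<Union>D) (\<Union>D') \<or> before (\<Union>D') (\<Union>D)" using F by (auto simp: packing_chain_def)
    then have "before (\<Union>(H D)) (\<Union>(H D')) \<or> before (\<Union>(H D')) (\<Union>(H D))" using bef by blast
    then have "\<Union>(H D) = {}" unfolding D(4) before_def by blast
    then show "pnorm t (H D) (\<lambda>d. pnorm r d x') = 0" by (rule Uzero)
  qed
  also have "\<dots> = val F x"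
    unfolding val_def using v_t packing_chain_packing[OF F] by (intro pnorm_cong) auto
  finally have *: "val (H ` F) x' = val F x" .
  have "val F' x' = val (H ` F) x'"
    unfolding val_def F'_def using F Uzero by (intro pnorm_neutral) (auto simp: packing_chain_finite)
  then have "val F' x' = val F x" using * by simp
  moreover have "packing_chain F'" using ch unfolding F'_def packing_chain_def by auto
  moreover have "\<Union>D \<noteq> {} \<and> \<Union>D \<subseteq> \<phi> ` S" if "D \<in> F'" for D using that UH unfolding F'_def by auto
  ultimately show ?thesis using that by blast
qed

text \<open>A chain to the left of \<open>c\<close> followed by one to the right of \<open>c\<close> is a chain.\<close>

lemma superadditive:
  assumes x: "x \<in> X"
  shows "N (restr x {..<c}) powr p + N (restr x {c..}) powr p \<le> N x powr p"
proof -
  define x1 x2 where "x1 = restr x {..<c}" and "x2 = restr x {c..}"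
  have *: "val F1 x1 powr p + val F2 x2 powr p \<le> N x powr p" if F: "packing_chain F1" "packing_chain F2" for F1 F2
  proof -
    obtain G1 where G1: "packing_chain G1" "val G1 x = val F1 x1" "\<And>D. D \<in> G1 \<Longrightarrow> \<Union>D \<noteq> {} \<and> \<Union>D \<subseteq> {..<c}"
      by (rule transport_chain[OF F(1), of "{..<c}" "\<lambda>n. n" x x1])
        (auto simp: x1_def restr_def strict_mono_on_def)
    obtain G2 where G2: "packing_chain G2" "val G2 x = val F2 x2" "\<And>D. D \<in> G2 \<Longrightarrow> \<Union>D \<noteq> {} \<and> \<Union>D \<subseteq> {c..}"
      by (rule transport_chain[OF F(2), of "{c..}" "\<lambda>n. n" x x2])
        (auto simp: x2_def restr_def strict_mono_on_def)
    have bef: "before (\<Union>D) (\<Union>D')" if "D \<in> G1" "D' \<in> G2" for D D'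
      using G1(3)[OF that(1)] G2(3)[OF that(2)] unfolding before_def
      by (meson atLeast_iff lessThan_iff less_le_trans subset_iff)
    have "packing_chain (G1 \<union> G2)"
      using G1(1) G2(1) bef unfolding packing_chain_def by auto
    moreover have "G1 \<inter> G2 = {}" using G1(3) G2(3) bef unfolding before_def by blast
    ultimately have "val (G1 \<union> G2) x powr p = val G1 x powr p + val G2 x powr p"
      using packing_chain_finite[OF G1(1)] packing_chain_finite[OF G2(1)]
      by (simp add: val_def pnorm_powr sum.union_disjoint)
    moreover have "val (G1 \<union> G2) x powr p \<le> N x powr p"
      using val_le_N[OF x \<open>packing_chain (G1 \<union> G2)\<close>] by (intro powr_mono2) auto
    ultimately show ?thesis using G1 G2 by simp
  qed
  have x12: "x1 \<in> X" "x2 \<in> X" using x restr_mem_X unfolding x1_def x2_def by auto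
  have "N x1 powr p \<le> N x powr p - val F2 x2 powr p" if F: "packing_chain F2" for F2
    using *[OF _ F] by (intro N_powr_leI x12) (auto simp: algebra_simps)
  then have "N x2 powr p \<le> N x powr p - N x1 powr p"
    by (intro N_powr_leI x12) (auto simp: algebra_simps)
  then show ?thesis unfolding x1_def x2_def by simp
qed

text \<open>A chain that almost attains the norm is finite; superadditivity leaves little norm beyond it.\<close>

lemma tail_tendsto_zero:
  assumes x: "x \<in> X" and "\<epsilon> > 0"
  shows "\<exists>c. \<forall>c'\<ge>c. N (restr x {c'..}) < \<epsilon>"
proof -
  have "\<exists>F. packing_chain F \<and> N x powr p - val F x powr p < \<epsilon> powr p"
  proof (rule ccontr)
    assume "\<not> ?thesis"
    then have *: "packing_chain F \<Longrightarrow> val F x powr p \<le> N x powr p - \<epsilon> powr p" for F by force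
    have "N x powr p \<le> N x powr p - \<epsilon> powr p" using x * by (rule N_powr_leI)
    then show False using assms(2) by simp
  qed
  then obtain F where F: "packing_chain F" "N x powr p - val F x powr p < \<epsilon> powr p" by blast
  have "finite (\<Union>(\<Union>F))"
    using F(1) packing_finite_member packing_finite unfolding packing_chain_def by (intro finite_Union) auto
  then obtain c where c: "\<Union>(\<Union>F) \<subseteq> {..<c}" using finite_nat_iff_bounded by blast
  have "N (restr x {c'..}) < \<epsilon>" if "c' \<ge> c" for c'
  proof -
    have "val F (restr x {..<c'}) = val F x"
      unfolding val_def using c that by (intro pnorm_cong refl) (force simp: restr_def subset_iff intro!: pnorm_cong)
    then have "val F x \<le> N (restr x {..<c'})"
      using val_le_N[OF restr_mem_X[OF x] F(1)] by metis
    then have "val F x powr p \<le> N (restr x {..<c'}) powr p" by (intro powr_mono2) auto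
    then have "N (restr x {c'..}) powr p < \<epsilon> powr p" using superadditive[OF x, of c'] F(2) by linarith
    then show ?thesis
      using powr_mono2[of p \<epsilon> "N (restr x {c'..})"] assms(2) by fastforce
  qed
  then show ?thesis by blast
qed

end

section \<open>Upper and lower estimates for successive blocks\<close>

context exponents
begin

text \<open>Of the factor \<open>2 + \<eta>\<close>, one is spent on the first block of each descending set and \<open>1 + \<eta>\<close> on its later
  blocks.  Assumption \<open>later\<close> only concerns labels below one that occurred in an earlier block; this is what
  makes it attainable by passing to a subsequence.  Assumption \<open>profile\<close> holds when \<open>w\<close> collects values
  that a single vector of norm \<open>1 + \<eta>\<close> attains on descending sets with prescribed labels.\<close>

lemma upper_estimate:
  fixes blk :: "nat \<Rightarrow> nat" and u :: "nat \<Rightarrow> real" and w :: "nat set \<Rightarrow> real" and \<eta> :: real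
  assumes blk: "mono blk"
    and block_X: "\<And>k. restr u {n. blk n = k} \<in> X" and block_N: "\<And>k. N (restr u {n. blk n = k}) \<le> 1"
    and w_nonneg: "\<And>J. 0 \<le> w J"
    and profile: "\<And>\<J>. finite \<J> \<Longrightarrow> (\<And>J. J \<in> \<J> \<Longrightarrow> finite J \<and> J \<noteq> {}) \<Longrightarrow>
      (\<And>J J'. J \<in> \<J> \<Longrightarrow> J' \<in> \<J> \<Longrightarrow> J \<noteq> J' \<Longrightarrow> J \<inter> J' = {}) \<Longrightarrow> pnorm t \<J> w \<le> 1 + \<eta>"
    and later: "\<And>d m k. descending d \<Longrightarrow> d \<noteq> {} \<Longrightarrow> (\<And>n. n \<in> d \<Longrightarrow> blk n = k) \<Longrightarrow> blk m < k \<Longrightarrow>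
      (\<And>n. n \<in> d \<Longrightarrow> label n < label m) \<Longrightarrow> pnorm r d u \<le> w (label ` d)"
    and F: "packing_chain F"
  shows "val F (\<lambda>n. a (blk n) * u n) \<le> (2 + \<eta>) * pnorm p (blk ` \<Union>(\<Union>F)) a"
proof -
  define v where "v n = a (blk n) * u n" for n
  define y where "y k = restr u {n. blk n = k}" for k
  define first where "first d n \<longleftrightarrow> (\<forall>m\<in>d. blk n \<le> blk m)" for d n
  define \<alpha> where "\<alpha> d n = (if first d n then v n else 0)" for d n
  define \<beta> where "\<beta> d n = (if first d n then 0 else v n)" for d n
  define K where "K = blk ` \<Union>(\<Union>F)"
  have finF: "finite F" using F by (rule packing_chain_finite)
  have finD: "finite D" if "D \<in> F" for D using packing_finite packing_chain_packing[OF F that] .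
  have find: "finite d" if "D \<in> F" "d \<in> D" for D d 
    using packing_finite_member packing_chain_packing[OF F that(1)] that(2) by blast
  have desc: "descending d" if "D \<in> F" "d \<in> D" for D d 
    using packing_descending packing_chain_packing[OF F that(1)] that(2) by blast
  have finK: "finite K" unfolding K_def using finF finD find by (intro finite_imageI finite_Union) auto
  have "val F v \<le> pnorm p F (\<lambda>D. pnorm t D (\<lambda>d. pnorm r d (\<alpha> d) + pnorm r d (\<beta> d)))"
    unfolding val_def
  proof (intro pnorm_mono)
    fix D assume D: "D \<in> F"
    have "pnorm r d v \<le> pnorm r d (\<alpha> d) + pnorm r d (\<beta> d)" if "d \<in> D" for d
    proof -
      have "pnorm r d v = pnorm r d (\<lambda>n. \<alpha> d n + \<beta> d n)"
        by (intro pnorm_cong) (auto simp: \<alpha>_def \<beta>_def)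
      then show ?thesis using pnorm_triangle[OF r_ge_1 find[OF D that]] by simp
    qed
    then have "pnorm t D (\<lambda>d. pnorm r d v) \<le> pnorm t D (\<lambda>d. pnorm r d (\<alpha> d) + pnorm r d (\<beta> d))"
      by (intro pnorm_mono) auto
    then show "\<bar>pnorm t D (\<lambda>d. pnorm r d v)\<bar> \<le> \<bar>pnorm t D (\<lambda>d. pnorm r d (\<alpha> d) + pnorm r d (\<beta> d))\<bar>" by simp
  qed simp
  also have "\<dots> \<le> pnorm p F (\<lambda>D. pnorm t D (\<lambda>d. pnorm r d (\<alpha> d)) + pnorm t D (\<lambda>d. pnorm r d (\<beta> d)))"
    using finD by (intro pnorm_mono) (auto intro!: pnorm_triangle)
  also have "\<dots> \<le> pnorm p F (\<lambda>D. pnorm t D (\<lambda>d. pnorm r d (\<alpha> d))) + pnorm p F (\<lambda>D. pnorm t D (\<lambda>d. pnorm r d (\<beta> d)))"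
    using finF by (intro pnorm_triangle) auto
  finally have split: "val F v \<le> pnorm p F (\<lambda>D. pnorm t D (\<lambda>d. pnorm r d (\<alpha> d))) + pnorm p F (\<lambda>D. pnorm t D (\<lambda>d. pnorm r d (\<beta> d)))" .

  \<comment> \<open>The parts on first blocks: replacing the first block by the \<open>\<ell>\<^sub>p\<close> sum over all blocks loses nothing.\<close>
  have first_part: "pnorm p F (\<lambda>D. pnorm t D (\<lambda>d. pnorm r d (\<alpha> d))) \<le> pnorm p K a"
  proof -
    have *: "pnorm r d (\<alpha> d) \<le> pnorm p K (\<lambda>k. a k * pnorm r d (y k))" if D: "D \<in> F" "d \<in> D" for D d
    proof (cases "d = {}")
      case False
      define k where "k = Min (blk ` d)"
      have fin: "finite (blk ` d)" "blk ` d \<noteq> {}" using False find[OF D] by auto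
      have k: "k \<in> blk ` d" using Min_in[OF fin] by (simp add: k_def)
      then have kK: "k \<in> K" using D unfolding K_def by auto
      have "pnorm r d (\<alpha> d) \<le> pnorm r d (\<lambda>n. a k * y k n)"
      proof (intro pnorm_mono)
        fix n assume n: "n \<in> d"
        have "first d n \<Longrightarrow> blk n = k" using k n Min_le[OF fin(1), of "blk n"] unfolding first_def k_def
          by (auto intro!: order_antisym)
        then show "\<bar>\<alpha> d n\<bar> \<le> \<bar>a k * y k n\<bar>" by (auto simp: \<alpha>_def v_def y_def restr_def)
      qed simp
      also have "\<dots> = \<bar>a k * pnorm r d (y k)\<bar>" by (simp add: pnorm_scale abs_mult)
      also have "\<dots> \<le> pnorm p K (\<lambda>k. a k * pnorm r d (y k))"
        by (rule pnorm_member[of p K k "\<lambda>k. a k * pnorm r d (y k)"]) (use finK kK in auto)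
      finally show ?thesis .
    qed simp
    have **: "pnorm t D (\<lambda>d. pnorm r d (\<alpha> d)) \<le> pnorm p K (\<lambda>k. a k * pnorm t D (\<lambda>d. pnorm r d (y k)))" if D: "D \<in> F" for D
    proof -
      have "pnorm t D (\<lambda>d. pnorm r d (\<alpha> d)) \<le> pnorm t D (\<lambda>d. pnorm p K (\<lambda>k. a k * pnorm r d (y k)))"
        using *[OF D] by (intro pnorm_mono) auto
      also have "\<dots> \<le> pnorm p K (\<lambda>k. pnorm t D (\<lambda>d. a k * pnorm r d (y k)))"
        using finK finD[OF D] p_le_t by (intro pnorm_mixed_swap) auto
      also have "\<dots> = pnorm p K (\<lambda>k. a k * pnorm t D (\<lambda>d. pnorm r d (y k)))"
        by (intro pnorm_cong) (auto simp: pnorm_scale abs_mult)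
      finally show ?thesis .
    qed
    have "pnorm p F (\<lambda>D. pnorm t D (\<lambda>d. pnorm r d (\<alpha> d)))
        \<le> pnorm p F (\<lambda>D. pnorm p K (\<lambda>k. a k * pnorm t D (\<lambda>d. pnorm r d (y k))))"
      using ** by (intro pnorm_mono) auto
    also have "\<dots> = pnorm p K (\<lambda>k. pnorm p F (\<lambda>D. a k * pnorm t D (\<lambda>d. pnorm r d (y k))))"
      using finF finK by (intro pnorm_swap) auto
    also have "\<dots> = pnorm p K (\<lambda>k. a k * val F (y k))"
      unfolding val_def by (intro pnorm_cong) (auto simp: pnorm_scale abs_mult)
    also have "\<dots> \<le> pnorm p K a"
    proof (intro pnorm_mono)
      fix k
      have "val F (y k) \<le> 1" using val_le_N[OF block_X F] block_N unfolding y_def by (meson order_trans)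
      then show "\<bar>a k * val F (y k)\<bar> \<le> \<bar>a k\<bar>" by (simp add: abs_mult mult_left_le)
    qed simp
    finally show ?thesis .
  qed

  \<comment> \<open>\<open>L d\<close> is the part of \<open>d\<close> beyond its first block, \<open>M d\<close> are its later blocks, and \<open>K' D\<close> collects them over a packing.\<close>
  define L where "L d = {n \<in> d. \<not> first d n}" for d
  define M where "M d = blk ` L d" for d
  define K' where "K' D = (\<Union>d\<in>D. M d)" for D
  have M_sub: "M d \<subseteq> K' D" if "d \<in> D" for d D using that by (auto simp: K'_def)
  have K'_sub: "K' D \<subseteq> K" if "D \<in> F" for D using that by (auto simp: K'_def M_def L_def K_def)
  have finK': "finite (K' D)" if "D \<in> F" for D using finite_subset[OF K'_sub[OF that] finK] .
  have finM: "finite (M d)" if "D \<in> F" "d \<in> D" for D d using find[OF that] by (simp add: M_def L_def)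
  \<comment> \<open>A later block of \<open>D'\<close> is preceded by a point of \<open>D'\<close>, so everything before \<open>D'\<close> stays out of it.\<close>
  have disj: "K' D \<inter> K' D' = {}" if D: "D \<in> F" "D' \<in> F" "D \<noteq> D'" for D D'
  proof -
    have *: False if D: "before (\<Union>D) (\<Union>D')" "k \<in> K' D" "k \<in> K' D'" for D D' k
    proof -
      obtain d n where n: "d \<in> D" "n \<in> d" "blk n = k" using D(2) by (auto simp: K'_def M_def L_def)
      obtain d' n' m' where n': "d' \<in> D'" "n' \<in> d'" "m' \<in> d'" "blk n' = k" "blk m' < blk n'" 
        using D(3) by (auto simp: K'_def M_def L_def first_def not_le)
      have "n < m'" using D(1) n n' unfolding before_def by blast
      then show False using blk n n' monoD[of blk n m'] by auto
    qed
    have "before (\<Union>D) (\<Union>D') \<or> before (\<Union>D') (\<Union>D)" using F D unfolding packing_chain_def by blast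
    then show ?thesis using * by blast
  qed
  have second_t: "pnorm t D (\<lambda>d. pnorm r d (\<beta> d)) \<le> pnorm p (K' D) a * (1 + \<eta>)" if D: "D \<in> F" for D
  proof -
    define dk where "dk d k = {n \<in> d. blk n = k}" for d k
    define q where "q d = pnorm t (M d) (\<lambda>k. w (label ` dk d k))" for d
    have *: "pnorm r d (\<beta> d) \<le> pnorm p (K' D) a * q d" if d: "d \<in> D" for d
    proof -
      have LU: "L d = (\<Union>k\<in>M d. dk d k)"
        unfolding M_def L_def dk_def first_def by auto
      have "pnorm r d (\<beta> d) = pnorm r (L d) (\<beta> d)"
        using find[OF D d] by (intro pnorm_neutral[symmetric]) (auto simp: L_def \<beta>_def)
      also have "\<dots> = pnorm r (\<Union>k\<in>M d. dk d k) v"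
        by (intro pnorm_cong LU) (use LU in \<open>auto simp: L_def \<beta>_def\<close>)
      also have "\<dots> = pnorm r (M d) (\<lambda>k. pnorm r (dk d k) v)"
        using find[OF D d] by (intro pnorm_UN finM[OF D d]) (auto simp: dk_def)
      also have "\<dots> \<le> pnorm r (M d) (\<lambda>k. a k * w (label ` dk d k))"
      proof (intro pnorm_mono)
        fix k assume k: "k \<in> M d"
        obtain n m where nm: "n \<in> d" "m \<in> d" "blk n = k" "blk m < k"
          using k by (auto simp: M_def L_def first_def not_le)
        have "pnorm r (dk d k) v = pnorm r (dk d k) (\<lambda>n. a k * u n)"
          by (intro pnorm_cong) (auto simp: v_def dk_def)
        also have "\<dots> = \<bar>a k\<bar> * pnorm r (dk d k) u" by (simp add: pnorm_scale)
        also have "\<dots> \<le> \<bar>a k\<bar> * w (label ` dk d k)"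
        proof (intro mult_left_mono later)
          show "descending (dk d k)" using descending_subset[OF desc[OF D d]] by (auto simp: dk_def)
          show "dk d k \<noteq> {}" using nm by (auto simp: dk_def)
          show "blk m < k" by fact
          show "label n' < label m" if "n' \<in> dk d k" for n'
          proof -
            have "m < n'" using blk nm that monoD[of blk n' m] unfolding dk_def by (metis (mono_tags) leI mem_Collect_eq not_le)
            then show ?thesis using desc[OF D d] nm that unfolding descending_def dk_def by blast
          qed
        qed (auto simp: dk_def)
        finally show "\<bar>pnorm r (dk d k) v\<bar> \<le> \<bar>a k * w (label ` dk d k)\<bar>"
          using w_nonneg by (simp add: abs_mult)
      qed simp
      also have "\<dots> \<le> pnorm p (M d) a * q d"
        unfolding q_def using finM[OF D d] r_eq by (intro pnorm_Holder) auto
      also have "\<dots> \<le> pnorm p (K' D) a * q d"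
        using finK'[OF D] M_sub[OF d] by (intro mult_right_mono pnorm_subset) (auto simp: q_def)
      finally show ?thesis .
    qed
    \<comment> \<open>The label sets of the pieces \<open>dk d k\<close> are disjoint: for one \<open>d\<close> since labels are injective on it, for two since \<open>D\<close> is a packing.\<close>
    define \<J> where "\<J> = (\<lambda>(d, k). label ` dk d k) ` Sigma D M"
    have inj: "label ` dk d k \<inter> label ` dk d' k' = {}" 
      if d: "d \<in> D" "d' \<in> D" "k \<in> M d" "k' \<in> M d'" "(d, k) \<noteq> (d', k')" for d d' k k'
    proof (cases "d = d'")
      case True
      then show ?thesis using d descending_label_inj[OF desc[OF D d(1)]] unfolding dk_def inj_on_def by blast
    next
      case False
      then have "label ` d \<inter> label ` d' = {}" using packing_chain_packing[OF F D] d unfolding packing_def by blast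
      then show ?thesis unfolding dk_def by blast
    qed
    have ne: "label ` dk d k \<noteq> {}" if "k \<in> M d" for d k using that by (auto simp: M_def L_def dk_def)
    have "pnorm t D q = pnorm t (Sigma D M) (\<lambda>(d, k). w (label ` dk d k))"
      unfolding q_def using finD[OF D] finM[OF D] by (intro pnorm_Sigma) auto
    also have "\<dots> = pnorm t \<J> w"
    proof -
      have "inj_on (\<lambda>(d, k). label ` dk d k) (Sigma D M)"
      proof (rule inj_onI, clarify)
        fix d k d' k' assume a: "d \<in> D" "k \<in> M d" "d' \<in> D" "k' \<in> M d'" "label ` dk d k = label ` dk d' k'"
        show "d = d' \<and> k = k'" using inj[OF a(1,3,2,4)] ne[OF a(2)] a(5) by auto
      qed
      then show ?thesis unfolding \<J>_def by (subst pnorm_reindex) (auto intro: pnorm_cong)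
    qed
    also have "\<dots> \<le> 1 + \<eta>"
    proof (rule profile)
      show "finite \<J>" using finD[OF D] finM[OF D] by (auto simp: \<J>_def)
      show "finite J \<and> J \<noteq> {}" if "J \<in> \<J>" for J
        using that ne find[OF D] by (force simp: \<J>_def dk_def)
      show "J \<inter> J' = {}" if J: "J \<in> \<J>" "J' \<in> \<J>" "J \<noteq> J'" for J J'
      proof -
        obtain d k d' k' where dk: "d \<in> D" "k \<in> M d" "J = label ` dk d k" "d' \<in> D" "k' \<in> M d'" "J' = label ` dk d' k'"
          using J(1,2) unfolding \<J>_def by auto
        then have "(d, k) \<noteq> (d', k')" using J(3) by auto
        then show ?thesis using inj[of d d' k k'] dk by simp
      qed
    qed
    finally have q: "pnorm t D q \<le> 1 + \<eta>" .
    have "pnorm t D (\<lambda>d. pnorm r d (\<beta> d)) \<le> pnorm t D (\<lambda>d. pnorm p (K' D) a * q d)"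
      using * by (intro pnorm_mono) (auto simp: q_def)
    also have "\<dots> = pnorm p (K' D) a * pnorm t D q" by (simp add: pnorm_scale)
    also have "\<dots> \<le> pnorm p (K' D) a * (1 + \<eta>)" using q by (intro mult_left_mono) auto
    finally show ?thesis .
  qed
  have "pnorm t {} w \<le> 1 + \<eta>" by (rule profile) auto
  then have \<eta>: "0 \<le> 1 + \<eta>" by simp
  have "pnorm p F (\<lambda>D. pnorm t D (\<lambda>d. pnorm r d (\<beta> d))) \<le> pnorm p F (\<lambda>D. pnorm p (K' D) a * (1 + \<eta>))"
    using second_t \<eta> by (intro pnorm_mono) auto
  also have "\<dots> = pnorm p (\<Union>D\<in>F. K' D) a * (1 + \<eta>)"
    using finF finK' disj \<eta> by (simp add: pnorm_scale_right pnorm_UN)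
  also have "\<dots> \<le> pnorm p K a * (1 + \<eta>)"
    using K'_sub \<eta> finK by (intro mult_right_mono pnorm_subset) auto
  finally have "pnorm p F (\<lambda>D. pnorm t D (\<lambda>d. pnorm r d (\<beta> d))) \<le> pnorm p K a * (1 + \<eta>)" .
  with split first_part have "val F v \<le> pnorm p K a + pnorm p K a * (1 + \<eta>)" by linarith
  then show ?thesis unfolding v_def K_def by (simp add: algebra_simps)
qed

text \<open>Iterates superadditivity over the blocks, each initial union of blocks being an initial segment or everything.\<close>

lemma lower_estimate:
  fixes blk :: "nat \<Rightarrow> nat"
  assumes blk: "mono blk" and x: "x \<in> X" and fin: "finite K"
  shows "pnorm p K (\<lambda>k. N (restr x {n. blk n = k})) \<le> N x"
proof -
  have *: "(\<Sum>k<m. N (restr x {n. blk n = k}) powr p) \<le> N (restr x {n. blk n < m}) powr p" for m :: nat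
  proof (induction m)
    case (Suc m)
    define z where "z = restr x {n. blk n < Suc m}"
    have z: "z \<in> X" using restr_mem_X[OF x] by (simp add: z_def)
    have "\<exists>c. (\<forall>n. blk n < m \<longleftrightarrow> n < c) \<or> (\<forall>n. blk n < m)"
    proof (cases "\<forall>n. blk n < m")
      case False
      then have ex: "\<exists>n. \<not> blk n < m" by blast
      have "blk n < m \<longleftrightarrow> n < (LEAST n. \<not> blk n < m)" for n
        using LeastI_ex[OF ex] not_less_Least[of n "\<lambda>n. \<not> blk n < m"] monoD[OF blk]
        by (meson le_less_trans linorder_not_less)
      then show ?thesis by blast
    qed blast
    then show ?case
    proof (elim exE disjE)
      fix c assume c: "\<forall>n. blk n < m \<longleftrightarrow> n < c"
      have n1: "n < c \<Longrightarrow> blk n < Suc m" for n using c less_SucI by blast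
      have n2: "c \<le> n \<and> blk n < Suc m \<longleftrightarrow> blk n = m" for n using spec[OF c, of n] by linarith
      have 1: "restr z {..<c} = restr x {n. blk n < m}"
        by (rule ext) (use n1 in \<open>simp add: z_def restr_def c[rule_format]\<close>)
      have 2: "restr z {c..} = restr x {n. blk n = m}"
        by (rule ext) (simp add: z_def restr_def n2[symmetric])
      show ?thesis using superadditive[OF z, of c] Suc unfolding 1 2 by (simp add: z_def)
    next
      assume all: "\<forall>n. blk n < m"
      then have "restr x {n. blk n = m} = (\<lambda>n. 0)" "z = restr x {n. blk n < m}"
        by (auto simp: restr_def fun_eq_iff less_Suc_eq z_def)
      then show ?thesis using Suc by (simp add: z_def)
    qed
  qed simp
  obtain m where m: "K \<subseteq> {..<m}" using fin finite_nat_iff_bounded by blast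
  have "(\<Sum>k\<in>K. N (restr x {n. blk n = k}) powr p) \<le> (\<Sum>k<m. N (restr x {n. blk n = k}) powr p)"
    using m by (intro sum_mono2) auto
  also have "\<dots> \<le> N x powr p"
    using *[of m] powr_mono2[OF _ N_nonneg[OF restr_mem_X[OF x]] N_restr_le[OF x], of p "{n. blk n < m}"] by simp
  finally show ?thesis using N_nonneg[OF x] N_nonneg[OF restr_mem_X[OF x]] by (simp add: pnorm_le_iff)
qed

end

section \<open>Subsequences equivalent to the unit vector basis of \<open>\<ell>\<^sub>p\<close>\<close>

lemma pnorm_singleton [simp]: "0 < s \<Longrightarrow> pnorm s {a} u = \<bar>u a\<bar>"
  by (simp add: pnorm_def powr_powr)

lemma diagonal_convergence:
  fixes f :: "nat \<Rightarrow> nat \<Rightarrow> real"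
  assumes "\<And>k c. \<bar>f k c\<bar> \<le> M"
  obtains s l where "strict_mono s" "\<And>c. (\<lambda>k. f (s k) c) \<longlonglongrightarrow> l c"
proof -
  interpret subseqs "\<lambda>c s. convergent (\<lambda>k. f (s k) c)"
  proof
    fix c and s :: "nat \<Rightarrow> nat" assume "strict_mono s"
    have "bounded (range (\<lambda>k. f (s k) c))" using assms by (auto simp: bounded_iff)
    then obtain l r where "strict_mono r" "((\<lambda>k. f (s k) c) \<circ> r) \<longlonglongrightarrow> l"
      using bounded_imp_convergent_subsequence by blast
    then show "\<exists>r'. strict_mono r' \<and> convergent (\<lambda>k. f ((s \<circ> r') k) c)"
      by (auto simp: convergent_def o_def)
  qed
  have "convergent (\<lambda>k. f (diagseq k) c)" for c
  proof -
    have "convergent (\<lambda>k. f ((diagseq \<circ> (+) (Suc c)) k) c)"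
    proof (rule diagseq_holds)
      fix r s :: "nat \<Rightarrow> nat" and n assume "strict_mono r" "convergent (\<lambda>k. f (s k) n)"
      then show "convergent (\<lambda>k. f ((s \<circ> r) k) n)"
        using convergent_subseq_convergent[of "\<lambda>k. f (s k) n" r] by (simp add: o_def)
    qed
    then have "convergent (\<lambda>k. f (diagseq (k + Suc c)) c)" by (simp add: o_def add.commute)
    then show ?thesis using convergent_ignore_initial_segment[of "\<lambda>k. f (diagseq k) c" "Suc c"] by blast
  qed
  then have "\<forall>c. \<exists>l. (\<lambda>k. f (diagseq k) c) \<longlonglongrightarrow> l" by (simp add: convergent_def)
  then obtain l where "\<And>c. (\<lambda>k. f (diagseq k) c) \<longlonglongrightarrow> l c" by metis
  then show ?thesis using that subseq_diagseq by blast
qed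

context exponents
begin

lemma r_le_p: "r \<le> p"
proof -
  have "1 / p \<le> 1 / r" unfolding r_eq by simp
  then show ?thesis by (simp add: divide_simps)
qed

lemma packing_disjoint: 
  assumes "packing D" "d \<in> D" "d' \<in> D" "d \<noteq> d'"
  shows "d \<inter> d' = {}"
proof -
  have "label ` d \<inter> label ` d' = {}" using assms unfolding packing_def by blast
  then show ?thesis by blast
qed

lemma packing_chain_disjoint:
  assumes "packing_chain F" "D \<in> F" "D' \<in> F" "D \<noteq> D'"
  shows "\<Union>D \<inter> \<Union>D' = {}"
proof -
  have "before (\<Union>D) (\<Union>D') \<or> before (\<Union>D') (\<Union>D)" using assms unfolding packing_chain_def by blast
  then show ?thesis unfolding before_def by blast
qed

lemma packing_finite_Union: "packing D \<Longrightarrow> finite (\<Union>D)"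
  using packing_finite packing_finite_member by blast

lemma packing_chain_finite_Union: "packing_chain F \<Longrightarrow> finite (\<Union>(\<Union>F))"
  using packing_finite packing_finite_member packing_chain_finite packing_chain_packing
  by (intro finite_Union) (meson UnionE finite_Union)+

text \<open>Since \<open>t \<ge> p \<ge> s\<close>, replacing the outer exponents by \<open>s\<close> increases the value, and the three layers then merge into one.\<close>

lemma val_le_flat:
  assumes F: "packing_chain F" and "s \<le> p" "0 < s"
    and le: "\<And>D d. D \<in> F \<Longrightarrow> d \<in> D \<Longrightarrow> pnorm r d x \<le> pnorm s d x"
  shows "val F x \<le> pnorm s (\<Union>(\<Union>F)) x"
proof -
  have D: "pnorm t D (\<lambda>d. pnorm r d x) \<le> pnorm s (\<Union>D) x" if "D \<in> F" for D
  proof -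
    have pD: "packing D" using F that by (rule packing_chain_packing)
    have "pnorm t D (\<lambda>d. pnorm r d x) \<le> pnorm t D (\<lambda>d. pnorm s d x)"
      using le[OF that] by (intro pnorm_mono) auto
    also have "\<dots> \<le> pnorm s D (\<lambda>d. pnorm s d x)"
      using assms(2,3) p_le_t packing_finite[OF pD] by (intro pnorm_exponent_mono) auto
    also have "\<dots> = pnorm s (\<Union>d\<in>D. d) x"
      using assms(3) packing_finite[OF pD] packing_finite_member[OF pD] packing_disjoint[OF pD]
      by (intro pnorm_UN[symmetric]) auto
    finally show ?thesis by simp
  qed
  have "val F x \<le> pnorm p F (\<lambda>D. pnorm s (\<Union>D) x)"
    unfolding val_def using D by (intro pnorm_mono) auto
  also have "\<dots> \<le> pnorm s F (\<lambda>D. pnorm s (\<Union>D) x)"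
    using assms(2,3) packing_chain_finite[OF F] by (intro pnorm_exponent_mono) auto
  also have "\<dots> = pnorm s (\<Union>D\<in>F. \<Union>D) x"
    using assms(3) packing_chain_finite[OF F] packing_finite_Union[OF packing_chain_packing[OF F]]
      packing_chain_disjoint[OF F] by (intro pnorm_UN[symmetric]) auto
  also have "(\<Union>D\<in>F. \<Union>D) = \<Union>(\<Union>F)" by blast
  finally show ?thesis .
qed

lemma finite_support:
  assumes "finite S" "\<And>n. n \<notin> S \<Longrightarrow> x n = 0"
  shows "x \<in> X" "N x \<le> pnorm r S x"
proof -
  have *: "val F x \<le> pnorm r S x" if F: "packing_chain F" for F
  proof -
    have fin: "finite (\<Union>(\<Union>F))" using F by (rule packing_chain_finite_Union)
    have "val F x \<le> pnorm r (\<Union>(\<Union>F)) x" using F r_le_p by (intro val_le_flat) auto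
    also have "\<dots> = pnorm r (\<Union>(\<Union>F) \<inter> S) x"
      using fin assms by (intro pnorm_neutral[symmetric]) auto
    also have "\<dots> \<le> pnorm r S x" using assms by (intro pnorm_subset) auto
    finally show ?thesis .
  qed
  show "x \<in> X" "N x \<le> pnorm r S x" using X_I[OF *] N_leI[OF *] by auto
qed

lemma restr_lessThan_tendsto_zero:
  assumes "\<And>n. (\<lambda>k. x k n) \<longlonglongrightarrow> 0"
  shows "(\<lambda>k. N (restr (x k) {..<b})) \<longlonglongrightarrow> 0"
proof (rule tendsto_sandwich[OF _ _ tendsto_const])
  have "(\<lambda>k. pnorm r {..<b} (x k)) \<longlonglongrightarrow> pnorm r {..<b} (\<lambda>n. 0)"
    using assms by (intro tendsto_pnorm) auto
  then show "(\<lambda>k. pnorm r {..<b} (x k)) \<longlonglongrightarrow> 0" by (simp add: pnorm_def)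
  have "N (restr (x k) {..<b}) \<le> pnorm r {..<b} (restr (x k) {..<b})" for k
    by (rule finite_support) (auto simp: restr_def)
  moreover have "pnorm r {..<b} (restr (x k) {..<b}) = pnorm r {..<b} (x k)" for k
    by (intro pnorm_cong) (auto simp: restr_def)
  ultimately show "\<forall>\<^sub>F k in sequentially. N (restr (x k) {..<b}) \<le> pnorm r {..<b} (x k)" by simp
  have "restr (x k) {..<b} \<in> X" for k by (rule finite_support[of "{..<b}"]) (auto simp: restr_def)
  then show "\<forall>\<^sub>F k in sequentially. 0 \<le> N (restr (x k) {..<b})" using N_nonneg by simp
qed

text \<open>Only the labels of the descending set are recorded, not its position, so that different blocks can be
  compared.\<close>

definition prof :: "nat set \<Rightarrow> (nat \<Rightarrow> real) \<Rightarrow> real" where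
  "prof J x = (SUP d\<in>{d. descending d \<and> label ` d \<subseteq> J}. pnorm r d x)"

lemma val_singleton: "val {D} x = pnorm t D (\<lambda>d. pnorm r d x)"
  by (simp add: val_def)

lemma descending_le_N: "x \<in> X \<Longrightarrow> descending d \<Longrightarrow> pnorm r d x \<le> N x"
  using val_le_N[of x "{{d}}"] by (simp add: val_singleton)

lemma le_prof: "x \<in> X \<Longrightarrow> descending d \<Longrightarrow> label ` d \<subseteq> J \<Longrightarrow> pnorm r d x \<le> prof J x"
  unfolding prof_def using descending_le_N[of x] by (intro cSUP_upper) (auto intro!: bdd_aboveI[of _ "N x"])

lemma prof_nonneg: "x \<in> X \<Longrightarrow> 0 \<le> prof J x"
  using le_prof[of x "{}" J] by simp

lemma prof_le_N: "x \<in> X \<Longrightarrow> prof J x \<le> N x"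
  unfolding prof_def using descending_le_N[of x] by (intro cSUP_least) (auto intro: exI[of _ "{}"])

text \<open>Disjoint label sets let almost optimal descending sets form one packing.\<close>

lemma prof_family_le_N:
  assumes x: "x \<in> X" and fin: "finite \<J>"
    and disj: "\<And>J J'. J \<in> \<J> \<Longrightarrow> J' \<in> \<J> \<Longrightarrow> J \<noteq> J' \<Longrightarrow> J \<inter> J' = {}"
  shows "pnorm t \<J> (\<lambda>J. prof J x) \<le> N x"
proof (rule field_le_epsilon)
  fix e :: real assume "e > 0"
  define \<delta> where "\<delta> = e / (1 + pnorm t \<J> (\<lambda>_. 1))"
  have pos: "1 + pnorm t \<J> (\<lambda>_. 1) > 0" using pnorm_nonneg[of t \<J> "\<lambda>_. 1"] by linarith
  have \<delta>: "\<delta> > 0" using \<open>e > 0\<close> pos by (simp add: \<delta>_def)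
  have "\<exists>d. descending d \<and> label ` d \<subseteq> J \<and> prof J x - \<delta> < pnorm r d x" for J
  proof -
    have "prof J x - \<delta> < (SUP d\<in>{d. descending d \<and> label ` d \<subseteq> J}. pnorm r d x)"
      using \<delta> by (simp add: prof_def)
    then show ?thesis
      by (subst (asm) less_cSUP_iff)
        (use descending_le_N[OF x] in \<open>auto intro: exI[of _ "{}"] intro!: bdd_aboveI[of _ "N x"]\<close>)
  qed
  then obtain d where d: "\<And>J. descending (d J)" "\<And>J. label ` d J \<subseteq> J" "\<And>J. prof J x - \<delta> < pnorm r (d J) x"
    by metis
  have sep: "label ` d J \<inter> label ` d J' = {}" if "J \<in> \<J>" "J' \<in> \<J>" "J \<noteq> J'" for J J'
    using disj[OF that] d(2) by blast
  have "packing (d ` \<J>)"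
    unfolding packing_def
  proof (intro conjI ballI impI)
    fix e e' assume e: "e \<in> d ` \<J>" "e' \<in> d ` \<J>" "e \<noteq> e'"
    obtain J J' where J: "J \<in> \<J>" "J' \<in> \<J>" "e = d J" "e' = d J'" using e(1,2) by blast
    then have "J \<noteq> J'" using e(3) by blast
    then show "label ` e \<inter> label ` e' = {}" using sep[OF J(1,2)] J(3,4) by simp
  qed (use fin d(1) in auto)
  have "pnorm t \<J> (\<lambda>J. prof J x) \<le> pnorm t \<J> (\<lambda>J. pnorm r (d J) x + \<delta>)"
    using d(3) prof_nonneg[OF x] \<delta> by (intro pnorm_mono) (auto simp: less_imp_le diff_less_eq)
  also have "\<dots> \<le> pnorm t \<J> (\<lambda>J. pnorm r (d J) x) + pnorm t \<J> (\<lambda>J. \<delta> * 1)"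
    unfolding mult_1_right using fin by (intro pnorm_triangle) auto
  also have "pnorm t \<J> (\<lambda>J. \<delta> * 1) = \<delta> * pnorm t \<J> (\<lambda>_. 1)"
    using \<delta> by (subst pnorm_scale) auto
  also have "pnorm t \<J> (\<lambda>J. pnorm r (d J) x) = pnorm t (d ` \<J>) (\<lambda>d. pnorm r d x)"
  proof (rule pnorm_reindex_nontrivial[symmetric, OF fin])
    fix J J' assume J: "J \<in> \<J>" "J' \<in> \<J>" "J \<noteq> J'" "d J = d J'"
    have "d J = {}" using sep[OF J(1,2,3)] J(4) by auto
    then show "pnorm r (d J) x = 0" by simp
  qed
  also have "\<dots> \<le> N x"
    using val_le_N[OF x, of "{d ` \<J>}"] \<open>packing (d ` \<J>)\<close> by (simp add: val_singleton)
  also have "\<delta> * pnorm t \<J> (\<lambda>_. 1) \<le> e"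
    using pos \<open>e > 0\<close> by (simp add: \<delta>_def field_simps)
  finally show "pnorm t \<J> (\<lambda>J. prof J x) \<le> N x + e" by simp
qed

text \<open>A diagonal subsequence makes all profiles converge.  The limits satisfy the packing bound as every \<open>u k\<close>
  does.  Adding \<open>\<eta> * (1/2) ^ Suc (Max J)\<close> turns the limits into eventual upper bounds; disjoint sets have
  distinct maxima, so the additions sum up to at most \<open>\<eta>\<close>.\<close>

lemma stable_profile:
  assumes u: "\<And>k. u k \<in> X" "\<And>k. N (u k) \<le> 1" and \<eta>: "0 < \<eta>"
  obtains s :: "nat \<Rightarrow> nat" and w where "strict_mono s" "\<And>J. 0 \<le> w J"
    "\<And>\<J>. finite \<J> \<Longrightarrow> (\<And>J. J \<in> \<J> \<Longrightarrow> finite J \<and> J \<noteq> {}) \<Longrightarrow>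
      (\<And>J J'. J \<in> \<J> \<Longrightarrow> J' \<in> \<J> \<Longrightarrow> J \<noteq> J' \<Longrightarrow> J \<inter> J' = {}) \<Longrightarrow> pnorm t \<J> w \<le> 1 + \<eta>"
    "\<And>b. eventually (\<lambda>k. \<forall>J. J \<subseteq> {..<b} \<longrightarrow> prof J (u (s k)) \<le> w J) sequentially"
proof -
  have "\<bar>prof (set_decode c) (u k)\<bar> \<le> 1" for c k
    using prof_nonneg[OF u(1), of "set_decode c" k] prof_le_N[OF u(1), of "set_decode c" k] u(2)[of k] by linarith
  then obtain s l where s: "strict_mono s" and l: "\<And>c. (\<lambda>k. prof (set_decode c) (u (s k))) \<longlonglongrightarrow> l c"
    using diagonal_convergence[of "\<lambda>k c. prof (set_decode c) (u k)" 1] by blast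
  have l0: "0 \<le> l c" for c
    using prof_nonneg[OF u(1)] by (intro tendsto_lowerbound[OF l]) auto
  define \<pi> where "\<pi> J = l (set_encode J)" for J
  have \<pi>: "(\<lambda>k. prof J (u (s k))) \<longlonglongrightarrow> \<pi> J" if "finite J" for J
    using l[of "set_encode J"] that by (simp add: \<pi>_def)
  define w where "w J = \<pi> J + \<eta> * (1/2) ^ Suc (Max J)" for J
  show ?thesis
  proof (rule that[OF s])
    show "0 \<le> w J" for J using l0 \<eta> by (simp add: w_def \<pi>_def)
    show "pnorm t \<J> w \<le> 1 + \<eta>"
      if fin: "finite \<J>" and ne: "\<And>J. J \<in> \<J> \<Longrightarrow> finite J \<and> J \<noteq> {}"
        and disj: "\<And>J J'. J \<in> \<J> \<Longrightarrow> J' \<in> \<J> \<Longrightarrow> J \<noteq> J' \<Longrightarrow> J \<inter> J' = {}" for \<J>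
    proof -
      have 1: "pnorm t \<J> \<pi> \<le> 1"
      proof (rule tendsto_upperbound)
        show "(\<lambda>k. pnorm t \<J> (\<lambda>J. prof J (u (s k)))) \<longlonglongrightarrow> pnorm t \<J> \<pi>"
          using \<pi> ne by (intro tendsto_pnorm) auto
        show "\<forall>\<^sub>F k in sequentially. pnorm t \<J> (\<lambda>J. prof J (u (s k))) \<le> 1"
          using order_trans[OF prof_family_le_N[OF u(1) fin disj] u(2)] by simp
      qed simp
      have inj: "inj_on Max \<J>"
      proof (rule inj_onI)
        fix J J' assume J: "J \<in> \<J>" "J' \<in> \<J>" "Max J = Max J'"
        then have "Max J \<in> J \<inter> J'" using ne[OF J(1)] ne[OF J(2)] Max_in by (metis IntI)
        then show "J = J'" using disj[OF J(1,2)] by blast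
      qed
      have "pnorm t \<J> (\<lambda>J. \<eta> * (1/2) ^ Suc (Max J)) = \<eta> * pnorm t \<J> (\<lambda>J. (1/2) ^ Suc (Max J))"
        using \<eta> by (subst pnorm_scale) auto
      also have "pnorm t \<J> (\<lambda>J. (1/2) ^ Suc (Max J)) \<le> pnorm 1 \<J> (\<lambda>J. (1/2) ^ Suc (Max J))"
        using fin by (intro pnorm_exponent_mono) auto
      also have "\<dots> = (\<Sum>J\<in>\<J>. (1/2) ^ Suc (Max J))" by (simp add: pnorm_def sum_nonneg)
      also have "\<dots> = (\<Sum>j\<in>Max ` \<J>. (1/2) ^ Suc j)" using inj by (simp add: sum.reindex)
      also have "\<dots> \<le> (\<Sum>j. (1/2) ^ Suc j)"
        using fin sums_summable[OF power_half_series] by (intro sum_le_suminf) auto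
      also have "\<dots> = 1" using power_half_series sums_unique by metis
      finally have 2: "pnorm t \<J> (\<lambda>J. \<eta> * (1/2) ^ Suc (Max J)) \<le> \<eta>" using \<eta> by simp
      have "pnorm t \<J> w \<le> pnorm t \<J> \<pi> + pnorm t \<J> (\<lambda>J. \<eta> * (1/2) ^ Suc (Max J))"
        unfolding w_def using fin by (intro pnorm_triangle) auto
      then show ?thesis using 1 2 by linarith
    qed
    show "eventually (\<lambda>k. \<forall>J. J \<subseteq> {..<b} \<longrightarrow> prof J (u (s k)) \<le> w J) sequentially" for b
    proof -
      have "eventually (\<lambda>k. prof J (u (s k)) \<le> w J) sequentially" if "J \<in> Pow {..<b}" for J
      proof -
        have "finite J" using that finite_subset by blast
        moreover have "\<pi> J < w J" using \<eta> by (simp add: w_def)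
        ultimately have "\<forall>\<^sub>F k in sequentially. prof J (u (s k)) < w J"
          using order_tendstoD(2)[OF \<pi>] by blast
        then show ?thesis by eventually_elim simp
      qed
      then have "eventually (\<lambda>k. \<forall>J\<in>Pow {..<b}. prof J (u (s k)) \<le> w J) sequentially"
        by (intro eventually_ball_finite) auto
      then show ?thesis by (simp add: Ball_def)
    qed
  qed
qed

text \<open>A gliding hump: the vectors \<open>U (\<kappa> k)\<close> are, up to errors \<open>\<epsilon> k\<close>, supported in \<open>{b k..<b (Suc k)}\<close>, and
  \<open>\<kappa> k\<close> is chosen so late that all profiles with labels below \<open>b k\<close> are already stable.  As labels do
  not exceed indices, this covers every label of an earlier block.\<close>

theorem lp_subsequence:
  assumes u: "\<And>k. u k \<in> X" "\<And>k. N (u k) \<le> 1" and null: "\<And>n. (\<lambda>k. u k n) \<longlonglongrightarrow> 0"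
  obtains \<rho> :: "nat \<Rightarrow> nat" where "strict_mono \<rho>"
    "\<And>K a. finite K \<Longrightarrow> N (\<lambda>n. \<Sum>k\<in>K. a k * u (\<rho> k) n) \<le> 5/2 * pnorm p K a"
    "\<And>K a. finite K \<Longrightarrow> pnorm p K (\<lambda>k. a k * N (u (\<rho> k)))
        \<le> N (\<lambda>n. \<Sum>k\<in>K. a k * u (\<rho> k) n) + 1/5 * pnorm p K a"
proof -
  obtain s w where s: "strict_mono s" and w0: "\<And>J. 0 \<le> w J"
    and prof_w: "\<And>\<J>. finite \<J> \<Longrightarrow> (\<And>J. J \<in> \<J> \<Longrightarrow> finite J \<and> J \<noteq> {}) \<Longrightarrow>
      (\<And>J J'. J \<in> \<J> \<Longrightarrow> J' \<in> \<J> \<Longrightarrow> J \<noteq> J' \<Longrightarrow> J \<inter> J' = {}) \<Longrightarrow> pnorm t \<J> w \<le> 1 + 1/4"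
    and stable: "\<And>b. eventually (\<lambda>k. \<forall>J. J \<subseteq> {..<b} \<longrightarrow> prof J (u (s k)) \<le> w J) sequentially"
    by (rule stable_profile[of u "1/4"]) (use u in auto)
  define U where "U k = u (s k)" for k
  have U: "U k \<in> X" "N (U k) \<le> 1" for k using u by (auto simp: U_def)
  have Unull: "(\<lambda>k. U k n) \<longlonglongrightarrow> 0" for n
    using LIMSEQ_subseq_LIMSEQ[OF null s] by (simp add: U_def o_def)
  \<comment> \<open>The errors at both ends of a block add up to \<open>1/10\<close>; with \<open>2 + 1/4\<close> from the blocks this stays below \<open>5/2\<close>.\<close>
  define \<epsilon> :: "nat \<Rightarrow> real" where "\<epsilon> j = (1/20) * (1/2) ^ Suc j" for j
  have \<epsilon>: "0 < \<epsilon> j" for j by (simp add: \<epsilon>_def)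
  define P where "P j kb \<longleftrightarrow> (j = 0 \<longrightarrow> snd kb = 0) \<and> N (restr (U (fst kb)) {..<snd kb}) \<le> \<epsilon> j \<and>
      (\<forall>J. J \<subseteq> {..<snd kb} \<longrightarrow> J \<noteq> {} \<longrightarrow> prof J (U (fst kb)) \<le> w J)" for j and kb :: "nat \<times> nat"
  define Q where "Q j kb kb' \<longleftrightarrow> fst kb < fst kb' \<and> snd kb < snd kb' \<and> N (restr (U (fst kb)) {snd kb'..}) \<le> \<epsilon> j"
    for j and kb kb' :: "nat \<times> nat"
  have "\<exists>kb. P 0 kb"
  proof
    have "restr (U 0) {} = (\<lambda>n. 0)" by (simp add: restr_def)
    then show "P 0 (0, 0)" using \<epsilon>[of 0] by (simp add: P_def)
  qed
  moreover have "\<exists>kb'. P (Suc j) kb' \<and> Q j kb kb'" if "P j kb" for j kb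
  proof -
    obtain c where c: "\<And>c'. c' \<ge> c \<Longrightarrow> N (restr (U (fst kb)) {c'..}) < \<epsilon> j"
      using tail_tendsto_zero[OF U(1) \<epsilon>] by blast
    define b' where "b' = max c (Suc (snd kb))"
    have "eventually (\<lambda>k. N (restr (U k) {..<b'}) < \<epsilon> (Suc j)) sequentially"
      using order_tendstoD(2)[OF restr_lessThan_tendsto_zero[OF Unull] \<epsilon>] .
    moreover have "eventually (\<lambda>k. fst kb < k) sequentially" by (rule eventually_gt_at_top)
    ultimately have "eventually (\<lambda>k. N (restr (U k) {..<b'}) < \<epsilon> (Suc j) \<and> fst kb < k \<and>
        (\<forall>J. J \<subseteq> {..<b'} \<longrightarrow> prof J (U k) \<le> w J)) sequentially"
      using stable[of b'] unfolding U_def by eventually_elim auto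
    then obtain k where k: "N (restr (U k) {..<b'}) < \<epsilon> (Suc j)" "fst kb < k"
        "\<forall>J. J \<subseteq> {..<b'} \<longrightarrow> prof J (U k) \<le> w J"
      using eventually_happens'[OF sequentially_bot] by blast
    have "P (Suc j) (k, b') \<and> Q j kb (k, b')"
      using k c[of b'] by (auto simp: P_def Q_def b'_def)
    then show ?thesis by blast
  qed
  ultimately obtain kb where kb: "\<And>j. P j (kb j)" "\<And>j. Q j (kb j) (kb (Suc j))"
    using dependent_nat_choice[of P Q] by metis
  define \<kappa> b where "\<kappa> j = fst (kb j)" and "b j = snd (kb j)" for j
  have \<kappa>: "strict_mono \<kappa>" and b: "strict_mono b"
    using kb(2) by (auto simp: strict_mono_Suc_iff Q_def \<kappa>_def b_def)
  have b0: "b 0 = 0" using kb(1)[of 0] by (simp add: P_def b_def)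
  have head: "N (restr (U (\<kappa> j)) {..<b j}) \<le> \<epsilon> j" for j using kb(1)[of j] by (simp add: P_def \<kappa>_def b_def)
  have tail: "N (restr (U (\<kappa> j)) {b (Suc j)..}) \<le> \<epsilon> j" for j using kb(2)[of j] by (simp add: Q_def \<kappa>_def b_def)
  have prof_le: "prof J (U (\<kappa> j)) \<le> w J" if "J \<subseteq> {..<b j}" "J \<noteq> {}" for j J
    using kb(1)[of j] that by (simp add: P_def \<kappa>_def b_def)
  define blk where "blk n = (LEAST j. n < b (Suc j))" for n
  have blk_less: "n < b (Suc (blk n))" for n
    unfolding blk_def using LeastI[of "\<lambda>j. n < b (Suc j)" n] strict_mono_imp_increasing[OF b, of "Suc n"] by simp
  have blk_ge: "b (blk n) \<le> n" for n
  proof (cases "blk n")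
    case (Suc j)
    then show ?thesis using not_less_Least[of j "\<lambda>j. n < b (Suc j)"] unfolding blk_def by simp
  qed (simp add: b0)
  have blk_eq: "blk n = k \<longleftrightarrow> b k \<le> n \<and> n < b (Suc k)" for n k
  proof
    assume n: "b k \<le> n \<and> n < b (Suc k)"
    have "b (blk n) < b (Suc k)" "b k < b (Suc (blk n))" using n blk_ge[of n] blk_less[of n] by linarith+
    then show "blk n = k" using strict_mono_less[OF b] by simp
  qed (use blk_ge blk_less in auto)
  have blk_mono: "mono blk"
  proof (rule monoI)
    fix m n :: nat assume "m \<le> n"
    then have "b (blk m) < b (Suc (blk n))" using blk_ge[of m] blk_less[of n] by linarith
    then show "blk m \<le> blk n" using strict_mono_less[OF b] by simp
  qed
  define uu where "uu n = U (\<kappa> (blk n)) n" for n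
  define y where "y k = restr (U (\<kappa> k)) {n. blk n = k}" for k
  have y_uu: "restr uu {n. blk n = k} = y k" for k by (auto simp: uu_def y_def restr_def)
  have y: "y k \<in> X" "N (y k) \<le> 1" for k
    using restr_mem_X[OF U(1)] N_restr_le[OF U(1)] U(2) unfolding y_def by (blast intro: order_trans)+
  have y_err_X: "(\<lambda>n. U (\<kappa> k) n - y k n) \<in> X" for k using diff_mem_X U(1) y(1) by blast
  have y_err: "N (\<lambda>n. U (\<kappa> k) n - y k n) \<le> 2 * \<epsilon> k" for k
  proof -
    have "(\<lambda>n. U (\<kappa> k) n - y k n) = (\<lambda>n. restr (U (\<kappa> k)) {..<b k} n + restr (U (\<kappa> k)) {b (Suc k)..} n)"
      using strict_monoD[OF b, of k "Suc k"] by (auto simp: y_def restr_def fun_eq_iff blk_eq)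
    then show ?thesis
      using N_triangle[OF restr_mem_X[OF U(1)] restr_mem_X[OF U(1)], of "\<kappa> k" "{..<b k}" "\<kappa> k" "{b (Suc k)..}"] 
        head[of k] tail[of k] by simp
  qed
  have upper: "val F (\<lambda>n. a (blk n) * uu n) \<le> (2 + 1/4) * pnorm p (blk ` \<Union>(\<Union>F)) a" 
    if "packing_chain F" for F a
  proof (rule upper_estimate[OF blk_mono _ _ w0 prof_w _ that])
    show "restr uu {n. blk n = k} \<in> X" "N (restr uu {n. blk n = k}) \<le> 1" for k using y by (auto simp: y_uu)
    fix d m k assume d: "descending d" "d \<noteq> {}" "\<And>n. n \<in> d \<Longrightarrow> blk n = k" "blk m < k" "\<And>n. n \<in> d \<Longrightarrow> label n < label m"
    have "m < b k" using blk_less[of m] d(4) strict_mono_less_eq[OF b, of "Suc (blk m)" k] by linarith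
    then have sub: "label ` d \<subseteq> {..<b k}" using d(5) label_le[of m] by (auto intro: less_le_trans less_trans)
    have "pnorm r d uu = pnorm r d (U (\<kappa> k))" using d(3) by (intro pnorm_cong) (auto simp: uu_def)
    also have "\<dots> \<le> prof (label ` d) (U (\<kappa> k))" using d(1) U(1) by (intro le_prof) auto
    also have "\<dots> \<le> w (label ` d)" using sub d(2) by (intro prof_le) auto
    finally show "pnorm r d uu \<le> w (label ` d)" .
  qed
  have main: "N (\<lambda>n. \<Sum>k\<in>K. a k * U (\<kappa> k) n) \<le> 5/2 * pnorm p K a \<and>
      pnorm p K (\<lambda>k. a k * N (U (\<kappa> k))) \<le> N (\<lambda>n. \<Sum>k\<in>K. a k * U (\<kappa> k) n) + 1/5 * pnorm p K a"
    if K: "finite K" for K a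
  proof -
    define A where "A = pnorm p K a"
    define a' where "a' k = (if k \<in> K then a k else 0)" for k
    define v v' where "v n = (\<Sum>k\<in>K. a k * U (\<kappa> k) n)" and "v' n = (\<Sum>k\<in>K. a k * y k n)" for n
    have vX: "v \<in> X" "v' \<in> X" 
      unfolding v_def[abs_def] v'_def[abs_def] by (rule sum_mem_X[OF K U(1)], rule sum_mem_X[OF K y(1)])
    have v'_eq: "v' n = a' (blk n) * uu n" for n
    proof -
      have "v' n = (\<Sum>k\<in>K. if k = blk n then a k * uu n else 0)"
        unfolding v'_def by (intro sum.cong) (auto simp: y_def restr_def uu_def)
      then show ?thesis using K by (simp add: a'_def)
    qed
    have N_v': "N v' \<le> 9/4 * A"
    proof (rule N_leI)
      fix F assume F: "packing_chain F"
      have "val F v' \<le> (2 + 1/4) * pnorm p (blk ` \<Union>(\<Union>F)) a'"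
        using upper[OF F, of a'] by (simp only: v'_eq[abs_def])
      also have "pnorm p (blk ` \<Union>(\<Union>F)) a' = pnorm p (blk ` \<Union>(\<Union>F) \<inter> K) a'"
        using packing_chain_finite_Union[OF F] by (intro pnorm_neutral[symmetric]) (auto simp: a'_def)
      also have "\<dots> \<le> pnorm p K a'" using K by (intro pnorm_subset) auto
      also have "\<dots> = A" unfolding A_def by (intro pnorm_cong) (auto simp: a'_def)
      finally show "val F v' \<le> 9/4 * A" by simp
    qed
    have err: "N (\<lambda>n. v n - v' n) \<le> 1/10 * A"
    proof -
      have "N (\<lambda>n. v n - v' n) = N (\<lambda>n. \<Sum>k\<in>K. a k * (U (\<kappa> k) n - y k n))"
        by (simp add: v_def v'_def sum_subtractf right_diff_distrib)
      also have "\<dots> \<le> (\<Sum>k\<in>K. \<bar>a k\<bar> * N (\<lambda>n. U (\<kappa> k) n - y k n))"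
        by (rule N_sum_le[OF K y_err_X])
      also have "\<dots> \<le> (\<Sum>k\<in>K. A * (2 * \<epsilon> k))"
      proof (intro sum_mono mult_mono)
        show "\<bar>a k\<bar> \<le> A" if "k \<in> K" for k unfolding A_def using K that by (intro pnorm_member) auto
        show "N (\<lambda>n. U (\<kappa> k) n - y k n) \<le> 2 * \<epsilon> k" for k by (rule y_err)
        show "0 \<le> N (\<lambda>n. U (\<kappa> k) n - y k n)" for k by (rule N_nonneg[OF y_err_X])
      qed (simp add: A_def)
      also have "\<dots> = A * (1/10) * (\<Sum>k\<in>K. (1/2) ^ Suc k)"
        unfolding sum_distrib_left by (intro sum.cong) (auto simp: \<epsilon>_def)
      also have "(\<Sum>k\<in>K. (1/2) ^ Suc k :: real) \<le> (\<Sum>k. (1/2) ^ Suc k)"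
        using K sums_summable[OF power_half_series] by (intro sum_le_suminf) auto
      also have "\<dots> = 1" using power_half_series sums_unique by metis
      finally show ?thesis by (simp add: A_def mult_left_mono)
    qed
    have A: "0 \<le> A" by (simp add: A_def)
    have "N v \<le> N (\<lambda>n. v n - v' n) + N v'" using N_triangle[OF diff_mem_X[OF vX] vX(2)] by simp
    then have up: "N v \<le> 5/2 * A" using err N_v' A by linarith
    have v'v: "N v' \<le> N v + 1/10 * A"
      using N_triangle_diff[OF vX(1) diff_mem_X[OF vX]] err by simp
    have "pnorm p K (\<lambda>k. a k * N (U (\<kappa> k))) \<le> pnorm p K (\<lambda>k. a k * N (y k) + a k * (1/10))"
    proof (rule pnorm_mono)
      fix k
      have "\<epsilon> k \<le> 1/20" using power_le_one[of "1/2 :: real" "Suc k"] by (simp add: \<epsilon>_def)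
      then have "N (U (\<kappa> k)) \<le> N (y k) + 1/10"
        using N_triangle[OF y_err_X[of k] y(1)[of k]] y_err[of k] by simp
      then have "\<bar>a k\<bar> * N (U (\<kappa> k)) \<le> \<bar>a k\<bar> * (N (y k) + 1/10)" by (intro mult_left_mono) auto
      then show "\<bar>a k * N (U (\<kappa> k))\<bar> \<le> \<bar>a k * N (y k) + a k * (1/10)\<bar>"
        unfolding distrib_left[symmetric] abs_mult
        using N_nonneg[OF U(1), of "\<kappa> k"] N_nonneg[OF y(1), of k] by simp
    qed simp
    also have "\<dots> \<le> pnorm p K (\<lambda>k. a k * N (y k)) + pnorm p K (\<lambda>k. a k * (1/10))"
      using K by (intro pnorm_triangle) auto
    also have "pnorm p K (\<lambda>k. a k * (1/10)) = A * (1/10)"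
      unfolding A_def by (subst pnorm_scale_right) auto
    also have "pnorm p K (\<lambda>k. a k * N (y k)) = pnorm p K (\<lambda>k. N (restr v' {n. blk n = k}))"
    proof (intro pnorm_cong refl)
      fix k assume "k \<in> K"
      then have "restr v' {n. blk n = k} = (\<lambda>n. a k * y k n)"
        by (auto simp: restr_def v'_eq y_def uu_def a'_def fun_eq_iff)
      then show "\<bar>a k * N (y k)\<bar> = \<bar>N (restr v' {n. blk n = k})\<bar>"
        using N_scale[OF y(1), of "a k"] by (simp add: abs_mult)
    qed
    also have "\<dots> \<le> N v'" by (rule lower_estimate[OF blk_mono vX(2) K])
    finally show ?thesis using up v'v unfolding A_def v_def by simp
  qed
  show ?thesis
  proof (rule that[of "s \<circ> \<kappa>"])
    show "strict_mono (s \<circ> \<kappa>)" using s \<kappa> by (rule strict_mono_o)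
  qed (use main in \<open>simp_all add: U_def\<close>)
qed

end

section \<open>Unit vectors, duality and reflexivity\<close>

lemma sum_fun_apply: "(\<Sum>i\<in>A. f i) x = (\<Sum>i\<in>A. f i x)" for f :: "'i \<Rightarrow> 'a \<Rightarrow> 'b::comm_monoid_add"
  by (induction A rule: infinite_finite_induct) (auto simp: plus_fun_def zero_fun_def)

lemma sum_unit_vector:
  assumes "finite I" "inj_on \<pi> I"
  shows "(\<Sum>i\<in>I. unit_vector (\<pi> i)) = (\<lambda>n. if n \<in> \<pi> ` I then 1 else 0)"
proof
  fix n
  have "(\<Sum>i\<in>I. unit_vector (\<pi> i)) n = (\<Sum>i\<in>I. if \<pi> i = n then 1 else 0)"
    by (simp add: sum_fun_apply unit_vector_def eq_commute)
  also have "\<dots> = (\<Sum>k\<in>\<pi> ` I. if k = n then 1 else 0)"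
    by (subst sum.reindex) (use assms in \<open>auto simp: o_def\<close>)
  also have "\<dots> = (if n \<in> \<pi> ` I then 1 else 0)" using assms(1) by simp
  finally show "(\<Sum>i\<in>I. unit_vector (\<pi> i)) n = (if n \<in> \<pi> ` I then 1 else 0)" .
qed

lemma powr_inverse_average_tendsto_zero:
  assumes "1 < p"
  shows "(\<lambda>m. real m powr (1 / p) / real m) \<longlonglongrightarrow> 0"
proof -
  have "(\<lambda>m. real m powr (1 / p - 1)) \<longlonglongrightarrow> 0"
    using assms by (intro tendsto_neg_powr filterlim_real_sequentially) auto
  moreover have "eventually (\<lambda>m. real m powr (1 / p - 1) = real m powr (1 / p) / real m) sequentially"
    using eventually_gt_at_top[of "0::nat"] by eventually_elim (simp add: powr_diff)
  ultimately show ?thesis by (rule Lim_transform_eventually)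
qed

context exponents
begin

lemma pnorm_card: "0 < s \<Longrightarrow> pnorm s A (\<lambda>_. 1) = real (card A) powr (1 / s)"
  by (simp add: pnorm_def)

lemma unit_vector_mem_X: "unit_vector n \<in> X"
  by (rule finite_support[of "{n}"]) (auto simp: unit_vector_def)

lemma N_unit_vector_le: "N (unit_vector n) \<le> 1"
  using finite_support(2)[of "{n}" "unit_vector n"] by (simp add: unit_vector_def)

lemma infinite_dimensional_X: "infinite_dimensional X"
  unfolding infinite_dimensional_def
proof
  assume "\<exists>B::(nat \<Rightarrow> real) set. finite B \<and> span B = X"
  then obtain B :: "(nat \<Rightarrow> real) set" where B: "finite B" "span B = X" by blast
  define S :: "(nat \<Rightarrow> real) set" where "S = unit_vector ` {..card B}"
  have inj: "inj_on unit_vector {..card B}"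
    by (rule inj_onI) (metis unit_vector_def zero_neq_one)
  have "independent S"
  proof
    assume "dependent S"
    then obtain u n where n: "n \<in> {..card B}" and u: "u (unit_vector n) \<noteq> 0"
        and 0: "(\<Sum>v\<in>unit_vector ` {..card B}. u v *\<^sub>R v) = 0"
      using dependent_finite[of S] unfolding S_def by auto
    have "0 = (\<Sum>v\<in>unit_vector ` {..card B}. u v *\<^sub>R v) n" unfolding 0 by (simp add: zero_fun_def)
    also have "\<dots> = (\<Sum>k\<in>{..card B}. u (unit_vector k) * unit_vector k n)"
      using inj by (simp add: sum_fun_apply sum.reindex scaleR_fun_def)
    also have "\<dots> = (\<Sum>k\<in>{..card B}. if k = n then u (unit_vector n) else 0)"
      by (intro sum.cong) (auto simp: unit_vector_def)
    also have "\<dots> = u (unit_vector n)" using n by simp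
    finally show False using u by simp
  qed
  moreover have "S \<subseteq> span B" using unit_vector_mem_X by (auto simp: S_def B(2))
  ultimately have "card S \<le> card B" using independent_span_bound[OF B(1)] by blast
  then show False using inj by (simp add: S_def card_image)
qed

abbreviation "X_dual \<equiv> dual_carrier X N"

lemma dual_add: "f \<in> X_dual \<Longrightarrow> x \<in> X \<Longrightarrow> y \<in> X \<Longrightarrow> f (\<lambda>n. x n + y n) = f x + f y"
  by (auto simp: dual_carrier_def plus_fun_def)

lemma dual_scale: "f \<in> X_dual \<Longrightarrow> x \<in> X \<Longrightarrow> f (\<lambda>n. c * x n) = c * f x"
  by (auto simp: dual_carrier_def scaleR_fun_def)

lemma dual_sum:
  assumes "f \<in> X_dual" "finite K" "\<And>k. k \<in> K \<Longrightarrow> x k \<in> X"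
  shows "f (\<lambda>n. \<Sum>k\<in>K. a k * x k n) = (\<Sum>k\<in>K. a k * f (x k))"
  using assms(2,3)
proof (induction K rule: finite_induct)
  case empty
  then show ?case using dual_scale[OF assms(1) zero_mem_X, of 0] by simp
next
  case (insert k K)
  have "(\<lambda>n. a k * x k n) \<in> X" using insert.prems scale_mem_X by simp
  moreover have "(\<lambda>n. \<Sum>k\<in>K. a k * x k n) \<in> X" by (rule sum_mem_X) (use insert in auto)
  ultimately show ?case using insert dual_add[OF assms(1)] dual_scale[OF assms(1)] by simp
qed

lemma dual_I:
  assumes "\<And>x y. x \<in> X \<Longrightarrow> y \<in> X \<Longrightarrow> g (\<lambda>n. x n + y n) = g x + g y"
    and "\<And>c x. x \<in> X \<Longrightarrow> g (\<lambda>n. c * x n) = c * g x"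
    and "\<And>x. x \<in> X \<Longrightarrow> \<bar>g x\<bar> \<le> C * N x"
  shows "(\<lambda>x. if x \<in> X then g x else 0) \<in> X_dual"
proof -
  have "\<exists>K. \<forall>x\<in>X. \<bar>g x\<bar> \<le> K * N x" using assms(3) by blast
  then show ?thesis
    using assms(1,2) add_mem_X scale_mem_X unfolding dual_carrier_def
    by (auto simp: plus_fun_def scaleR_fun_def)
qed

lemma dual_norm_leI:
  assumes "\<And>x. x \<in> X \<Longrightarrow> N x \<le> 1 \<Longrightarrow> \<bar>f x\<bar> \<le> C"
  shows "dual_norm X N f \<le> C"
  unfolding dual_norm_def using assms zero_mem_X N_zero by (intro cSUP_least) (auto intro!: exI[of _ "\<lambda>n. 0"])

lemma dual_le:
  assumes f: "f \<in> X_dual" and x: "x \<in> X"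
  shows "\<bar>f x\<bar> \<le> dual_norm X N f * N x"
proof (cases "N x = 0")
  case True
  have "x = (\<lambda>n. 0)" using coordinate_le_N[OF x] True by fastforce
  then show ?thesis using True dual_scale[OF f x, of 0] by simp
next
  case False
  then have Nx: "N x > 0" using N_nonneg[OF x] by simp
  obtain C where C: "\<And>x. x \<in> X \<Longrightarrow> \<bar>f x\<bar> \<le> C * N x" using f unfolding dual_carrier_def by blast
  have "bdd_above ((\<lambda>x. \<bar>f x\<bar>) ` {x \<in> X. N x \<le> 1})"
  proof (rule bdd_aboveI2)
    fix y assume y: "y \<in> {x \<in> X. N x \<le> 1}"
    have "\<bar>f y\<bar> \<le> \<bar>C\<bar> * N y" using C[of y] y mult_right_mono[OF abs_ge_self[of C] N_nonneg[of y]] by auto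
    also have "\<dots> \<le> \<bar>C\<bar>" using y by (simp add: mult_left_le)
    finally show "\<bar>f y\<bar> \<le> \<bar>C\<bar>" .
  qed
  moreover have "(\<lambda>n. inverse (N x) * x n) \<in> {x \<in> X. N x \<le> 1}"
    using scale_mem_X[OF x] N_scale[OF x] Nx by simp
  ultimately have "\<bar>f (\<lambda>n. inverse (N x) * x n)\<bar> \<le> dual_norm X N f"
    unfolding dual_norm_def by (rule cSUP_upper2) auto
  then have "\<bar>inverse (N x) * f x\<bar> \<le> dual_norm X N f" unfolding dual_scale[OF f x] .
  then show ?thesis using Nx by (simp add: abs_mult field_simps)
qed

lemma dual_norm_nonneg: "f \<in> X_dual \<Longrightarrow> 0 \<le> dual_norm X N f"
  using dual_le[of f "unit_vector 0"] N_unit_vector_le[of 0] unit_vector_mem_X coordinate_le_N[of "unit_vector 0" 0]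
  by (simp add: unit_vector_def)

lemma dual_combine: "f \<in> X_dual \<Longrightarrow> g \<in> X_dual \<Longrightarrow> (\<lambda>x. f x + c * g x) \<in> X_dual"
proof -
  assume f: "f \<in> X_dual" and g: "g \<in> X_dual"
  have "(\<lambda>x. if x \<in> X then f x + c * g x else 0) \<in> X_dual"
  proof (rule dual_I)
    fix x assume x: "x \<in> X"
    have "\<bar>f x + c * g x\<bar> \<le> \<bar>f x\<bar> + \<bar>c\<bar> * \<bar>g x\<bar>" by (metis abs_mult abs_triangle_ineq)
    also have "\<dots> \<le> dual_norm X N f * N x + \<bar>c\<bar> * (dual_norm X N g * N x)"
      using dual_le[OF f x] dual_le[OF g x] by (intro add_mono mult_left_mono) auto
    finally show "\<bar>f x + c * g x\<bar> \<le> (dual_norm X N f + \<bar>c\<bar> * dual_norm X N g) * N x"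
      by (simp add: algebra_simps)
  qed (simp_all add: dual_add[OF f] dual_add[OF g] dual_scale[OF f] dual_scale[OF g] algebra_simps)
  moreover have "(\<lambda>x. if x \<in> X then f x + c * g x else 0) = (\<lambda>x. f x + c * g x)"
    using f g by (auto simp: dual_carrier_def)
  ultimately show ?thesis by simp
qed

definition coord :: "nat \<Rightarrow> (nat \<Rightarrow> real) \<Rightarrow> real" where
  "coord n x = (if x \<in> X then x n else 0)"

lemma coord_dual: "coord n \<in> X_dual"
  unfolding coord_def[abs_def] by (rule dual_I[where C = 1]) (auto simp: coordinate_le_N)

lemma zero_dual: "(\<lambda>x. 0) \<in> X_dual"
  using dual_I[of "\<lambda>x. 0" 0] by simp

lemma coord_sum_dual: 
  assumes "finite S" 
  shows "(\<lambda>x. \<Sum>n\<in>S. c n * coord n x) \<in> X_dual"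
  using assms
proof (induction S rule: finite_induct)
  case (insert n S)
  then show ?case using dual_combine[OF insert.IH coord_dual, of "c n" n] by (simp add: add.commute)
qed (simp add: zero_dual)

lemma restr_lessThan_eq: "restr x {..<b} = (\<lambda>i. \<Sum>n<b. x n * unit_vector n i)"
proof
  fix i
  have "(\<Sum>n<b. x n * unit_vector n i) = (\<Sum>n<b. if n = i then x n else 0)"
    by (intro sum.cong) (auto simp: unit_vector_def)
  then show "restr x {..<b} i = (\<Sum>n<b. x n * unit_vector n i)" by (simp add: restr_def)
qed

lemma dual_truncation:
  assumes "f \<in> X_dual" "x \<in> X"
  shows "f x = (\<Sum>n<b. f (unit_vector n) * coord n x) + f (restr x {b..})"
proof -
  have "f x = f (\<lambda>i. restr x {..<b} i + restr x {b..} i)" by (rule arg_cong[of _ _ f]) (simp add: restr_def fun_eq_iff)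
  also have "\<dots> = f (restr x {..<b}) + f (restr x {b..})"
    using assms restr_mem_X by (intro dual_add) auto
  also have "f (restr x {..<b}) = (\<Sum>n<b. x n * f (unit_vector n))"
    unfolding restr_lessThan_eq using assms unit_vector_mem_X by (intro dual_sum) auto
  finally show ?thesis using assms by (simp add: coord_def mult.commute)
qed

text \<open>If truncation failed to approximate \<open>f\<close>, there would be a coordinatewise null sequence in the unit ball on
  which \<open>f\<close> exceeds \<open>\<epsilon>\<close>.  On sums of \<open>m\<close> terms of its \<open>\<ell>\<^sub>p\<close> subsequence \<open>f\<close> would be at least
  \<open>m * \<epsilon>\<close> while the norm is of order \<open>m powr (1/p)\<close>.\<close>

lemma shrinking:
  assumes f: "f \<in> X_dual" and \<epsilon>: "\<epsilon> > 0"
  shows "\<exists>b0. \<forall>b\<ge>b0. dual_norm X N (\<lambda>x. f x - (\<Sum>n<b. f (unit_vector n) * coord n x)) \<le> \<epsilon>"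
proof (rule ccontr)
  assume "\<not> ?thesis"
  then have big: "\<exists>b\<ge>b0. \<not> dual_norm X N (\<lambda>x. f x - (\<Sum>n<b. f (unit_vector n) * coord n x)) \<le> \<epsilon>" for b0 by blast
  have "\<exists>z. z \<in> X \<and> N z \<le> 1 \<and> f z > \<epsilon> \<and> (\<forall>n<k. z n = 0)" for k
  proof -
    obtain b where b: "b \<ge> k" "\<not> dual_norm X N (\<lambda>x. f x - (\<Sum>n<b. f (unit_vector n) * coord n x)) \<le> \<epsilon>"
      using big by blast
    then obtain x where x: "x \<in> X" "N x \<le> 1" "\<bar>f x - (\<Sum>n<b. f (unit_vector n) * coord n x)\<bar> > \<epsilon>"
      using dual_norm_leI[of "\<lambda>x. f x - (\<Sum>n<b. f (unit_vector n) * coord n x)" \<epsilon>] by (meson not_le)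
    define z where "z = restr x {b..}"
    have z: "z \<in> X" "N z \<le> 1" "\<bar>f z\<bar> > \<epsilon>" "\<forall>n<k. z n = 0"
      using x restr_mem_X[OF x(1), of "{b..}"] N_restr_le[OF x(1), of "{b..}"] b(1) dual_truncation[OF f x(1), of b]
      by (auto simp: z_def restr_def)
    show ?thesis
    proof (cases "f z > 0")
      case False
      then show ?thesis using z dual_scale[OF f z(1), of "-1"] scale_mem_X[OF z(1), of "-1"] N_minus[OF z(1)]
        by (intro exI[of _ "\<lambda>n. - z n"]) auto
    qed (use z in auto)
  qed
  then obtain z where z: "\<And>k. z k \<in> X" "\<And>k. N (z k) \<le> 1" "\<And>k. f (z k) > \<epsilon>" "\<And>k n. n < k \<Longrightarrow> z k n = 0"
    by metis
  have null: "(\<lambda>k. z k n) \<longlonglongrightarrow> 0" for n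
    by (rule tendsto_eventually, rule eventually_mono[OF eventually_gt_at_top[of n]]) (rule z(4))
  obtain \<rho> :: "nat \<Rightarrow> nat" where 
    up: "\<And>K a. finite K \<Longrightarrow> N (\<lambda>n. \<Sum>k\<in>K. a k * z (\<rho> k) n) \<le> 5/2 * pnorm p K a"
    using lp_subsequence[OF z(1,2) null] by metis
  define C where "C = dual_norm X N f"
  have C: "0 \<le> C" using dual_norm_nonneg[OF f] by (simp add: C_def)
  have bound: "\<epsilon> \<le> C * (5/2) * (real m powr (1 / p) / real m)" if "m > 0" for m
  proof -
    define v where "v n = (\<Sum>k<m. 1 * z (\<rho> k) n)" for n
    have v: "v \<in> X" unfolding v_def[abs_def] using sum_mem_X[of "{..<m}" "\<lambda>k. z (\<rho> k)" "\<lambda>_. 1"] z(1) by simp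
    have "real m * \<epsilon> \<le> (\<Sum>k<m. 1 * f (z (\<rho> k)))"
      using sum_mono[of "{..<m}" "\<lambda>_. \<epsilon>" "\<lambda>k. f (z (\<rho> k))"] z(3) by (simp add: less_imp_le)
    also have "\<dots> = f v" unfolding v_def[abs_def] using z(1) by (intro dual_sum[symmetric] f) auto
    also have "\<dots> \<le> C * N v" using dual_le[OF f v] by (simp add: C_def)
    finally have 1: "real m * \<epsilon> \<le> C * N v" .
    have "N v \<le> 5/2 * real m powr (1 / p)"
      unfolding v_def[abs_def] using up[of "{..<m}" "\<lambda>_. 1"] by (simp add: pnorm_card)
    then have "C * N v \<le> C * (5/2 * real m powr (1 / p))" using C by (rule mult_left_mono)
    with 1 have "real m * \<epsilon> \<le> C * (5/2 * real m powr (1 / p))" by linarith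
    then show ?thesis using that by (simp add: field_simps)
  qed
  have "(\<lambda>m. C * (5/2) * (real m powr (1 / p) / real m)) \<longlonglongrightarrow> C * (5/2) * 0"
    by (intro tendsto_mult powr_inverse_average_tendsto_zero p_gt_1 tendsto_const)
  then have "\<epsilon> \<le> C * (5/2) * 0"
    by (rule tendsto_lowerbound[OF _ eventually_mono[OF eventually_gt_at_top[of 0] bound]]) simp_all
  then show False using \<epsilon> by simp
qed

text \<open>Composes the supporting functionals of the three layers.\<close>

lemma val_supporting:
  assumes F: "packing_chain F"
  obtains S c where "finite S" "\<And>n. 0 \<le> c n" "(\<Sum>n\<in>S. c n * \<bar>x n\<bar>) = val F x"
    "\<And>y. (\<Sum>n\<in>S. c n * \<bar>y n\<bar>) \<le> val F y"
proof -
  have finF: "finite F" using F by (rule packing_chain_finite)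
  have finD: "finite D" if "D \<in> F" for D using packing_finite packing_chain_packing[OF F that] .
  have find: "finite d" if "D \<in> F" "d \<in> D" for D d 
    using packing_finite_member packing_chain_packing[OF F that(1)] that(2) by blast
  obtain c1 where c1: "\<And>D. 0 \<le> c1 D" "(\<Sum>D\<in>F. c1 D * \<bar>pnorm t D (\<lambda>d. pnorm r d x)\<bar>) = val F x"
    "\<And>v. (\<Sum>D\<in>F. c1 D * \<bar>v D\<bar>) \<le> pnorm p F v"
    using pnorm_supporting[of p F "\<lambda>D. pnorm t D (\<lambda>d. pnorm r d x)"] finF unfolding val_def by auto
  have "\<forall>D. \<exists>c. D \<in> F \<longrightarrow> (\<forall>d. 0 \<le> c d) \<and> (\<Sum>d\<in>D. c d * \<bar>pnorm r d x\<bar>) = pnorm t D (\<lambda>d. pnorm r d x) \<and>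
     (\<forall>v. (\<Sum>d\<in>D. c d * \<bar>v d\<bar>) \<le> pnorm t D v)"
    using pnorm_supporting[of t _ "\<lambda>d. pnorm r d x"] finD by auto
  then obtain c2 where c2: "\<And>D d. D \<in> F \<Longrightarrow> 0 \<le> c2 D d" 
    "\<And>D. D \<in> F \<Longrightarrow> (\<Sum>d\<in>D. c2 D d * \<bar>pnorm r d x\<bar>) = pnorm t D (\<lambda>d. pnorm r d x)"
    "\<And>D v. D \<in> F \<Longrightarrow> (\<Sum>d\<in>D. c2 D d * \<bar>v d\<bar>) \<le> pnorm t D v" by (drule_tac choice) blast
  have "\<forall>d. \<exists>c. finite d \<longrightarrow> (\<forall>n. 0 \<le> c n) \<and> (\<Sum>n\<in>d. c n * \<bar>x n\<bar>) = pnorm r d x \<and>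
     (\<forall>v. (\<Sum>n\<in>d. c n * \<bar>v n\<bar>) \<le> pnorm r d v)"
    using pnorm_supporting[of r _ x] r_ge_1 by auto
  then obtain c3 where c3: "\<And>d n. finite d \<Longrightarrow> 0 \<le> c3 d n" 
    "\<And>d. finite d \<Longrightarrow> (\<Sum>n\<in>d. c3 d n * \<bar>x n\<bar>) = pnorm r d x"
    "\<And>d v. finite d \<Longrightarrow> (\<Sum>n\<in>d. c3 d n * \<bar>v n\<bar>) \<le> pnorm r d v" by (drule_tac choice) blast
  define S where "S = \<Union>(\<Union>F)"
  have finS: "finite S" unfolding S_def by (rule packing_chain_finite_Union[OF F])
  define c where "c n = (\<Sum>D\<in>F. \<Sum>d\<in>D. if n \<in> d then c1 D * c2 D d * c3 d n else 0)" for n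
  have flat: "(\<Sum>n\<in>S. c n * \<bar>y n\<bar>) = (\<Sum>D\<in>F. c1 D * (\<Sum>d\<in>D. c2 D d * (\<Sum>n\<in>d. c3 d n * \<bar>y n\<bar>)))" for y
  proof -
    have "(\<Sum>n\<in>S. c n * \<bar>y n\<bar>) = (\<Sum>n\<in>S. \<Sum>D\<in>F. \<Sum>d\<in>D. (if n \<in> d then c1 D * c2 D d * c3 d n * \<bar>y n\<bar> else 0))"
      unfolding c_def sum_distrib_right by (intro sum.cong) auto
    also have "\<dots> = (\<Sum>D\<in>F. \<Sum>d\<in>D. \<Sum>n\<in>S. (if n \<in> d then c1 D * c2 D d * c3 d n * \<bar>y n\<bar> else 0))"
      by (subst sum.swap, intro sum.cong refl, rule sum.swap)
    also have "\<dots> = (\<Sum>D\<in>F. \<Sum>d\<in>D. \<Sum>n\<in>d. c1 D * c2 D d * c3 d n * \<bar>y n\<bar>)"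
    proof (rule sum.cong[OF refl], rule sum.cong[OF refl])
      fix D d assume "D \<in> F" "d \<in> D"
      then have "d \<subseteq> S" unfolding S_def by blast
      then have "S \<inter> {n. n \<in> d} = d" by blast
      then show "(\<Sum>n\<in>S. (if n \<in> d then c1 D * c2 D d * c3 d n * \<bar>y n\<bar> else 0)) = (\<Sum>n\<in>d. c1 D * c2 D d * c3 d n * \<bar>y n\<bar>)"
        using finS by (simp add: sum.If_cases)
    qed
    finally show ?thesis by (simp add: sum_distrib_left mult.assoc)
  qed
  show ?thesis
  proof (rule that[of S c])
    show "0 \<le> c n" for n unfolding c_def using c1(1) c2(1) c3(1) find by (intro sum_nonneg) auto
    show "(\<Sum>n\<in>S. c n * \<bar>x n\<bar>) = val F x"
    proof -
      have "(\<Sum>n\<in>S. c n * \<bar>x n\<bar>) = (\<Sum>D\<in>F. c1 D * (\<Sum>d\<in>D. c2 D d * pnorm r d x))"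
        unfolding flat using c3(2) find by (intro sum.cong refl arg_cong2[of _ _ _ _ "(*)"]) auto
      also have "\<dots> = (\<Sum>D\<in>F. c1 D * pnorm t D (\<lambda>d. pnorm r d x))"
        using c2(2) by (intro sum.cong refl arg_cong2[of _ _ _ _ "(*)"]) auto
      finally show ?thesis using c1(2) by simp
    qed
    show "(\<Sum>n\<in>S. c n * \<bar>y n\<bar>) \<le> val F y" for y
    proof -
      have "(\<Sum>n\<in>S. c n * \<bar>y n\<bar>) \<le> (\<Sum>D\<in>F. c1 D * (\<Sum>d\<in>D. c2 D d * \<bar>pnorm r d y\<bar>))"
        unfolding flat using c3(3) find c1(1) c2(1) by (intro sum_mono mult_left_mono) auto
      also have "\<dots> \<le> (\<Sum>D\<in>F. c1 D * \<bar>pnorm t D (\<lambda>d. pnorm r d y)\<bar>)"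
        using c2(3) c1(1) by (intro sum_mono mult_left_mono) (rule c2(3)[where v = "\<lambda>d. pnorm r d y", THEN order_trans], auto)
      also have "\<dots> \<le> val F y" unfolding val_def by (rule c1(3))
      finally show ?thesis .
    qed
  qed (rule finS)
qed

text \<open>The coordinates of the representing vector are the values of \<open>\<Phi>\<close> at the coordinate functionals.  The
  supporting functionals show that this vector has finite norm, and shrinking determines \<open>\<Phi>\<close> by its
  values on coordinate functionals.\<close>

theorem reflexive_X: "reflexive_space X N"
  unfolding reflexive_space_def
proof
  fix \<Phi> assume \<Phi>: "\<Phi> \<in> dual_carrier X_dual (dual_norm X N)"
  then have add: "\<And>f g. f \<in> X_dual \<Longrightarrow> g \<in> X_dual \<Longrightarrow> \<Phi> (\<lambda>x. f x + g x) = \<Phi> f + \<Phi> g"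
    and scale: "\<And>c f. f \<in> X_dual \<Longrightarrow> \<Phi> (\<lambda>x. c * f x) = c * \<Phi> f"
    by (auto simp: dual_carrier_def[of X_dual] plus_fun_def scaleR_fun_def)
  obtain C0 where C0: "\<And>f. f \<in> X_dual \<Longrightarrow> \<bar>\<Phi> f\<bar> \<le> C0 * dual_norm X N f"
    using \<Phi> unfolding dual_carrier_def[of X_dual] by blast
  define C where "C = \<bar>C0\<bar>"
  have C: "0 \<le> C" by (simp add: C_def)
  have bound: "\<bar>\<Phi> f\<bar> \<le> C * dual_norm X N f" if "f \<in> X_dual" for f
    using C0[OF that] mult_right_mono[OF abs_ge_self[of C0] dual_norm_nonneg[OF that]] by (simp add: C_def)
  have combine: "\<Phi> (\<lambda>x. f x + c * g x) = \<Phi> f + c * \<Phi> g" if f: "f \<in> X_dual" and g: "g \<in> X_dual" for f g c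
  proof -
    have "(\<lambda>x. c * g x) \<in> X_dual" using dual_combine[OF zero_dual g, of c] by simp
    then show ?thesis using add[OF f, of "\<lambda>x. c * g x"] scale[OF g] by simp
  qed
  have zero: "\<Phi> (\<lambda>x. 0) = 0" using scale[OF zero_dual, of 0] by simp
  define x where "x n = \<Phi> (coord n)" for n
  have sum: "\<Phi> (\<lambda>y. \<Sum>n\<in>S. c n * coord n y) = (\<Sum>n\<in>S. c n * x n)" if "finite S" for S c
    using that
  proof (induction S rule: finite_induct)
    case (insert n S)
    then show ?case
      using combine[OF coord_sum_dual[OF insert.hyps(1)] coord_dual, of c "c n" n] by (simp add: x_def add.commute)
  qed (simp add: zero)
  have x: "x \<in> X"
  proof (rule X_I)
    fix F assume F: "packing_chain F"
    obtain S c where S: "finite S" and c: "\<And>n. 0 \<le> c n" "(\<Sum>n\<in>S. c n * \<bar>x n\<bar>) = val F x"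
      "\<And>y. (\<Sum>n\<in>S. c n * \<bar>y n\<bar>) \<le> val F y" using val_supporting[OF F] by blast
    define g where "g y = (\<Sum>n\<in>S. (c n * sgn (x n)) * coord n y)" for y
    have g: "g \<in> X_dual" unfolding g_def[abs_def] by (rule coord_sum_dual[OF S])
    have "dual_norm X N g \<le> 1"
    proof (rule dual_norm_leI)
      fix y assume y: "y \<in> X" "N y \<le> 1"
      have "\<bar>g y\<bar> \<le> (\<Sum>n\<in>S. \<bar>(c n * sgn (x n)) * coord n y\<bar>)" unfolding g_def by (rule sum_abs)
      also have "\<dots> \<le> (\<Sum>n\<in>S. c n * \<bar>y n\<bar>)"
        using c(1) y by (intro sum_mono) (auto simp: abs_mult coord_def abs_sgn_eq)
      also have "\<dots> \<le> 1" using c(3)[of y] val_le_N[OF y(1) F] y(2) by linarith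
      finally show "\<bar>g y\<bar> \<le> 1" .
    qed
    then have "\<bar>\<Phi> g\<bar> \<le> C" using bound[OF g] C by (meson mult_left_le order_trans)
    moreover have "\<Phi> g = (\<Sum>n\<in>S. c n * \<bar>x n\<bar>)"
      unfolding g_def[abs_def] sum[OF S] by (intro sum.cong) (auto simp: sgn_mult_abs abs_sgn mult.assoc mult.commute[of "sgn _"])
    ultimately show "val F x \<le> C" using c(2) by simp
  qed
  have "\<Phi> f = f x" if f: "f \<in> X_dual" for f
  proof (rule LIMSEQ_unique)
    define T where "T b y = (\<Sum>n<b. f (unit_vector n) * coord n y)" for b y
    have T: "T b \<in> X_dual" for b unfolding T_def[abs_def] by (rule coord_sum_dual) simp
    have \<Phi>T: "\<Phi> (T b) = T b x" for b 
      unfolding T_def[abs_def] using x by (subst sum) (auto simp: coord_def)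
    show "(\<lambda>b. \<Phi> (T b)) \<longlonglongrightarrow> \<Phi> f"
    proof (rule LIMSEQ_I)
      fix e :: real assume e: "e > 0"
      define \<epsilon> where "\<epsilon> = e / (C + 1)"
      have "\<epsilon> > 0" using e C by (simp add: \<epsilon>_def)
      then obtain b0 where b0: "\<And>b. b \<ge> b0 \<Longrightarrow> dual_norm X N (\<lambda>y. f y - T b y) \<le> \<epsilon>"
        using shrinking[OF f] unfolding T_def by blast
      have "norm (\<Phi> (T b) - \<Phi> f) < e" if "b \<ge> b0" for b
      proof -
        have "(\<lambda>y. f y - T b y) \<in> X_dual" using dual_combine[OF f T, of "-1"] by simp
        then have "\<bar>\<Phi> (\<lambda>y. f y - T b y)\<bar> \<le> C * \<epsilon>" 
          using bound b0[OF that] C by (meson mult_left_mono order_trans)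
        moreover have "\<Phi> (\<lambda>y. f y - T b y) = \<Phi> f - \<Phi> (T b)" using combine[OF f T, of "-1"] by simp
        moreover have "C * \<epsilon> < e" using e C by (simp add: \<epsilon>_def field_simps)
        ultimately show ?thesis by simp
      qed
      then show "\<exists>b0. \<forall>b\<ge>b0. norm (\<Phi> (T b) - \<Phi> f) < e" by blast
    qed
    show "(\<lambda>b. \<Phi> (T b)) \<longlonglongrightarrow> f x"
    proof (rule LIMSEQ_I)
      fix e :: real assume e: "e > 0"
      define \<epsilon> where "\<epsilon> = e / (dual_norm X N f + 1)"
      have "\<epsilon> > 0" using e dual_norm_nonneg[OF f] by (simp add: \<epsilon>_def)
      then obtain b0 where b0: "\<And>b. b \<ge> b0 \<Longrightarrow> N (restr x {b..}) < \<epsilon>" using tail_tendsto_zero[OF x] by blast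
      have "norm (\<Phi> (T b) - f x) < e" if "b \<ge> b0" for b
      proof -
        have "\<bar>f (restr x {b..})\<bar> \<le> dual_norm X N f * N (restr x {b..})" 
          by (rule dual_le[OF f restr_mem_X[OF x]])
        also have "\<dots> \<le> dual_norm X N f * \<epsilon>" 
          using b0[OF that] dual_norm_nonneg[OF f] by (intro mult_left_mono) auto
        also have "\<dots> < e" using e dual_norm_nonneg[OF f] by (simp add: \<epsilon>_def field_simps)
        finally have "\<bar>f (restr x {b..})\<bar> < e" .
        then show ?thesis using dual_truncation[OF f x, of b] unfolding \<Phi>T T_def by simp
      qed
      then show "\<exists>b0. \<forall>b\<ge>b0. norm (\<Phi> (T b) - f x) < e" by blast
    qed
  qed
  then show "\<exists>x\<in>X. \<forall>f\<in>X_dual. \<Phi> f = f x" using x by blast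
qed

end

section \<open>Iterated limits and asymmetry\<close>

text \<open>The positions of the listed coordinates increase along the list and exceed those of all other coordinates
  in \<open>I\<close>.  This is the situation reached in the iterated limit along the list.\<close>

definition spread :: "nat set \<Rightarrow> (nat \<Rightarrow> nat \<Rightarrow> nat) \<Rightarrow> nat list \<Rightarrow> (nat \<Rightarrow> nat) \<Rightarrow> bool" where
  "spread I pos js n \<longleftrightarrow> sorted_wrt (\<lambda>i j. pos i (n i) < pos j (n j)) js \<and>
     (\<forall>j\<in>I - set js. \<forall>i\<in>set js. pos j (n j) < pos i (n i))"

lemma spread_Cons:
  assumes "spread I pos js n" "i \<in> I" "i \<notin> set js"
    and "\<And>j. j \<in> I - set (i # js) \<Longrightarrow> pos j (n j) < pos i (n i)"
  shows "spread I pos (i # js) n"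
proof -
  have i: "pos i (n i) < pos a (n a)" if "a \<in> set js" for a
    using assms(1-3) that by (simp add: spread_def)
  then show ?thesis
    unfolding spread_def using assms(1,4) by (auto simp: spread_def intro: less_trans)
qed

lemma spread_extend:
  assumes "finite I" "\<And>i k. k \<le> pos i k" "distinct js" "set js \<subseteq> I"
  shows "\<exists>n'. (\<forall>j. j \<notin> set js \<longrightarrow> n' j = n j) \<and> spread I pos js n'"
  using assms(3,4)
proof (induction js arbitrary: n)
  case (Cons i js)
  define k where "k = Suc (\<Sum>j\<in>I. pos j (n j))"
  obtain n' where n': "\<And>j. j \<notin> set js \<Longrightarrow> n' j = (n(i := k)) j" "spread I pos js n'"
    using Cons.IH[of "n(i := k)"] Cons.prems by auto
  have big: "pos j (n j) < pos i k" if "j \<in> I" for j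
  proof -
    have "pos j (n j) \<le> (\<Sum>j\<in>I. pos j (n j))" using assms(1) that by (intro member_le_sum) auto
    then show ?thesis using assms(2)[of k i] by (simp add: k_def)
  qed
  have i: "n' i = k" "i \<in> I - set js" using n'(1)[of i] Cons.prems by auto
  have "spread I pos (i # js) n'"
    using n' i big by (intro spread_Cons) auto
  then show ?case using n'(1) by (intro exI[of _ n']) auto
qed (auto simp: spread_def)

text \<open>Hence a quantity depending only on the order of the positions is constant on spread configurations.\<close>

lemma spread_same_order:
  assumes "spread I pos js n" "spread I pos js n'" "distinct js" "set js \<subseteq> I"
    and "\<And>j. j \<notin> set js \<Longrightarrow> n j = n' j" and "i \<in> I" "j \<in> I"
  shows "pos i (n i) < pos j (n j) \<longleftrightarrow> pos i (n' i) < pos j (n' j)"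
proof -
  have *: "pos i (n i) < pos j (n j) \<longleftrightarrow> (\<exists>a b. a < b \<and> b < length js \<and> js ! a = i \<and> js ! b = j)"
    if n: "spread I pos js n" and ij: "i \<in> set js" "j \<in> set js" for n
  proof -
    obtain a b where ab: "a < length js" "b < length js" "i = js ! a" "j = js ! b"
      using ij by (metis in_set_conv_nth)
    have lt: "\<And>a b. a < b \<Longrightarrow> b < length js \<Longrightarrow> pos (js ! a) (n (js ! a)) < pos (js ! b) (n (js ! b))"
      using n unfolding spread_def sorted_wrt_iff_nth_less by blast
    show ?thesis
    proof
      assume "pos i (n i) < pos j (n j)"
      then have "a < b" using lt[of b a] ab by (metis less_asym less_irrefl linorder_neqE_nat)
      then show "\<exists>a b. a < b \<and> b < length js \<and> js ! a = i \<and> js ! b = j" using ab by blast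
    qed (use lt in blast)
  qed
  show ?thesis
  proof (cases "i \<in> set js"; cases "j \<in> set js")
    assume "i \<in> set js" "j \<in> set js"
    then show ?thesis using trans[OF *[OF assms(1)] *[OF assms(2), symmetric]] by blast
  next
    assume ij: "i \<in> set js" "j \<notin> set js"
    then have "pos j (n j) < pos i (n i)" "pos j (n' j) < pos i (n' i)"
      using assms(1,2,7) by (auto simp: spread_def)
    then show ?thesis by simp
  next
    assume ij: "i \<notin> set js" "j \<in> set js"
    then have "pos i (n i) < pos j (n j)" "pos i (n' i) < pos j (n' j)"
      using assms(1,2,6) by (auto simp: spread_def)
    then show ?thesis by simp
  next
    assume "i \<notin> set js" "j \<notin> set js"
    then show ?thesis using assms(5) by simp
  qed
qed

text \<open>Each single limit is the limit of an eventually constant sequence, so the iterated limit exists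
  and is the value at any spread configuration.\<close>

lemma iterated_limit_of_order_invariant:
  assumes I: "finite I" and pos: "\<And>i k. k \<le> pos i k"
    and inv: "\<And>n n'. (\<And>i j. i \<in> I \<Longrightarrow> j \<in> I \<Longrightarrow> pos i (n i) < pos j (n j) \<longleftrightarrow> pos i (n' i) < pos j (n' j)) \<Longrightarrow> F n = F n'"
    and "distinct js" "set js \<subseteq> I"
  shows "\<exists>L. has_iterated_limit F js n L \<and>
    (\<forall>n'. (\<forall>j. j \<notin> set js \<longrightarrow> n' j = n j) \<and> spread I pos js n' \<longrightarrow> F n' = L)"
  using assms(4,5)
proof (induction js arbitrary: n)
  case Nil
  show ?case
  proof (intro exI[of _ "F n"] conjI allI impI)
    fix n' assume "(\<forall>j. j \<notin> set [] \<longrightarrow> n' j = n j) \<and> spread I pos [] n'"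
    then have "n' = n" by (simp add: fun_eq_iff)
    then show "F n' = F n" by (rule arg_cong)
  qed simp
next
  case (Cons i js)
  have js: "distinct js" "set js \<subseteq> I" "i \<notin> set js" "i \<in> I" using Cons.prems by auto
  have "\<forall>k. \<exists>L. has_iterated_limit F js (n(i := k)) L \<and>
    (\<forall>n'. (\<forall>j. j \<notin> set js \<longrightarrow> n' j = (n(i := k)) j) \<and> spread I pos js n' \<longrightarrow> F n' = L)"
    using Cons.IH[OF js(1,2)] by blast
  from choice[OF this] obtain g where g: "\<And>k. has_iterated_limit F js (n(i := k)) (g k)"
    "\<And>k n'. (\<forall>j. j \<notin> set js \<longrightarrow> n' j = (n(i := k)) j) \<Longrightarrow> spread I pos js n' \<Longrightarrow> F n' = g k" by blast
  define k0 where "k0 = Suc (\<Sum>j\<in>I. pos j (n j))"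
  have "\<forall>k. \<exists>n'. (\<forall>j. j \<notin> set js \<longrightarrow> n' j = (n(i := k)) j) \<and> spread I pos js n'"
    by (intro allI spread_extend I pos js)
  from choice[OF this] obtain e where e: "\<And>k j. j \<notin> set js \<Longrightarrow> e k j = (n(i := k)) j"
    "\<And>k. spread I pos js (e k)" by blast
  have spread_e: "spread I pos (i # js) (e k)" if k: "k \<ge> k0" for k
  proof -
    have i: "e k i = k" "i \<in> I - set js" using e(1)[of i k] js by auto
    have big: "pos j (n j) < pos i k" if "j \<in> I" for j
    proof -
      have "pos j (n j) \<le> (\<Sum>j\<in>I. pos j (n j))" using I that by (intro member_le_sum) auto
      then show ?thesis using pos[of k i] k by (simp add: k0_def)
    qed
    show ?thesis
      using e i big by (intro spread_Cons) auto
  qed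
  have Fe: "F (e k) = g k" for k using g(2)[of "e k" k] e by blast
  have same: "F n' = F (e k0)" if n': "\<And>j. j \<notin> set (i # js) \<Longrightarrow> n' j = n j" "spread I pos (i # js) n'" for n'
  proof (rule inv)
    fix a b assume "a \<in> I" "b \<in> I"
    then show "pos a (n' a) < pos b (n' b) \<longleftrightarrow> pos a (e k0 a) < pos b (e k0 b)"
      using n' e(1) by (intro spread_same_order[OF n'(2) spread_e[OF order_refl] Cons.prems]) auto
  qed
  have "g k = g k0" if "k \<ge> k0" for k
  proof -
    have "e k j = n j" if "j \<notin> set (i # js)" for j using e(1)[of j k] that by simp
    then have "F (e k) = F (e k0)" by (rule same[OF _ spread_e[OF that]])
    then show ?thesis unfolding Fe .
  qed
  then have "g \<longlonglongrightarrow> g k0" 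
    by (intro tendsto_eventually eventually_mono[OF eventually_ge_at_top[of k0]])
  then have lim: "has_iterated_limit F (i # js) n (g k0)" using g(1) by auto
  show ?case
  proof (intro exI[of _ "g k0"] conjI allI impI lim)
    fix n' assume n': "(\<forall>j. j \<notin> set (i # js) \<longrightarrow> n' j = n j) \<and> spread I pos (i # js) n'"
    have "F n' = F (e k0)" by (rule same) (use n' in auto)
    then show "F n' = g k0" unfolding Fe .
  qed
qed

context exponents
begin

lemma N_indicator_transport:
  assumes "finite S" "finite S'" "strict_mono_on S \<phi>" "\<phi> ` S \<subseteq> S'" "\<And>n. n \<in> S \<Longrightarrow> label (\<phi> n) = label n"
  shows "N (\<lambda>n. if n \<in> S then 1 else 0) \<le> N (\<lambda>n. if n \<in> S' then 1 else 0)"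
proof (rule N_leI)
  fix F assume F: "packing_chain F"
  have X': "(\<lambda>n. if n \<in> S' then 1 else 0) \<in> X" by (rule finite_support(1)[OF assms(2)]) simp
  obtain F' where "packing_chain F'" "val F' (\<lambda>n. if n \<in> S' then 1 else 0) = val F (\<lambda>n. if n \<in> S then 1 else 0)"
    by (rule transport_chain[OF F assms(3,5), of "\<lambda>n. if n \<in> S' then 1 else 0" "\<lambda>n. if n \<in> S then 1 else 0"])
      (use assms(4) in \<open>auto simp: image_subset_iff\<close>)
  then show "val F (\<lambda>n. if n \<in> S then 1 else 0) \<le> N (\<lambda>n. if n \<in> S' then 1 else 0)"
    using val_le_N[OF X'] by metis
qed

lemma N_indicator_descending:
  assumes "descending S"
  shows "real (card S) powr (1 / r) \<le> N (\<lambda>n. if n \<in> S then 1 else 0)"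
proof -
  have "(\<lambda>n. if n \<in> S then 1 else 0) \<in> X" by (rule finite_support(1)[OF descending_finite[OF assms]]) simp
  moreover have "pnorm r S (\<lambda>n. if n \<in> S then 1 else 0) = pnorm r S (\<lambda>_. 1)" by (intro pnorm_cong) auto
  ultimately show ?thesis using descending_le_N[OF _ assms] pnorm_card[of r S] by fastforce
qed

text \<open>A descending set meets \<open>S\<close> at most once, so the \<open>\<ell>\<^sub>p\<close> norm takes over at the lowest layer as well.\<close>

lemma N_indicator_ascending:
  assumes S: "finite S" and asc: "\<And>m n. m \<in> S \<Longrightarrow> n \<in> S \<Longrightarrow> m < n \<Longrightarrow> label m \<le> label n"
  shows "N (\<lambda>n. if n \<in> S then 1 else 0) \<le> real (card S) powr (1 / p)"
proof (rule N_leI)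
  fix F assume F: "packing_chain F"
  define x :: "nat \<Rightarrow> real" where "x n = (if n \<in> S then 1 else 0)" for n
  have "val F x \<le> pnorm p (\<Union>(\<Union>F)) x"
  proof (rule val_le_flat[OF F])
    fix D d assume D: "D \<in> F" "d \<in> D"
    have d: "descending d" using packing_chain_packing[OF F D(1)] D(2) by (rule packing_descending)
    have eq: "pnorm s d x = pnorm s (d \<inter> S) x" for s
      using descending_finite[OF d] by (intro pnorm_neutral[symmetric]) (auto simp: x_def)
    have "a = b" if "a \<in> d \<inter> S" "b \<in> d \<inter> S" for a b
    proof (rule ccontr)
      assume "a \<noteq> b"
      then have "a < b \<or> b < a" by auto
      then show False using that d asc unfolding descending_def by (meson IntE leD)
    qed
    then consider "d \<inter> S = {}" | a where "d \<inter> S = {a}" by blast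
    then show "pnorm r d x \<le> pnorm p d x" by cases (simp_all add: eq)
  qed auto
  also have "\<dots> = pnorm p (\<Union>(\<Union>F) \<inter> S) x"
    using packing_chain_finite_Union[OF F] by (intro pnorm_neutral[symmetric]) (auto simp: x_def)
  also have "\<dots> \<le> pnorm p S x" using S by (intro pnorm_subset) auto
  also have "\<dots> = pnorm p S (\<lambda>_. 1)" by (intro pnorm_cong) (auto simp: x_def)
  also have "\<dots> = real (card S) powr (1 / p)" by (simp add: pnorm_card)
  finally show "val F (\<lambda>n. if n \<in> S then 1 else 0) \<le> real (card S) powr (1 / p)" by (simp add: x_def[abs_def])
qed

text \<open>The \<open>i\<close>-th sequence runs through the unit vectors with label \<open>m - i\<close>.  In the order \<open>1, \<dots>, m\<close> the labels
  decrease along the index line, in the reversed order they increase.\<close>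

theorem not_asymptotically_symmetric: "\<not> asymptotically_symmetric X N"
proof
  assume "asymptotically_symmetric X N"
  then obtain C :: real where C: "\<And>(m::nat) (x :: nat \<Rightarrow> nat \<Rightarrow> nat \<Rightarrow> real) \<sigma> L L'.
        (\<forall>i\<in>{1..m}. (\<forall>n. x i n \<in> X) \<and> (\<exists>M. \<forall>n. N (x i n) \<le> M)) \<Longrightarrow>
        \<sigma> permutes {1..m} \<Longrightarrow>
        has_iterated_limit (\<lambda>n. N (\<Sum>i=1..m. x i (n i))) [1..<Suc m] (\<lambda>_. 0) L \<Longrightarrow>
        has_iterated_limit (\<lambda>n. N (\<Sum>i=1..m. x i (n i))) (map \<sigma> [1..<Suc m]) (\<lambda>_. 0) L'
        \<Longrightarrow> L \<le> C * L'"
    unfolding asymptotically_symmetric_def by blast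
  obtain m :: nat where m: "(\<bar>C\<bar> + 1) powr t < real m" using reals_Archimedean2 by blast
  define I where "I = {1..m}"
  define pos where "pos i k = prod_encode (m - i, k)" for i k
  define x where "x i k = unit_vector (pos i k)" for i k
  define F where "F n = N (\<Sum>i=1..m. x i (n i))" for n
  define S where "S n = (\<lambda>i. pos i (n i)) ` I" for n
  have label_pos: "label (pos i k) = m - i" for i k by (simp add: pos_def)
  have pos_ge: "k \<le> pos i k" for i k unfolding pos_def by (rule le_prod_encode_2)
  have inj: "inj_on (\<lambda>i. pos i (n i)) I" for n
  proof (rule inj_onI)
    fix i j assume "i \<in> I" "j \<in> I" "pos i (n i) = pos j (n j)"
    then show "i = j" using label_pos[of i "n i"] label_pos[of j "n j"] by (auto simp: I_def)
  qed
  have F_eq: "F n = N (\<lambda>q. if q \<in> S n then 1 else 0)" for n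
    unfolding F_def x_def S_def using sum_unit_vector[OF _ inj[of n]] by (simp add: I_def)
  have finS: "finite (S n)" and cardS: "card (S n) = m" for n
    using inj[of n] by (simp_all add: S_def I_def card_image)
  have le: "F n \<le> F n'" 
    if n: "\<And>i j. i \<in> I \<Longrightarrow> j \<in> I \<Longrightarrow> pos i (n i) < pos j (n j) \<longleftrightarrow> pos i (n' i) < pos j (n' j)" for n n'
  proof -
    \<comment> \<open>A label determines the sequence from which the unit vector is taken, hence its new position.\<close>
    define \<phi> where "\<phi> q = (let i = m - label q in pos i (n' i))" for q
    have \<phi>: "\<phi> (pos i (n i)) = pos i (n' i)" if "i \<in> I" for i
      using that by (simp add: \<phi>_def label_pos I_def)
    have "strict_mono_on (S n) \<phi>" unfolding strict_mono_on_def S_def using n \<phi> by auto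
    moreover have "\<phi> ` S n \<subseteq> S n'" using \<phi> by (auto simp: S_def)
    moreover have "label (\<phi> q) = label q" if "q \<in> S n" for q using that \<phi> by (auto simp: S_def label_pos)
    ultimately show ?thesis unfolding F_eq by (intro N_indicator_transport[where \<phi> = \<phi>] finS) auto
  qed
  have inv: "F n = F n'" 
    if "\<And>i j. i \<in> I \<Longrightarrow> j \<in> I \<Longrightarrow> pos i (n i) < pos j (n j) \<longleftrightarrow> pos i (n' i) < pos j (n' j)" for n n'
    using le[of n n'] le[of n' n] that by (intro order_antisym) auto
  define \<sigma> where "\<sigma> i = (if i \<in> I then Suc m - i else i)" for i
  have \<sigma>: "\<sigma> permutes I"
  proof (rule bij_imp_permutes)
    show "bij_betw \<sigma> I I" by (rule bij_betw_byWitness[where f' = \<sigma>]) (auto simp: \<sigma>_def I_def)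
  qed (simp add: \<sigma>_def)
  have set1: "set [1..<Suc m] = I" by (auto simp: I_def)
  have set2: "set (map \<sigma> [1..<Suc m]) = I" using permutes_image[OF \<sigma>] set1 by simp
  have dist2: "distinct (map \<sigma> [1..<Suc m])" using permutes_inj_on[OF \<sigma>] by (simp add: distinct_map)
  have finI: "finite I" by (simp add: I_def)
  have limit: "\<exists>L n'. has_iterated_limit F js (\<lambda>_. 0) L \<and> spread I pos js n' \<and> F n' = L"
    if js: "distinct js" "set js = I" for js
  proof -
    have "\<exists>L. has_iterated_limit F js (\<lambda>_. 0) L \<and>
        (\<forall>n'. (\<forall>j. j \<notin> set js \<longrightarrow> n' j = 0) \<and> spread I pos js n' \<longrightarrow> F n' = L)"
    proof (rule iterated_limit_of_order_invariant[OF finI pos_ge])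
      show "F n = F n'" if "\<And>i j. i \<in> I \<Longrightarrow> j \<in> I \<Longrightarrow> pos i (n i) < pos j (n j) \<longleftrightarrow> pos i (n' i) < pos j (n' j)"
        for n n' by (rule inv[OF that])
    qed (use js in auto)
    moreover have "\<exists>n'. (\<forall>j. j \<notin> set js \<longrightarrow> n' j = 0) \<and> spread I pos js n'"
      using js by (intro spread_extend finI pos_ge) auto
    ultimately show ?thesis by metis
  qed
  have nth: "[1..<Suc m] ! (i - 1) = i" "i - 1 < length [1..<Suc m]" if "i \<in> I" for i
    using that by (auto simp: I_def nth_upt simp del: upt_Suc)
  obtain L n1 where L: "has_iterated_limit F [1..<Suc m] (\<lambda>_. 0) L" and n1: "spread I pos [1..<Suc m] n1" "F n1 = L"
    using limit[OF distinct_upt set1] by blast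
  obtain L' n2 where L': "has_iterated_limit F (map \<sigma> [1..<Suc m]) (\<lambda>_. 0) L'"
    and n2: "spread I pos (map \<sigma> [1..<Suc m]) n2" "F n2 = L'"
    using limit[OF dist2 set2] by blast
  have less1: "pos i (n1 i) < pos j (n1 j)" if "i \<in> I" "j \<in> I" "i < j" for i j
  proof -
    have "i - 1 < j - 1" using that by (auto simp: I_def)
    then show ?thesis
      using n1(1) nth[OF that(1)] nth[OF that(2)] unfolding spread_def sorted_wrt_iff_nth_less by metis
  qed
  have less2: "pos j (n2 j) < pos i (n2 i)" if ij: "i \<in> I" "j \<in> I" "i < j" for i j
  proof -
    define i' j' where "i' = Suc m - i" and "j' = Suc m - j"
    have I': "i' \<in> I" "j' \<in> I" "j' - 1 < i' - 1" "\<sigma> i' = i" "\<sigma> j' = j"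
      using ij by (auto simp: I_def i'_def j'_def \<sigma>_def)
    have "map \<sigma> [1..<Suc m] ! (i' - 1) = i" "map \<sigma> [1..<Suc m] ! (j' - 1) = j"
      "i' - 1 < length (map \<sigma> [1..<Suc m])"
      using nth[OF I'(1)] nth[OF I'(2)] I' by (simp_all del: upt_Suc)
    then show ?thesis using n2(1) I'(3) unfolding spread_def sorted_wrt_iff_nth_less by metis
  qed
  have "descending (S n1)"
    unfolding descending_def
  proof (intro conjI ballI impI finS)
    fix q q' assume "q \<in> S n1" "q' \<in> S n1" "q < q'"
    then obtain i j where ij: "i \<in> I" "j \<in> I" "q = pos i (n1 i)" "q' = pos j (n1 j)" by (auto simp: S_def)
    then have "i < j" using less1[of j i] \<open>q < q'\<close> by (metis less_asym linorder_neqE_nat less_irrefl)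
    then show "label q' < label q" using ij by (auto simp: label_pos I_def)
  qed
  then have lower: "real m powr (1 / r) \<le> L"
    using N_indicator_descending cardS F_eq n1(2) by metis
  have "N (\<lambda>q. if q \<in> S n2 then 1 else 0) \<le> real (card (S n2)) powr (1 / p)"
  proof (rule N_indicator_ascending[OF finS])
    fix q q' assume "q \<in> S n2" "q' \<in> S n2" "q < q'"
    then obtain i j where ij: "i \<in> I" "j \<in> I" "q = pos i (n2 i)" "q' = pos j (n2 j)" by (auto simp: S_def)
    then have "\<not> i < j" using less2[of i j] \<open>q < q'\<close> by auto
    then show "label q \<le> label q'" using ij by (auto simp: label_pos I_def)
  qed
  then have upper: "L' \<le> real m powr (1 / p)" using cardS F_eq n2(2) by metis
  have "x i k \<in> X" "N (x i k) \<le> 1" for i k using unit_vector_mem_X N_unit_vector_le by (auto simp: x_def)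
  then have "L \<le> C * L'"
    using C[of m x \<sigma> L L'] \<sigma> L L' unfolding I_def F_def by blast
  also have "\<dots> \<le> \<bar>C\<bar> * real m powr (1 / p)"
  proof -
    have "0 \<le> L'" unfolding n2(2)[symmetric] F_eq by (intro N_nonneg finite_support(1)[OF finS[of n2]]) simp
    then show ?thesis using upper by (intro mult_mono) auto
  qed
  finally have "real m powr (1 / p) * real m powr (1 / t) \<le> real m powr (1 / p) * \<bar>C\<bar>"
    using lower by (simp add: r_eq powr_add mult.commute)
  moreover have m0: "real m > 0" using m powr_ge_zero[of "\<bar>C\<bar> + 1" t] by linarith
  ultimately have "real m powr (1 / t) \<le> \<bar>C\<bar>" by simp
  moreover have "\<bar>C\<bar> + 1 \<le> real m powr (1 / t)"
  proof -
    have "((\<bar>C\<bar> + 1) powr t) powr (1 / t) \<le> real m powr (1 / t)" using m by (intro powr_mono2) auto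
    then show ?thesis by (simp add: powr_powr)
  qed
  ultimately show False by linarith
qed

end

section \<open>Basic sequences\<close>

locale normed_carrier =
  fixes V :: "'a::real_vector set" and nrm :: "'a \<Rightarrow> real"
  assumes normed: "normed_space_on V nrm"
begin

lemma V_subspace: "subspace V"
  using normed by (simp add: normed_space_on_def)

lemma V_zero: "0 \<in> V"
  and V_scale: "u \<in> V \<Longrightarrow> c *\<^sub>R u \<in> V" and V_diff: "u \<in> V \<Longrightarrow> v \<in> V \<Longrightarrow> u - v \<in> V"
  using V_subspace by (auto intro: subspace_0 subspace_scale subspace_diff)

lemma V_sum: "(\<And>i. i \<in> A \<Longrightarrow> f i \<in> V) \<Longrightarrow> sum f A \<in> V"
  using V_subspace by (rule subspace_sum)

lemma nrm_eq_0: "u \<in> V \<Longrightarrow> nrm u = 0 \<longleftrightarrow> u = 0"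
  using normed by (simp add: normed_space_on_def)

lemma nrm_scale: "u \<in> V \<Longrightarrow> nrm (c *\<^sub>R u) = \<bar>c\<bar> * nrm u"
  using normed by (simp add: normed_space_on_def)

lemma nrm_triangle: "u \<in> V \<Longrightarrow> v \<in> V \<Longrightarrow> nrm (u + v) \<le> nrm u + nrm v"
  using normed by (simp add: normed_space_on_def)

lemma nrm_zero: "nrm 0 = 0"
  using nrm_eq_0 V_zero by blast

lemma nrm_minus: "u \<in> V \<Longrightarrow> nrm (- u) = nrm u"
  using nrm_scale[of u "-1"] by simp

lemma nrm_nonneg: "u \<in> V \<Longrightarrow> 0 \<le> nrm u"
  using nrm_triangle[of u "- u"] nrm_minus[of u] nrm_zero V_scale[of u "-1"] by simp

lemma nrm_commute: "u \<in> V \<Longrightarrow> v \<in> V \<Longrightarrow> nrm (u - v) = nrm (v - u)"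
  using nrm_minus[of "u - v"] V_diff[of u v] by simp

lemma nrm_triangle_diff: "u \<in> V \<Longrightarrow> v \<in> V \<Longrightarrow> nrm (u - v) \<le> nrm u + nrm v"
  using nrm_triangle[of u "- v"] nrm_minus[of v] V_scale[of v "-1"] by simp

lemma nrm_triangle_via: "u \<in> V \<Longrightarrow> v \<in> V \<Longrightarrow> w \<in> V \<Longrightarrow> nrm (u - w) \<le> nrm (u - v) + nrm (v - w)"
  using nrm_triangle[of "u - v" "v - w"] V_diff by simp

lemma nrm_sum: "finite A \<Longrightarrow> (\<And>i. i \<in> A \<Longrightarrow> f i \<in> V) \<Longrightarrow> nrm (sum f A) \<le> (\<Sum>i\<in>A. nrm (f i))"
proof (induction A rule: finite_induct)
  case (insert i A)
  then show ?case using nrm_triangle[of "f i" "sum f A"] V_sum[of A f] by auto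
qed (simp add: nrm_zero)

end

text \<open>The definition of a basic sequence only provides unique expansions.  The boundedness of the partial sum
  operators, the content of this locale, is Banach's theorem and uses the completeness of the space.\<close>

locale normalized_basic_sequence = normed_carrier V nrm
  for V :: "'a::real_vector set" and nrm +
  fixes x :: "nat \<Rightarrow> 'a"
  assumes banach: "banach_space_on V nrm" and basic: "basic_sequence V nrm x" and norm1: "nrm (x k) = 1"
begin

definition Span :: "'a set" where "Span = closed_span_on V nrm (range x)"

definition expansion :: "'a \<Rightarrow> (nat \<Rightarrow> real) \<Rightarrow> bool" where
  "expansion v a \<longleftrightarrow> (\<lambda>n. nrm (v - (\<Sum>i<n. a i *\<^sub>R x i))) \<longlonglongrightarrow> 0"

definition coef :: "'a \<Rightarrow> nat \<Rightarrow> real" where "coef v = (THE a. expansion v a)"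

definition psum :: "'a \<Rightarrow> nat \<Rightarrow> 'a" where "psum v n = (\<Sum>i<n. coef v i *\<^sub>R x i)"

lemma x_V: "x k \<in> V"
  using basic by (simp add: basic_sequence_def)

lemma comb_V: "(\<Sum>i\<in>A. a i *\<^sub>R x i) \<in> V"
  by (intro V_sum V_scale x_V)

lemma span_subset_V: "span (range x) \<subseteq> V"
  using V_subspace x_V by (intro span_minimal) auto

lemma Span_V: "v \<in> Span \<Longrightarrow> v \<in> V"
  by (simp add: Span_def closed_span_on_def)

lemma Span_approx: "v \<in> Span \<Longrightarrow> \<epsilon> > 0 \<Longrightarrow> \<exists>y\<in>span (range x). nrm (v - y) < \<epsilon>"
  by (simp add: Span_def closed_span_on_def)

lemma Span_I: "v \<in> V \<Longrightarrow> (\<And>\<epsilon>. \<epsilon> > 0 \<Longrightarrow> \<exists>y\<in>span (range x). nrm (v - y) < \<epsilon>) \<Longrightarrow> v \<in> Span"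
  by (simp add: Span_def closed_span_on_def)

lemma span_in_Span: "v \<in> span (range x) \<Longrightarrow> v \<in> Span"
  using span_subset_V nrm_zero by (intro Span_I) (auto intro!: bexI[of _ v])

lemma Span_closed:
  assumes v: "v \<in> V" and lim: "\<And>\<epsilon>. \<epsilon> > 0 \<Longrightarrow> \<exists>w\<in>Span. nrm (v - w) < \<epsilon>"
  shows "v \<in> Span"
proof (rule Span_I[OF v])
  fix \<epsilon> :: real assume "\<epsilon> > 0"
  then obtain w where w: "w \<in> Span" "nrm (v - w) < \<epsilon> / 2" using lim[of "\<epsilon> / 2"] by auto
  then obtain y where y: "y \<in> span (range x)" "nrm (w - y) < \<epsilon> / 2" using Span_approx[of w "\<epsilon> / 2"] \<open>\<epsilon> > 0\<close> by auto
  have "nrm (v - y) \<le> nrm (v - w) + nrm (w - y)"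
    using v Span_V[OF w(1)] y(1) span_subset_V by (intro nrm_triangle_via) auto
  then show "\<exists>y\<in>span (range x). nrm (v - y) < \<epsilon>" using w y by (intro bexI[of _ y]) auto
qed

lemma Span_zero: "0 \<in> Span"
  by (rule span_in_Span) (rule span_zero)

lemma Span_scale:
  assumes "v \<in> Span"
  shows "c *\<^sub>R v \<in> Span"
proof (rule Span_I)
  show "c *\<^sub>R v \<in> V" using assms Span_V V_scale by blast
  fix \<epsilon> :: real assume "\<epsilon> > 0"
  then obtain y where y: "y \<in> span (range x)" "nrm (v - y) < \<epsilon> / (\<bar>c\<bar> + 1)"
    using Span_approx[OF assms, of "\<epsilon> / (\<bar>c\<bar> + 1)"] by auto
  have "nrm (c *\<^sub>R v - c *\<^sub>R y) = \<bar>c\<bar> * nrm (v - y)"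
    using nrm_scale[of "v - y" c] V_diff Span_V[OF assms] y(1) span_subset_V by (auto simp: scaleR_diff_right)
  also have "\<dots> \<le> \<bar>c\<bar> * (\<epsilon> / (\<bar>c\<bar> + 1))" using y(2) by (intro mult_left_mono) auto
  also have "\<dots> < \<epsilon>" using \<open>\<epsilon> > 0\<close> by (simp add: field_simps)
  finally show "\<exists>y\<in>span (range x). nrm (c *\<^sub>R v - y) < \<epsilon>" using span_scale[OF y(1)] by blast
qed

lemma Span_diff:
  assumes "v \<in> Span" "w \<in> Span"
  shows "v - w \<in> Span"
proof (rule Span_I)
  show "v - w \<in> V" using assms Span_V V_diff by blast
  fix \<epsilon> :: real assume "\<epsilon> > 0"
  then obtain y z where y: "y \<in> span (range x)" "nrm (v - y) < \<epsilon> / 2" and z: "z \<in> span (range x)" "nrm (w - z) < \<epsilon> / 2"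
    using Span_approx[OF assms(1), of "\<epsilon> / 2"] Span_approx[OF assms(2), of "\<epsilon> / 2"] by auto
  have "nrm ((v - w) - (y - z)) = nrm ((v - y) - (w - z))" by (simp add: algebra_simps)
  also have "\<dots> \<le> nrm (v - y) + nrm (w - z)"
    using assms Span_V y(1) z(1) span_subset_V V_diff by (intro nrm_triangle_diff) auto
  also have "\<dots> < \<epsilon>" using y z by simp
  finally show "\<exists>y\<in>span (range x). nrm (v - w - y) < \<epsilon>" using span_diff[OF y(1) z(1)] by blast
qed

lemma Span_add: "v \<in> Span \<Longrightarrow> w \<in> Span \<Longrightarrow> v + w \<in> Span"
  using Span_diff[of v "(-1) *\<^sub>R w"] Span_scale[of w "-1"] by simp

lemma expansion_unique: "v \<in> Span \<Longrightarrow> \<exists>!a. expansion v a"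
  using basic by (simp add: basic_sequence_def Span_def expansion_def)

lemma expansion_coef: "v \<in> Span \<Longrightarrow> expansion v (coef v)"
  unfolding coef_def by (rule theI'[OF expansion_unique])

lemma coef_eqI: "v \<in> Span \<Longrightarrow> expansion v a \<Longrightarrow> coef v = a"
  using expansion_unique[of v] expansion_coef[of v] by blast

lemma psum_V: "psum v n \<in> V"
  unfolding psum_def by (rule comb_V)

lemma psum_tendsto: "v \<in> Span \<Longrightarrow> (\<lambda>n. nrm (v - psum v n)) \<longlonglongrightarrow> 0"
  using expansion_coef by (simp add: expansion_def psum_def)

lemma coef_diff:
  assumes "v \<in> Span" "w \<in> Span"
  shows "coef (v - w) = (\<lambda>i. coef v i - coef w i)"
proof (rule coef_eqI[OF Span_diff[OF assms]], unfold expansion_def, rule tendsto_sandwich[OF _ _ tendsto_const])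
  have eq: "(\<Sum>i<n. (coef v i - coef w i) *\<^sub>R x i) = psum v n - psum w n" for n
    by (simp add: psum_def scaleR_diff_left sum_subtractf)
  show "\<forall>\<^sub>F n in sequentially. nrm (v - w - (\<Sum>i<n. (coef v i - coef w i) *\<^sub>R x i)) \<le> nrm (v - psum v n) + nrm (w - psum w n)"
  proof (rule always_eventually, rule allI)
    fix n
    have e: "v - w - (psum v n - psum w n) = (v - psum v n) - (w - psum w n)" by simp
    show "nrm (v - w - (\<Sum>i<n. (coef v i - coef w i) *\<^sub>R x i)) \<le> nrm (v - psum v n) + nrm (w - psum w n)"
      unfolding eq e by (intro nrm_triangle_diff V_diff psum_V Span_V assms)
  qed
  show "\<forall>\<^sub>F n in sequentially. 0 \<le> nrm (v - w - (\<Sum>i<n. (coef v i - coef w i) *\<^sub>R x i))"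
    using assms Span_V comb_V V_diff nrm_nonneg by auto
  show "(\<lambda>n. nrm (v - psum v n) + nrm (w - psum w n)) \<longlonglongrightarrow> 0"
    using tendsto_add[OF psum_tendsto[OF assms(1)] psum_tendsto[OF assms(2)]] by simp
qed

lemma coef_scale:
  assumes "v \<in> Span"
  shows "coef (c *\<^sub>R v) = (\<lambda>i. c * coef v i)"
proof (rule coef_eqI[OF Span_scale[OF assms]], unfold expansion_def)
  have eq: "(\<Sum>i<n. (c * coef v i) *\<^sub>R x i) = c *\<^sub>R psum v n" for n
    by (simp add: psum_def scaleR_sum_right)
  have "nrm (c *\<^sub>R v - (\<Sum>i<n. (c * coef v i) *\<^sub>R x i)) = \<bar>c\<bar> * nrm (v - psum v n)" for n
    unfolding eq using nrm_scale[of "v - psum v n" c] V_diff Span_V[OF assms] psum_V by (simp add: scaleR_diff_right)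
  then show "(\<lambda>n. nrm (c *\<^sub>R v - (\<Sum>i<n. (c * coef v i) *\<^sub>R x i))) \<longlonglongrightarrow> 0"
    using tendsto_mult_right_zero[OF psum_tendsto[OF assms]] by simp
qed

lemma psum_diff: "v \<in> Span \<Longrightarrow> w \<in> Span \<Longrightarrow> psum (v - w) n = psum v n - psum w n"
  by (simp add: psum_def coef_diff scaleR_diff_left sum_subtractf)

lemma psum_scale: "v \<in> Span \<Longrightarrow> psum (c *\<^sub>R v) n = c *\<^sub>R psum v n"
  by (simp add: psum_def coef_scale scaleR_sum_right)

lemma coef_le:
  assumes "\<And>n. nrm (psum v n) \<le> B"
  shows "\<bar>coef v i\<bar> \<le> 2 * B"
proof -
  have "coef v i *\<^sub>R x i = psum v (Suc i) - psum v i" by (simp add: psum_def)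
  then have "\<bar>coef v i\<bar> = nrm (psum v (Suc i) - psum v i)" using nrm_scale[OF x_V] norm1 by (metis mult.right_neutral)
  also have "\<dots> \<le> nrm (psum v (Suc i)) + nrm (psum v i)" using psum_V by (intro nrm_triangle_diff) auto
  finally show ?thesis using assms[of i] assms[of "Suc i"] by simp
qed

lemma psum_bounded:
  assumes "v \<in> Span"
  shows "\<exists>M::nat. \<forall>n. nrm (psum v n) \<le> real M"
proof -
  have "Bseq (\<lambda>n. nrm (v - psum v n))" using psum_tendsto[OF assms] by (intro convergent_imp_Bseq convergentI)
  then obtain B where B: "\<And>n. \<bar>nrm (v - psum v n)\<bar> \<le> B" by (auto simp: Bseq_def)
  obtain M :: nat where M: "nrm v + B \<le> real M" using real_arch_simple by blast
  have "nrm (psum v n) \<le> real M" for n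
    using nrm_triangle_diff[of v "v - psum v n"] Span_V[OF assms] psum_V V_diff B[of n] M by (auto simp: abs_le_iff)
  then show ?thesis by blast
qed

text \<open>By Baire's theorem the vectors whose partial sums are bounded by some \<open>m\<close> are dense in a ball; by
  subtracting and scaling, any vector is approximated by vectors with partial sums under control.\<close>

lemma approximate_open_mapping:
  obtains C where "0 \<le> C" "\<And>w \<delta>. w \<in> Span \<Longrightarrow> 0 < \<delta> \<Longrightarrow> \<exists>f\<in>Span. nrm (w - f) < \<delta> \<and> (\<forall>n. nrm (psum f n) \<le> C * nrm w)"
proof -
  define d where "d u v = (if u \<in> Span \<and> v \<in> Span then nrm (u - v) else 0)" for u v
  interpret M: Metric_space Span d
  proof
    show "0 \<le> d u v" for u v using nrm_nonneg V_diff Span_V by (auto simp: d_def)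
    show "d u v = d v u" for u v using nrm_commute Span_V by (auto simp: d_def)
    show "(d u v = 0) = (u = v)" if "u \<in> Span" "v \<in> Span" for u v
      using that nrm_eq_0[of "u - v"] V_diff Span_V by (auto simp: d_def)
    show "d u w \<le> d u v + d v w" if "u \<in> Span" "v \<in> Span" "w \<in> Span" for u v w
      using that nrm_triangle_via Span_V by (auto simp: d_def)
  qed
  have complete: "M.mcomplete"
    unfolding M.mcomplete_def
  proof (intro allI impI)
    fix \<sigma> assume \<sigma>: "M.MCauchy \<sigma>"
    then have \<sigma>Span: "\<sigma> n \<in> Span" for n by (auto simp: M.MCauchy_def)
    have "\<forall>\<epsilon>>0. \<exists>M. \<forall>m\<ge>M. \<forall>n\<ge>M. nrm (\<sigma> m - \<sigma> n) < \<epsilon>"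
      using \<sigma> \<sigma>Span unfolding M.MCauchy_def d_def by simp
    then obtain l where l: "l \<in> V" "(\<lambda>n. nrm (\<sigma> n - l)) \<longlonglongrightarrow> 0"
      using banach \<sigma>Span Span_V unfolding banach_space_on_def by metis
    have ev: "eventually (\<lambda>n. nrm (\<sigma> n - l) < \<epsilon>) sequentially" if "\<epsilon> > 0" for \<epsilon>
      using order_tendstoD(2)[OF l(2) that] .
    have lW: "l \<in> Span"
    proof (rule Span_closed[OF l(1)])
      fix \<epsilon> :: real assume "\<epsilon> > 0"
      then obtain n where "nrm (\<sigma> n - l) < \<epsilon>" using eventually_happens'[OF sequentially_bot ev] by blast
      then show "\<exists>w\<in>Span. nrm (l - w) < \<epsilon>" using nrm_commute[OF l(1) Span_V[OF \<sigma>Span]] \<sigma>Span by metis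
    qed
    have "\<exists>N. \<forall>n\<ge>N. \<sigma> n \<in> Span \<and> d (\<sigma> n) l < \<epsilon>" if "\<epsilon> > 0" for \<epsilon>
      using ev[OF that] \<sigma>Span lW unfolding eventually_sequentially d_def by simp
    then show "\<exists>l. limitin M.mtopology \<sigma> l sequentially"
      using lW unfolding M.limit_metric_sequentially by blast
  qed
  define Fm where "Fm m = {v \<in> Span. \<forall>n. nrm (psum v n) \<le> real m}" for m :: nat
  define \<G> where "\<G> = range (\<lambda>m. M.mtopology closure_of Fm m)"
  have "\<exists>T\<in>\<G>. M.mtopology interior_of T \<noteq> {}"
  proof (rule ccontr)
    assume "\<not> ?thesis"
    then have "M.mtopology interior_of \<Union>\<G> = {}"
      by (intro M.metric_Baire_category_alt complete) (auto simp: \<G>_def)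
    moreover have "\<Union>\<G> = Span"
    proof
      show "\<Union>\<G> \<subseteq> Span" using closure_of_subset_topspace[of M.mtopology] by (auto simp: \<G>_def)
      show "Span \<subseteq> \<Union>\<G>"
      proof
        fix v assume v: "v \<in> Span"
        then obtain m where "v \<in> Fm m" using psum_bounded[OF v] by (auto simp: Fm_def)
        moreover have "Fm m \<subseteq> M.mtopology closure_of Fm m" 
          by (intro closure_of_subset) (auto simp: Fm_def)
        ultimately show "v \<in> \<Union>\<G>" by (auto simp: \<G>_def)
      qed
    qed
    moreover have "M.mtopology interior_of Span = Span" using interior_of_topspace[of M.mtopology] by simp
    ultimately show False using Span_zero by auto
  qed
  then obtain m v0 where v0: "v0 \<in> M.mtopology interior_of (M.mtopology closure_of Fm m)" by (auto simp: \<G>_def)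
  have "openin M.mtopology (M.mtopology interior_of (M.mtopology closure_of Fm m))" by simp
  then obtain \<epsilon> where \<epsilon>: "\<epsilon> > 0" "M.mball v0 \<epsilon> \<subseteq> M.mtopology interior_of (M.mtopology closure_of Fm m)"
    using v0 unfolding M.openin_mtopology by blast
  have v0W: "v0 \<in> Span" using v0 interior_of_subset_topspace[of M.mtopology] by auto
  have approx: "\<exists>f\<in>Fm m. nrm (w - f) < \<delta>" if w: "w \<in> Span" "nrm (v0 - w) < \<epsilon>" and \<delta>: "\<delta> > 0" for w \<delta>
  proof -
    have "w \<in> M.mball v0 \<epsilon>" using w v0W by (simp add: M.mball_def d_def)
    then have "w \<in> M.mtopology closure_of Fm m" 
      using subset_trans[OF \<epsilon>(2) interior_of_subset] by (rule rev_subsetD)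
    then obtain f where "f \<in> Fm m" "f \<in> M.mball w \<delta>" using \<delta> unfolding M.metric_closure_of by blast
    then show ?thesis by (auto simp: M.mball_def d_def)
  qed
  define C where "C = 4 * real m / \<epsilon>"
  show ?thesis
  proof (rule that[of C])
    show "0 \<le> C" using \<epsilon>(1) by (simp add: C_def)
    fix w \<delta> assume w: "w \<in> Span" and \<delta>: "(0::real) < \<delta>"
    show "\<exists>f\<in>Span. nrm (w - f) < \<delta> \<and> (\<forall>n. nrm (psum f n) \<le> C * nrm w)"
    proof (cases "w = 0")
      case True
      have "psum 0 n = 0" for n using psum_scale[OF Span_zero, of 0] by simp
      then show ?thesis using True Span_zero \<delta> nrm_zero by (intro bexI[of _ 0]) auto
    next
      case False
      then have nw: "nrm w > 0" using nrm_eq_0[OF Span_V[OF w]] nrm_nonneg[OF Span_V[OF w]] by simp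
      define c where "c = \<epsilon> / (2 * nrm w)"
      have c: "c > 0" using \<epsilon> nw by (simp add: c_def)
      define \<delta>' where "\<delta>' = \<delta> * c / 2"
      have \<delta>': "\<delta>' > 0" using \<delta> c by (simp add: \<delta>'_def)
      have cw: "v0 + c *\<^sub>R w \<in> Span" using v0W w Span_scale Span_add by blast
      have "nrm (v0 - (v0 + c *\<^sub>R w)) = nrm (c *\<^sub>R w)" using nrm_minus[OF V_scale[OF Span_V[OF w]]] by simp
      also have "\<dots> < \<epsilon>" using nrm_scale[OF Span_V[OF w]] c nw \<epsilon> by (simp add: c_def)
      finally obtain f1 where f1: "f1 \<in> Fm m" "nrm (v0 + c *\<^sub>R w - f1) < \<delta>'" using approx[OF cw _ \<delta>'] by blast
      have "nrm (v0 - v0) < \<epsilon>" using \<epsilon> nrm_zero by simp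
      then obtain f2 where f2: "f2 \<in> Fm m" "nrm (v0 - f2) < \<delta>'" using approx[OF v0W _ \<delta>'] by blast
      define f where "f = f1 - f2"
      have W12: "f1 \<in> Span" "f2 \<in> Span" using f1 f2 by (auto simp: Fm_def)
      have fW: "f \<in> Span" unfolding f_def using W12 by (rule Span_diff)
      have e: "c *\<^sub>R w - f = (v0 + c *\<^sub>R w - f1) - (v0 - f2)" by (simp add: f_def)
      have "nrm (c *\<^sub>R w - f) \<le> nrm (v0 + c *\<^sub>R w - f1) + nrm (v0 - f2)"
        unfolding e by (intro nrm_triangle_diff V_diff Span_V W12 cw v0W)
      then have 1: "nrm (c *\<^sub>R w - f) < \<delta> * c" using f1 f2 by (simp add: \<delta>'_def)
      have 2: "nrm (psum f n) \<le> 2 * real m" for n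
      proof -
        have "nrm (psum f n) \<le> nrm (psum f1 n) + nrm (psum f2 n)"
          unfolding f_def psum_diff[OF W12] using psum_V by (intro nrm_triangle_diff) auto
        moreover have "nrm (psum f1 n) \<le> real m" "nrm (psum f2 n) \<le> real m" using f1(1) f2(1) by (auto simp: Fm_def)
        ultimately show ?thesis by simp
      qed
      show ?thesis
      proof (intro bexI[of _ "inverse c *\<^sub>R f"] conjI allI)
        show "inverse c *\<^sub>R f \<in> Span" by (rule Span_scale[OF fW])
        have "w - inverse c *\<^sub>R f = inverse c *\<^sub>R (c *\<^sub>R w - f)" using c by (simp add: scaleR_diff_right)
        then have "nrm (w - inverse c *\<^sub>R f) = inverse c * nrm (c *\<^sub>R w - f)"
          using nrm_scale[of "c *\<^sub>R w - f" "inverse c"] Span_V[OF Span_diff[OF Span_scale[OF w] fW]] c by simp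
        also have "\<dots> < inverse c * (\<delta> * c)" using 1 c by (intro mult_strict_left_mono) auto
        also have "\<dots> = \<delta>" using c by simp
        finally show "nrm (w - inverse c *\<^sub>R f) < \<delta>" .
        fix n
        have "nrm (psum (inverse c *\<^sub>R f) n) = inverse c * nrm (psum f n)"
          unfolding psum_scale[OF fW] using nrm_scale[OF psum_V] c by simp
        also have "\<dots> \<le> inverse c * (2 * real m)" using 2 c by (intro mult_left_mono) auto
        also have "\<dots> = C * nrm w" using nw \<epsilon> by (simp add: c_def C_def field_simps)
        finally show "nrm (psum (inverse c *\<^sub>R f) n) \<le> C * nrm w" .
      qed
    qed
  qed
qed

text \<open>Subtracting successive approximations from \<open>w\<close> gives remainders \<open>v j\<close> tending to zero geometrically whose
  partial sums are Cauchy uniformly in \<open>n\<close>.  Their coefficients converge to the coefficients \<open>l\<close> of an expansion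
  of zero, so \<open>l = 0\<close> by uniqueness, and the telescoping bound at \<open>J = 0\<close> concerns \<open>w\<close> itself.\<close>

lemma basis_constant:
  obtains C where "0 \<le> C" "\<And>w n. w \<in> Span \<Longrightarrow> nrm (psum w n) \<le> C * nrm w"
proof -
  obtain C where C: "0 \<le> C" and app: "\<And>w \<delta>. w \<in> Span \<Longrightarrow> 0 < \<delta> \<Longrightarrow> \<exists>f\<in>Span. nrm (w - f) < \<delta> \<and> (\<forall>n. nrm (psum f n) \<le> C * nrm w)"
    using approximate_open_mapping by blast
  have "nrm (psum w n) \<le> 2 * C * nrm w" if w: "w \<in> Span" for w n
  proof (cases "w = 0")
    case True
    have "psum 0 n = 0" using psum_scale[OF Span_zero, of 0] by simp
    then show ?thesis using True nrm_zero by simp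
  next
    case False
    define nw where "nw = nrm w"
    have nw: "nw > 0" using False nrm_eq_0[OF Span_V[OF w]] nrm_nonneg[OF Span_V[OF w]] by (simp add: nw_def)
    define P where "P j v \<longleftrightarrow> v \<in> Span \<and> nrm v \<le> nw / 2 ^ j \<and> (j = 0 \<longrightarrow> v = w)" for j v
    define Q where "Q j v v' \<longleftrightarrow> (\<forall>n. nrm (psum (v - v') n) \<le> C * (nw / 2 ^ j))" for j v v'
    have "\<exists>v. P 0 v" using w by (auto simp: P_def nw_def)
    moreover have "\<exists>v'. P (Suc j) v' \<and> Q j v v'" if "P j v" for j v
    proof -
      have v: "v \<in> Span" "nrm v \<le> nw / 2 ^ j" using that by (auto simp: P_def)
      obtain f where f: "f \<in> Span" "nrm (v - f) < nw / 2 ^ Suc j" "\<forall>n. nrm (psum f n) \<le> C * nrm v"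
        using app[OF v(1), of "nw / 2 ^ Suc j"] nw by auto
      have "nrm (psum f n) \<le> C * (nw / 2 ^ j)" for n
        using f(3) mult_left_mono[OF v(2) C] order_trans by blast
      then show ?thesis using f Span_diff[OF v(1) f(1)] by (intro exI[of _ "v - f"]) (auto simp: P_def Q_def)
    qed
    ultimately obtain v where v: "\<And>j. P j (v j)" "\<And>j. Q j (v j) (v (Suc j))"
      using dependent_nat_choice[of P Q] by metis
    have vW: "v j \<in> Span" and v_le: "nrm (v j) \<le> nw / 2 ^ j" for j using v(1)[of j] by (auto simp: P_def)
    have v0: "v 0 = w" using v(1)[of 0] by (simp add: P_def)
    have step: "nrm (psum (v j) n - psum (v (Suc j)) n) \<le> C * (nw / 2 ^ j)" for j n
      using v(2)[of j] psum_diff[OF vW vW] by (simp add: Q_def)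
    have tele: "nrm (psum (v J) n - psum (v J') n) \<le> 2 * C * nw / 2 ^ J - 2 * C * nw / 2 ^ J'" if "J \<le> J'" for J J' n
      using that
    proof (induction J' rule: dec_induct)
      case (step k)
      have "nrm (psum (v J) n - psum (v (Suc k)) n) \<le> nrm (psum (v J) n - psum (v k) n) + nrm (psum (v k) n - psum (v (Suc k)) n)"
        by (intro nrm_triangle_via psum_V)
      also have "\<dots> \<le> 2 * C * nw / 2 ^ J - 2 * C * nw / 2 ^ k + C * (nw / 2 ^ k)"
        using step.IH \<open>\<And>j n. nrm (psum (v j) n - psum (v (Suc j)) n) \<le> C * (nw / 2 ^ j)\<close>[where j = k and n = n] by linarith
      also have "\<dots> = 2 * C * nw / 2 ^ J - 2 * C * nw / 2 ^ Suc k" by (simp add: field_simps)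
      finally show ?case .
    qed (simp add: nrm_zero)
    have tele': "nrm (psum (v J) n - psum (v J') n) \<le> 2 * C * nw / 2 ^ J" if "J \<le> J'" for J J' n
    proof -
      have "0 \<le> 2 * C * nw / 2 ^ J'" using C nw by simp
      then show ?thesis using tele[OF that, of n] by linarith
    qed
    have to0: "(\<lambda>J. c / 2 ^ J) \<longlonglongrightarrow> 0" for c :: real
      by (rule LIMSEQ_divide_realpow_zero) simp
    have "Cauchy (\<lambda>J. coef (v J) i)" for i
    proof (rule CauchyI')
      fix e :: real assume "e > 0"
      then obtain M where M: "\<And>J. J \<ge> M \<Longrightarrow> 4 * C * nw / 2 ^ J < e"
        using order_tendstoD(2)[OF to0[of "4 * C * nw"], of e] unfolding eventually_sequentially by blast
      have "dist (coef (v J) i) (coef (v J') i) < e" if "J \<ge> M" "J' > J" for J J'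
      proof -
        have "\<bar>coef (v J - v J') i\<bar> \<le> 2 * (2 * C * nw / 2 ^ J)"
          using tele'[of J J'] that by (intro coef_le) (simp add: psum_diff vW)
        then show ?thesis using M[OF that(1)] by (simp add: coef_diff vW dist_real_def)
      qed
      then show "\<exists>M. \<forall>m\<ge>M. \<forall>n>m. dist (coef (v m) i) (coef (v n) i) < e" by blast
    qed
    then have "\<forall>i. \<exists>l. (\<lambda>J. coef (v J) i) \<longlonglongrightarrow> l" using Cauchy_convergent_iff convergent_def by blast
    from choice[OF this] obtain l where l: "\<And>i. (\<lambda>J. coef (v J) i) \<longlonglongrightarrow> l i" by blast
    define T where "T n = (\<Sum>i<n. l i *\<^sub>R x i)" for n
    have T_V: "T n \<in> V" for n unfolding T_def by (rule comb_V)
    have close: "nrm (psum (v J) n - T n) \<le> 2 * C * nw / 2 ^ J" for J n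
    proof (rule LIMSEQ_le_const)
      have "(\<lambda>J'. 2 * C * nw / 2 ^ J + (\<Sum>i<n. \<bar>coef (v J') i - l i\<bar>)) \<longlonglongrightarrow> 2 * C * nw / 2 ^ J + (\<Sum>i<n. \<bar>l i - l i\<bar>)"
        by (intro tendsto_add tendsto_const tendsto_sum tendsto_rabs tendsto_diff l)
      then show "(\<lambda>J'. 2 * C * nw / 2 ^ J + (\<Sum>i<n. \<bar>coef (v J') i - l i\<bar>)) \<longlonglongrightarrow> 2 * C * nw / 2 ^ J" by simp
      have "nrm (psum (v J) n - T n) \<le> 2 * C * nw / 2 ^ J + (\<Sum>i<n. \<bar>coef (v J') i - l i\<bar>)" if "J' \<ge> J" for J'
      proof -
        have "psum (v J') n - T n = (\<Sum>i<n. (coef (v J') i - l i) *\<^sub>R x i)"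
          by (simp add: psum_def T_def scaleR_diff_left sum_subtractf)
        also have "nrm \<dots> \<le> (\<Sum>i<n. nrm ((coef (v J') i - l i) *\<^sub>R x i))"
          by (intro nrm_sum) (auto intro: V_scale x_V)
        also have "\<dots> = (\<Sum>i<n. \<bar>coef (v J') i - l i\<bar>)" by (simp add: nrm_scale x_V norm1)
        finally have "nrm (psum (v J') n - T n) \<le> (\<Sum>i<n. \<bar>coef (v J') i - l i\<bar>)" .
        moreover have "nrm (psum (v J) n - T n) \<le> nrm (psum (v J) n - psum (v J') n) + nrm (psum (v J') n - T n)"
          by (intro nrm_triangle_via psum_V T_V)
        ultimately show ?thesis using tele'[OF that, of n] by linarith
      qed
      then show "\<exists>M. \<forall>J'\<ge>M. nrm (psum (v J) n - T n) \<le> 2 * C * nw / 2 ^ J + (\<Sum>i<n. \<bar>coef (v J') i - l i\<bar>)" by blast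
    qed
    have "(\<lambda>n. nrm (0 - T n)) \<longlonglongrightarrow> 0"
    proof (rule LIMSEQ_I)
      fix e :: real assume e: "e > 0"
      obtain J where J: "(2 * C * nw + nw) / 2 ^ J < e / 2"
        using eventually_happens'[OF sequentially_bot order_tendstoD(2)[OF to0[of "2 * C * nw + nw"], of "e / 2"]] e by auto
      obtain n0 where n0: "\<And>n. n \<ge> n0 \<Longrightarrow> nrm (v J - psum (v J) n) < e / 2"
        using order_tendstoD(2)[OF psum_tendsto[OF vW[of J]], of "e / 2"] e unfolding eventually_sequentially by auto
      have "norm (nrm (0 - T n) - 0) < e" if "n \<ge> n0" for n
      proof -
        have "nrm (0 - T n) \<le> nrm (0 - v J) + nrm (v J - T n)"
          using V_zero Span_V[OF vW] T_V by (intro nrm_triangle_via) auto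
        also have "nrm (v J - T n) \<le> nrm (v J - psum (v J) n) + nrm (psum (v J) n - T n)"
          using Span_V[OF vW] T_V psum_V by (intro nrm_triangle_via) auto
        also have "nrm (0 - v J) = nrm (v J)" using nrm_minus Span_V[OF vW] by simp
        finally have "nrm (0 - T n) \<le> nw / 2 ^ J + (nrm (v J - psum (v J) n) + 2 * C * nw / 2 ^ J)"
          using v_le[of J] close[of J n] by linarith
        moreover have "2 * C * nw / 2 ^ J + nw / 2 ^ J < e / 2" using J by (simp add: add_divide_distrib)
        ultimately have "nrm (0 - T n) < e" using n0[OF that] by linarith
        then show ?thesis using nrm_nonneg[OF V_diff[OF V_zero T_V]] by simp
      qed
      then show "\<exists>n0. \<forall>n\<ge>n0. norm (nrm (0 - T n) - 0) < e" by blast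
    qed
    then have "coef 0 = l" using Span_zero by (intro coef_eqI) (auto simp: expansion_def T_def)
    moreover have "coef 0 = (\<lambda>_. 0)" using coef_scale[OF Span_zero, of 0] by simp
    ultimately have "l i = 0" for i by metis
    then have "T n = 0" by (simp add: T_def)
    then show ?thesis using close[of 0 n] v0 by (simp add: nw_def)
  qed
  then show ?thesis using that[of "2 * C"] C by simp
qed

theorem coefficient_bound:
  obtains C where "0 \<le> C" "\<And>A a i. finite A \<Longrightarrow> i \<in> A \<Longrightarrow> \<bar>a i\<bar> \<le> C * nrm (\<Sum>j\<in>A. a j *\<^sub>R x j)"
proof -
  obtain C where C: "0 \<le> C" "\<And>w n. w \<in> Span \<Longrightarrow> nrm (psum w n) \<le> C * nrm w" using basis_constant by blast
  have "\<bar>a i\<bar> \<le> 2 * C * nrm (\<Sum>j\<in>A. a j *\<^sub>R x j)" if A: "finite A" "i \<in> A" for A a i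
  proof -
    define w where "w = (\<Sum>j\<in>A. a j *\<^sub>R x j)"
    have w: "w \<in> Span" unfolding w_def by (intro span_in_Span span_sum span_scale span_base) auto
    obtain m where m: "A \<subseteq> {..<m}" using A(1) finite_nat_iff_bounded by blast
    have "expansion w (\<lambda>j. if j \<in> A then a j else 0)"
      unfolding expansion_def
    proof (rule tendsto_eventually, rule eventually_mono[OF eventually_ge_at_top[of m]])
      fix n assume "m \<le> n"
      then have "(\<Sum>j<n. (if j \<in> A then a j else 0) *\<^sub>R x j) = w"
        unfolding w_def using m A(1) by (intro sum.mono_neutral_cong_right) auto
      then show "nrm (w - (\<Sum>j<n. (if j \<in> A then a j else 0) *\<^sub>R x j)) = 0" by (simp add: nrm_zero)
    qed
    then have "coef w i = a i" using coef_eqI[OF w] A(2) by simp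
    then show ?thesis using coef_le[of w "C * nrm w" i] C(2)[OF w] by (simp add: w_def)
  qed
  then show ?thesis using that[of "2 * C"] C(1) by simp
qed

end

context exponents
begin

lemma scaleR_sum_fun: "(\<Sum>i\<in>A. a i *\<^sub>R x i) = (\<lambda>n. \<Sum>i\<in>A. a i * x i n)" for x :: "'i \<Rightarrow> nat \<Rightarrow> real"
  by (simp add: fun_eq_iff sum_fun_apply scaleR_fun_def)

text \<open>Otherwise a subsequence has a coordinatewise limit \<open>z \<noteq> 0\<close>.  Cesaro means of an \<open>\<ell>\<^sub>p\<close> subsequence of the
  differences tend to zero, so means over arbitrarily late terms approximate \<open>z\<close>; bounded coefficient functionals
  then force every coefficient of \<open>z\<close> to vanish.\<close>

theorem basic_sequence_coordinate_null:
  assumes basic: "basic_sequence X N x" and norm1: "normalized N x"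
  shows "(\<lambda>k. x k n0) \<longlonglongrightarrow> 0"
proof (rule ccontr)
  assume not: "\<not> (\<lambda>k. x k n0) \<longlonglongrightarrow> 0"
  interpret B: normalized_basic_sequence X N x
    by unfold_locales (use normed_space_X banach_space_X basic norm1 in \<open>auto simp: normalized_def\<close>)
  have xX: "x k \<in> X" and xN: "N (x k) = 1" for k using B.x_V B.norm1 by auto
  obtain \<delta> where \<delta>: "\<delta> > 0" and inf: "\<And>k0. \<exists>k\<ge>k0. \<delta> \<le> \<bar>x k n0\<bar>"
    using not unfolding LIMSEQ_def dist_real_def by (auto simp: not_less)
  define Z where "Z = {k. \<delta> \<le> \<bar>x k n0\<bar>}"
  have Z: "infinite Z" unfolding infinite_nat_iff_unbounded_le Z_def using inf by auto
  define s0 where "s0 = enumerate Z"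
  have s0: "strict_mono s0" "\<And>k. \<delta> \<le> \<bar>x (s0 k) n0\<bar>"
    using strict_mono_enumerate[OF Z] enumerate_in_set[OF Z] by (auto simp: s0_def Z_def)
  have "\<bar>x (s0 k) c\<bar> \<le> 1" for k c using coordinate_le_N[OF xX] xN by metis
  then obtain s1 z where s1: "strict_mono s1" and z: "\<And>c. (\<lambda>k. x (s0 (s1 k)) c) \<longlonglongrightarrow> z c"
    using diagonal_convergence[of "\<lambda>k. x (s0 k)" 1] by blast
  have zX: "z \<in> X" "N z \<le> 1"
    using coordinate_limit[of "\<lambda>k. x (s0 (s1 k))" 1 z] xX xN z by auto
  have "\<delta> \<le> \<bar>z n0\<bar>" by (rule tendsto_lowerbound[OF tendsto_rabs[OF z]]) (use s0(2) in auto)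
  define u where "u k = (\<lambda>n. (1/2) * (x (s0 (s1 k)) n - z n))" for k
  have u: "u k \<in> X" "N (u k) \<le> 1" for k
  proof -
    show "u k \<in> X" unfolding u_def by (intro scale_mem_X diff_mem_X xX zX(1))
    have "N (u k) = (1/2) * N (\<lambda>n. x (s0 (s1 k)) n - z n)"
      unfolding u_def using N_scale[OF diff_mem_X[OF xX zX(1)], of "1/2" "s0 (s1 k)"] by simp
    then show "N (u k) \<le> 1"
      using N_triangle_diff[OF xX zX(1), of "s0 (s1 k)"] xN[of "s0 (s1 k)"] zX(2) by linarith
  qed
  have "(\<lambda>k. u k n) \<longlonglongrightarrow> (1/2) * (z n - z n)" for n
    unfolding u_def by (intro tendsto_intros z)
  then have null: "(\<lambda>k. u k n) \<longlonglongrightarrow> 0" for n by simp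
  obtain \<rho> :: "nat \<Rightarrow> nat" where \<rho>: "strict_mono \<rho>"
    and up: "\<And>K a. finite K \<Longrightarrow> N (\<lambda>n. \<Sum>k\<in>K. a k * u (\<rho> k) n) \<le> 5/2 * pnorm p K a"
    using lp_subsequence[OF u null] by metis
  define q where "q = s0 \<circ> s1 \<circ> \<rho>"
  have q: "strict_mono q" unfolding q_def using s0(1) s1 \<rho> by (intro strict_mono_o)
  define avg where "avg L m = (\<Sum>k\<in>{L..<L+m}. (1 / real m) *\<^sub>R x (q k))" for L m :: nat
  have avg: "N (z - avg L m) \<le> 5 * (real m powr (1 / p) / real m)" if m: "m > 0" for L m
  proof -
    have sum1: "(\<Sum>k\<in>{L..<L+m}. (1 / real m) * c) = c" for c :: real using m by simp
    have eq: "z - avg L m = (\<lambda>n. (-2) * (\<Sum>k\<in>{L..<L+m}. (1 / real m) * u (\<rho> k) n))"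
    proof
      fix n
      have "(\<Sum>k\<in>{L..<L+m}. (1 / real m) * u (\<rho> k) n) = (\<Sum>k\<in>{L..<L+m}. (1/2) * ((1 / real m) * x (q k) n) - (1/2) * ((1 / real m) * z n))"
        by (intro sum.cong) (auto simp: u_def q_def algebra_simps)
      also have "\<dots> = (1/2) * (\<Sum>k\<in>{L..<L+m}. (1 / real m) * x (q k) n) - (1/2) * (\<Sum>k\<in>{L..<L+m}. (1 / real m) * z n)"
        unfolding sum_subtractf sum_distrib_left ..
      also have "\<dots> = (1/2) * (avg L m n - z n)"
        unfolding sum1 by (simp add: avg_def scaleR_sum_fun right_diff_distrib)
      finally show "(z - avg L m) n = (-2) * (\<Sum>k\<in>{L..<L+m}. (1 / real m) * u (\<rho> k) n)" by simp
    qed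
    have "N (z - avg L m) = 2 * N (\<lambda>n. \<Sum>k\<in>{L..<L+m}. (1 / real m) * u (\<rho> k) n)"
    proof -
      have "(\<lambda>n. \<Sum>k\<in>{L..<L+m}. (1 / real m) * u (\<rho> k) n) \<in> X"
        by (rule sum_mem_X) (simp_all add: u)
      then show ?thesis unfolding eq by (simp only: N_scale)
    qed
    also have "\<dots> \<le> 2 * (5/2 * pnorm p {L..<L+m} (\<lambda>_. (1 / real m) * 1))"
      using up[of "{L..<L+m}" "\<lambda>_. 1 / real m"] by simp
    also have "pnorm p {L..<L+m} (\<lambda>_. (1 / real m) * 1) = (1 / real m) * real m powr (1 / p)"
      by (subst pnorm_scale) (simp_all add: pnorm_card)
    also have "2 * (5/2 * (1 / real m * real m powr (1 / p))) = 5 * (real m powr (1 / p) / real m)" by simp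
    finally show ?thesis .
  qed
  have small: "\<exists>m>0. 5 * (real m powr (1 / p) / real m) < \<epsilon>" if "\<epsilon> > 0" for \<epsilon>
  proof -
    have "(\<lambda>m. 5 * (real m powr (1 / p) / real m)) \<longlonglongrightarrow> 5 * 0"
      by (intro tendsto_mult powr_inverse_average_tendsto_zero p_gt_1 tendsto_const)
    then have "eventually (\<lambda>m. 5 * (real m powr (1 / p) / real m) < \<epsilon>) sequentially"
      using order_tendstoD(2) that by fastforce
    then have "eventually (\<lambda>m. m > 0 \<and> 5 * (real m powr (1 / p) / real m) < \<epsilon>) sequentially"
      using eventually_gt_at_top[of 0] by eventually_elim simp
    then show ?thesis using eventually_happens'[OF sequentially_bot] by blast
  qed
  have avg_span: "avg L m \<in> span (range x)" for L m
    unfolding avg_def by (intro span_sum span_scale span_base) auto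
  have zW: "z \<in> B.Span"
  proof (rule B.Span_I[OF zX(1)])
    fix \<epsilon> :: real assume "\<epsilon> > 0"
    then obtain m where m: "m > 0" "5 * (real m powr (1 / p) / real m) < \<epsilon>" using small by blast
    then show "\<exists>y\<in>span (range x). N (z - y) < \<epsilon>" using avg[OF m(1), of 0] avg_span by (meson le_less_trans)
  qed
  obtain C where C: "0 \<le> C" "\<And>A a i. finite A \<Longrightarrow> i \<in> A \<Longrightarrow> \<bar>a i\<bar> \<le> C * N (\<Sum>j\<in>A. a j *\<^sub>R x j)"
    using B.coefficient_bound by blast
  have "B.coef z i = 0" for i
  proof -
    have "\<bar>B.coef z i\<bar> \<le> C * (2 * \<epsilon>)" if \<epsilon>: "\<epsilon> > 0" for \<epsilon>
    proof -
      obtain m where m: "m > 0" "5 * (real m powr (1 / p) / real m) < \<epsilon>" using small[OF \<epsilon>] by blast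
      have "eventually (\<lambda>n. n > i \<and> N (z - B.psum z n) < \<epsilon>) sequentially"
        using order_tendstoD(2)[OF B.psum_tendsto[OF zW] \<epsilon>] eventually_gt_at_top[of i] by eventually_elim simp
      then obtain n where n: "n > i" "N (z - B.psum z n) < \<epsilon>" using eventually_happens'[OF sequentially_bot] by blast
      define Q where "Q = q ` {Suc i..<Suc i + m}"
      define A where "A = {..<n} \<union> Q"
      define c where "c j = (if j < n then B.coef z j else 0) - (if j \<in> Q then 1 / real m else 0)" for j
      have finQ: "finite Q" by (simp add: Q_def)
      have A: "finite A" "i \<in> A" using n finQ by (auto simp: A_def)
      have "k \<le> q k" for k using strict_mono_imp_increasing[OF q] .
      then have "i \<notin> Q" unfolding Q_def by (metis atLeastLessThan_iff imageE not_less_eq_eq)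
      then have ci: "c i = B.coef z i" using n by (simp add: c_def)
      have "(\<Sum>j\<in>A. c j *\<^sub>R x j) = (\<Sum>j\<in>A. (if j < n then B.coef z j else 0) *\<^sub>R x j) - (\<Sum>j\<in>A. (if j \<in> Q then 1 / real m else 0) *\<^sub>R x j)"
        by (simp add: c_def scaleR_diff_left sum_subtractf)
      also have "(\<Sum>j\<in>A. (if j < n then B.coef z j else 0) *\<^sub>R x j) = B.psum z n"
        unfolding B.psum_def using A(1) by (intro sum.mono_neutral_cong_right) (auto simp: A_def)
      also have "(\<Sum>j\<in>A. (if j \<in> Q then 1 / real m else 0) *\<^sub>R x j) = (\<Sum>j\<in>Q. (1 / real m) *\<^sub>R x j)"
        using A(1) by (intro sum.mono_neutral_cong_right) (auto simp: A_def)
      also have "\<dots> = avg (Suc i) m"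
        unfolding Q_def avg_def using strict_mono_imp_inj_on[OF q] by (subst sum.reindex) (auto intro: inj_on_subset)
      finally have sumA: "(\<Sum>j\<in>A. c j *\<^sub>R x j) = B.psum z n - avg (Suc i) m" .
      have aV: "avg (Suc i) m \<in> X" using avg_span B.span_subset_V by blast
      have "N (B.psum z n - avg (Suc i) m) \<le> N (B.psum z n - z) + N (z - avg (Suc i) m)"
        by (intro B.nrm_triangle_via B.psum_V zX(1) aV)
      also have "\<dots> \<le> 2 * \<epsilon>"
        using n(2) B.nrm_commute[OF zX(1) B.psum_V] avg[OF m(1), of "Suc i"] m(2) by simp
      finally have "N (\<Sum>j\<in>A. c j *\<^sub>R x j) \<le> 2 * \<epsilon>" unfolding sumA .
      then show ?thesis using C(2)[OF A, of c] mult_left_mono[OF _ C(1)] unfolding ci by (meson order_trans)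
    qed
    then have "\<bar>B.coef z i\<bar> \<le> 0 + e" if "e > 0" for e
    proof -
      define \<epsilon> where "\<epsilon> = e / (2 * (C + 1))"
      have "\<epsilon> > 0" using that C(1) by (simp add: \<epsilon>_def)
      have "C * (2 * \<epsilon>) \<le> e" using that C(1) by (simp add: \<epsilon>_def field_simps)
      then show ?thesis using \<open>\<And>\<epsilon>. \<epsilon> > 0 \<Longrightarrow> \<bar>B.coef z i\<bar> \<le> C * (2 * \<epsilon>)\<close>[OF \<open>\<epsilon> > 0\<close>] by linarith
    qed
    then show ?thesis using field_le_epsilon[of "\<bar>B.coef z i\<bar>" 0] by simp
  qed
  then have "B.psum z n = 0" for n by (simp add: B.psum_def)
  then have "(\<lambda>n::nat. N z) \<longlonglongrightarrow> 0" using B.psum_tendsto[OF zW] by simp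
  then have "N z = 0" using LIMSEQ_const_iff by metis
  then show False using coordinate_le_N[OF zX(1), of n0] \<open>\<delta> \<le> \<bar>z n0\<bar>\<close> \<delta> by linarith
qed

lemma lp_norm_eq_pnorm: "finite {i. a i \<noteq> 0} \<Longrightarrow> lp_norm p a = pnorm p {i. a i \<noteq> 0} a"
  unfolding lp_norm_def pnorm_def by (subst suminf_finite[of "{i. a i \<noteq> 0}"]) auto

theorem basic_sequence_subsequence:
  assumes basic: "basic_sequence X N x" and norm1: "normalized N x"
  shows "\<exists>\<rho> :: nat \<Rightarrow> nat. strict_mono \<rho> \<and> K_equivalent 4 N (x \<circ> \<rho>) (lp_norm p) unit_vector"
proof -
  have x: "x k \<in> X" "N (x k) = 1" for k
    using basic norm1 by (auto simp: basic_sequence_def normalized_def)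
  obtain \<rho> :: "nat \<Rightarrow> nat" where \<rho>: "strict_mono \<rho>"
    and up: "\<And>K a. finite K \<Longrightarrow> N (\<lambda>n. \<Sum>k\<in>K. a k * x (\<rho> k) n) \<le> 5/2 * pnorm p K a"
    and low: "\<And>K a. finite K \<Longrightarrow> pnorm p K (\<lambda>k. a k * N (x (\<rho> k)))
        \<le> N (\<lambda>n. \<Sum>k\<in>K. a k * x (\<rho> k) n) + 1/5 * pnorm p K a"
    by (rule lp_subsequence[OF x(1) eq_refl[OF x(2)] basic_sequence_coordinate_null[OF basic norm1]]) blast
  have "K_equivalent 4 N (x \<circ> \<rho>) (lp_norm p) unit_vector"
    unfolding K_equivalent_def
  proof (rule exI[of _ "5/4"], rule conjI[rotated], rule exI[of _ "5/2"], intro conjI allI impI)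
    fix a :: "nat \<Rightarrow> real" assume fin: "finite {i. a i \<noteq> 0}"
    define K where "K = {i. a i \<noteq> 0}"
    have "(\<Sum>i | a i \<noteq> 0. a i *\<^sub>R unit_vector i) = a"
    proof
      fix n
      have "(\<Sum>i\<in>K. a i * unit_vector i n) = (\<Sum>i\<in>K. if i = n then a n else 0)"
        by (intro sum.cong) (auto simp: unit_vector_def)
      then show "(\<Sum>i | a i \<noteq> 0. a i *\<^sub>R unit_vector i) n = a n"
        using fin by (simp add: scaleR_sum_fun K_def)
    qed
    then have lp: "lp_norm p (\<Sum>i | a i \<noteq> 0. a i *\<^sub>R unit_vector i) = pnorm p K a"
      using lp_norm_eq_pnorm[OF fin] by (simp add: K_def)
    have v: "(\<Sum>i | a i \<noteq> 0. a i *\<^sub>R (x \<circ> \<rho>) i) = (\<lambda>n. \<Sum>k\<in>K. a k * x (\<rho> k) n)"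
      by (simp add: scaleR_sum_fun K_def)
    have K: "finite K" using fin by (simp add: K_def)
    show "N (\<Sum>i | a i \<noteq> 0. a i *\<^sub>R (x \<circ> \<rho>) i) \<le> 5/2 * lp_norm p (\<Sum>i | a i \<noteq> 0. a i *\<^sub>R unit_vector i)"
      unfolding lp v by (rule up[OF K])
    show "inverse (5/4) * lp_norm p (\<Sum>i | a i \<noteq> 0. a i *\<^sub>R unit_vector i) \<le> N (\<Sum>i | a i \<noteq> 0. a i *\<^sub>R (x \<circ> \<rho>) i)"
      unfolding lp v using low[OF K, of a] by (simp add: x(2))
  qed simp_all
  then show ?thesis using \<rho> by blast
qed

end

text \<open>With \<open>t\<close> the maximum of \<open>p\<close> and its conjugate exponent, both \<open>t \<ge> p\<close> and \<open>1/p + 1/t \<le> 1\<close> hold; the latter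
  gives \<open>r \<ge> 1\<close>, needed for the triangle inequality.\<close>

theorem theorem2p1:
  fixes p :: real
  assumes "1 < p"
  shows "\<exists>(X :: (nat \<Rightarrow> real) set) (N :: (nat \<Rightarrow> real) \<Rightarrow> real).
    banach_space_on X N \<and>
    reflexive_space X N \<and>
    infinite_dimensional X \<and>
    \<not> asymptotically_symmetric X N \<and>
    (\<forall>x :: nat \<Rightarrow> nat \<Rightarrow> real.
       basic_sequence X N x \<and> normalized N x \<longrightarrow>
       (\<exists>r :: nat \<Rightarrow> nat. strict_mono r \<and>
          K_equivalent 4 N (x \<circ> r) (lp_norm p) unit_vector))"
proof -
  define t where "t = max p (p / (p - 1))"
  define r where "r = inverse (1 / p + 1 / t)"
  have t: "t > 0" "p \<le> t" "p / (p - 1) \<le> t" using assms by (auto simp: t_def)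
  have "1 / t \<le> 1 / (p / (p - 1))" using t assms by (intro divide_left_mono) auto
  then have "1 / p + 1 / t \<le> 1" using assms by (simp add: field_simps)
  moreover have "1 / p + 1 / t > 0" using t assms by (simp add: add_pos_pos)
  ultimately have r: "1 \<le> r" "1 / r = 1 / p + 1 / t" by (simp_all add: r_def one_le_inverse_iff inverse_eq_divide)
  interpret exponents p t r by unfold_locales (use assms t r in auto)
  show ?thesis
    using banach_space_X reflexive_X infinite_dimensional_X not_asymptotically_symmetric basic_sequence_subsequence
    by blast
qed

end
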